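(* Let $d_1<d_2$ be relatively prime positive integers, let $\mathcal{B}=\{(u,v,w)\in\mathbb{R}^3: u^2+v^2+w^2\le 1\}$ be the unit ball, let $h=1-u^2-v^2-w^2$, and for $\epsilon>0$ let $\phi:\mathbb{R}^3\to\mathbb{R}^2$ be the map $$\phi(u,v,w)=\bigl(T_{d_1}(u)+\epsilon v,\;T_{d_2}(u)+\epsilon w\bigr),$$ where $T_d$ is the degree-$d$ Chebyshev polynomial of the first kind. If $\epsilon>0$ is sufficiently small, then: (1) the complement $\mathbb{R}^2\setminus\phi(\mathcal{B})$ has exactly $\frac{(d_1-1)(d_2-1)}{2}+1$ connected components; (2) the algebraic boundary of $\phi(\mathcal{B})$ is an irreducible curve of degree at most $4d_2-2$, and it is equal to the branch locus of the restriction of $\phi$ to the surface $\{h=0\}$.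
   Context: The Chebyshev polynomials of the first kind are defined by $T_0(t)=1$, $T_1(t)=t$, $T_{d+1}(t)=2tT_d(t)-T_{d-1}(t)$ for $d\ge1$. The algebraic boundary of $\phi(\mathcal{B})$ is the Zariski closure in $\mathbb{C}^2$ of the topological boundary of $\phi(\mathcal{B})\subset\mathbb{R}^2$. Writing $\phi=(f,g)$ and regarding it as a polynomial map $\mathbb{C}^3\to\mathbb{C}^2$, the branch locus of the restriction of $\phi$ to $\{h=0\}$ is the Zariski closure in $\mathbb{C}^2$ of the image under $\phi$ of the set of points of $\mathbb{C}^3$ where $h=0$ and the $3\times3$ Jacobian determinant of $(f,g,h)$ with respect to $(u,v,w)$ vanishes. *)

theory Defs
  imports "HOL-Analysis.Analysis" "HOL-Computational_Algebra.Polynomial_Factorial"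
begin

fun cheb :: "nat \<Rightarrow> 'a::comm_ring_1 poly" where
  "cheb 0 = 1"
| "cheb (Suc 0) = [:0, 1:]"
| "cheb (Suc (Suc d)) = [:0, 2:] * cheb (Suc d) - cheb d"

(* Polymorphic in the coefficient ring: used over the reals for the image of the ball
   and over the complex numbers for the branch locus. *)
definition phi :: "nat \<Rightarrow> nat \<Rightarrow> 'a::comm_ring_1 \<Rightarrow> 'a^3 \<Rightarrow> 'a^2" where
  "phi d1 d2 e p = vector [poly (cheb d1) (p $ 1) + e * p $ 2, poly (cheb d2) (p $ 1) + e * p $ 3]"

definition sphere_eq :: "'a::comm_ring_1^3 \<Rightarrow> 'a" where
  "sphere_eq p = 1 - (p $ 1)\<^sup>2 - (p $ 2)\<^sup>2 - (p $ 3)\<^sup>2"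

definition unit_ball :: "(real^3) set" where
  "unit_ball = {p. (p $ 1)\<^sup>2 + (p $ 2)\<^sup>2 + (p $ 3)\<^sup>2 \<le> 1}"

(* Elements of C[x,y] are represented in the type complex poly poly, i.e. C[x][y]:
   coeff (coeff P j) i is the coefficient of x^i y^j. *)
definition eval2 :: "complex poly poly \<Rightarrow> complex^2 \<Rightarrow> complex" where
  "eval2 P z = poly (poly P [:z $ 2:]) (z $ 1)"

definition total_deg :: "complex poly poly \<Rightarrow> nat" where
  "total_deg P = Max (insert 0 {i + j | i j. coeff (coeff P j) i \<noteq> 0})"

definition zariski_closure :: "(complex^2) set \<Rightarrow> (complex^2) set" where
  "zariski_closure S = {z. \<forall>P. (\<forall>s\<in>S. eval2 P s = 0) \<longrightarrow> eval2 P z = 0}"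

definition irreducible_plane_curve :: "(complex^2) set \<Rightarrow> nat \<Rightarrow> bool" where
  "irreducible_plane_curve C n \<longleftrightarrow>
     (\<exists>P. irreducible P \<and> total_deg P = n \<and> C = {z. eval2 P z = 0})"

definition complexify :: "real^2 \<Rightarrow> complex^2" where
  "complexify x = (\<chi> i. complex_of_real (x $ i))"

definition algebraic_boundary :: "(real^2) set \<Rightarrow> (complex^2) set" where
  "algebraic_boundary S = zariski_closure (complexify ` frontier S)"

definition partial_deriv :: "(complex^3 \<Rightarrow> complex) \<Rightarrow> 3 \<Rightarrow> complex^3 \<Rightarrow> complex" where
  "partial_deriv F j p = deriv (\<lambda>t. F (\<chi> k. if k = j then t else p $ k)) (p $ j)"

definition jacobian_det :: "(complex^3 \<Rightarrow> complex^3) \<Rightarrow> complex^3 \<Rightarrow> complex" where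
  "jacobian_det F p = det (\<chi> i j. partial_deriv (\<lambda>q. F q $ i) j p)"

definition branch_locus :: "(complex^3 \<Rightarrow> complex^2) \<Rightarrow> (complex^3 \<Rightarrow> complex) \<Rightarrow> (complex^2) set" where
  "branch_locus G h = zariski_closure
     (G ` {p. h p = 0 \<and> jacobian_det (\<lambda>q. vector [G q $ 1, G q $ 2, h q]) p = 0})"

end

theory Submission
  imports Defs "Subresultants.Subresultant_Gcd"
    "HOL-Computational_Algebra.Field_as_Ring"
    "HOL-Computational_Algebra.Fundamental_Theorem_Algebra"
begin

text \<open>
The image of the ball is a tube around the arc \<open>\<gamma>(u) = (T\<^sub>d\<^sub>1(u), T\<^sub>d\<^sub>2(u))\<close>, \<open>-1 \<le> u \<le> 1\<close>: the union of the
discs of radius \<open>\<epsilon> sqrt (1 - u\<^sup>2)\<close> around \<open>\<gamma>(u)\<close>.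

\<^bold>\<open>Components.\<close> Chebyshev polynomials commute, so \<open>\<gamma>\<close> runs on the curve \<open>F = 0\<close> for
\<open>F(x, y) = T\<^sub>d\<^sub>2(x) - T\<^sub>d\<^sub>1(y)\<close>, and by coprimality it fills the part of this curve in the square \<open>[-1, 1]\<^sup>2\<close>
(\<open>cheb_curve_param\<close>). In the coordinates \<open>arccos x\<close> and \<open>arccos y\<close> the curve becomes a pattern of diagonal
lines, which cuts out disjoint diamonds centred at the critical points of \<open>F\<close> with \<open>F \<noteq> 0\<close>. There are
\<open>(d\<^sub>1 - 1)(d\<^sub>2 - 1)/2\<close> of them (\<open>card_grid\<close>). A component of the complement of a thin tube that contains such a centre cannot
leave its diamond (\<open>component_in_diamond\<close>). Conversely every bounded component contains such a centre: \<open>\<bar>F\<bar>\<close> has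
a maximum on the closure of the component (\<open>bounded_component_contains_critical_point\<close>), and it is not
attained on the tube because from every boundary point of a thin tube with \<open>F \<noteq> 0\<close> there is a direction that leaves the
tube and increases \<open>\<bar>F\<bar>\<close> (\<open>escape_uniform\<close>). Such directions are found near each point of the arc by
passing to the limit of shrinking tubes, where the displacement from the tube boundary to the arc becomes
normal to the arc; the end points, where it may also point outwards, and the nodes need separate arguments.

\<^bold>\<open>Algebraic boundary.\<close> This part holds for every \<open>\<epsilon> > 0\<close>. The image of the critical points on the sphere
consists of the points \<open>(x, y)\<close> for which the polynomial
\<open>(x - T\<^sub>d\<^sub>1(u))\<^sup>2 + (y - T\<^sub>d\<^sub>2(u))\<^sup>2 - \<epsilon>\<^sup>2 (1 - u\<^sup>2)\<close> has a double root \<open>u\<close>. It is the zero set of the resultant of this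
polynomial and its derivative, whose degree is bounded by a weight argument (\<open>total_deg_branch_poly\<close>).
Over the \<open>u\<close>-line the critical points form a double cover \<open>s\<^sup>2 = D(u)\<close>. The polynomial \<open>D\<close> is real and changes
sign on the real line, so it is not a square; hence a polynomial in \<open>x, y\<close> that vanishes at infinitely many points of the image
vanishes on all of it (\<open>vanish_on_branch_curve\<close>). It follows that the image is the zero set of one
irreducible factor of the resultant, and that it is the Zariski closure of each of its infinite subsets, in
particular of the topological boundary of the tube.
\<close>

(* $ and \<bullet> denote coordinates and the inner product of real^n throughout *)
no_notation vec_index (infixl "$" 100)
no_notation scalar_prod (infix "\<bullet>" 70)

section \<open>Chebyshev polynomials\<close>

lemma cheb_cos: "poly (cheb d) (cos z) = cos (of_nat d * z)"
  for z :: "'a::{real_normed_field,banach}"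
proof (induction d rule: cheb.induct)
  case (3 d)
  define w where "w = of_nat (Suc d) * z"
  have e: "of_nat (Suc (Suc d)) * z = w + z" "of_nat d * z = w - z"
    by (simp_all add: w_def algebra_simps)
  show ?case using 3 unfolding e w_def[symmetric]
    by (simp add: cos_add cos_diff algebra_simps)
qed auto

lemma cheb_map_of_real:
  "(cheb d :: 'a::{real_algebra_1,comm_ring_1} poly) = map_poly of_real (cheb d)"
proof (induction d rule: cheb.induct)
  case (3 d)
  have h: "comm_ring_hom (of_real :: real \<Rightarrow> 'a)" by unfold_locales auto
  interpret map_poly_comm_ring_hom "of_real :: real \<Rightarrow> 'a" using h by (simp add: map_poly_comm_ring_hom_def)
  have "map_poly (of_real :: real \<Rightarrow> 'a) [:0, 2:] = [:0, 2:]"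
    by (simp add: map_poly_pCons)
  with 3 show ?case
    by (simp add: hom_mult hom_minus del: mult_pCons_left)
qed (auto simp: map_poly_pCons)

lemma poly_cheb_of_real: "poly (cheb d) (of_real x) = of_real (poly (cheb d) x)"
  for x :: real
  by (subst cheb_map_of_real) (rule of_real_hom.poly_map_poly)

lemma poly_pderiv_cheb_of_real:
  "poly (pderiv (cheb d)) (of_real x :: 'a::{real_algebra_1,comm_ring_1,idom}) = of_real (poly (pderiv (cheb d)) x)"
  by (subst cheb_map_of_real)
    (metis of_real_hom.map_poly_pderiv of_real_hom.poly_map_poly)

lemma pderiv_cheb_cos:
  "poly (pderiv (cheb d)) (cos z) * sin z = of_nat d * sin (of_nat d * z)"
  for z :: "'a::{real_normed_field,banach}"
proof -
  have "((\<lambda>z. poly (cheb d) (cos z)) has_field_derivative poly (pderiv (cheb d)) (cos z) * (- sin z)) (at z)"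
    by (rule DERIV_chain2[of "poly (cheb d)"]) (auto intro!: derivative_eq_intros poly_DERIV)
  moreover have "((\<lambda>z. cos (of_nat d * z)) has_field_derivative (- sin (of_nat d * z) * of_nat d)) (at z)"
    by (auto intro!: derivative_eq_intros)
  ultimately show ?thesis using DERIV_unique by (fastforce simp: cheb_cos)
qed

lemma pderiv2_cheb_cos:
  "poly (pderiv (pderiv (cheb d))) (cos z) * (sin z)\<^sup>2
     = poly (pderiv (cheb d)) (cos z) * cos z - (of_nat d)\<^sup>2 * poly (cheb d) (cos z)"
  for z :: "'a::{real_normed_field,banach}"
proof -
  have "((\<lambda>z. poly (pderiv (cheb d)) (cos z) * sin z) has_field_derivative
      (poly (pderiv (pderiv (cheb d))) (cos z) * (- sin z)) * sin z + cos z * poly (pderiv (cheb d)) (cos z)) (at z)"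
    by (rule DERIV_mult[OF DERIV_chain2[of "poly (pderiv (cheb d))"]])
      (auto intro!: derivative_eq_intros poly_DERIV)
  moreover have "((\<lambda>z. of_nat d * sin (of_nat d * z)) has_field_derivative (of_nat d * (cos (of_nat d * z) * of_nat d))) (at z)"
    by (auto intro!: derivative_eq_intros)
  ultimately have "(poly (pderiv (pderiv (cheb d))) (cos z) * (- sin z)) * sin z + cos z * poly (pderiv (cheb d)) (cos z)
     = of_nat d * (cos (of_nat d * z) * of_nat d)"
    using DERIV_unique by (fastforce simp: pderiv_cheb_cos)
  then show ?thesis by (simp add: cheb_cos power2_eq_square algebra_simps)
qed

lemma cheb_ode:
  "(1 - x\<^sup>2) * poly (pderiv (pderiv (cheb d))) x
     = x * poly (pderiv (cheb d)) x - (of_nat d)\<^sup>2 * poly (cheb d) x" for x :: complex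
  using pderiv2_cheb_cos[of d "Arccos x"] by (simp add: sin_squared_eq mult.commute)

text \<open>Pythagoras for \<open>cos (d z)\<close> and \<open>sin (d z)\<close>; every complex number is a
  cosine.\<close>
lemma cheb_pell:
  "(1 - x\<^sup>2) * (poly (pderiv (cheb d)) x)\<^sup>2 = (of_nat d)\<^sup>2 * (1 - (poly (cheb d) x)\<^sup>2)" for x :: complex
proof -
  have "(poly (pderiv (cheb d)) x * sin (Arccos x))\<^sup>2 = (of_nat d * sin (of_nat d * Arccos x))\<^sup>2"
    using pderiv_cheb_cos[of d "Arccos x"] by simp
  then show ?thesis
    using cheb_cos[of d "Arccos x"] by (simp add: power_mult_distrib sin_squared_eq mult.commute)
qed

lemma cheb_ode_real:
  "(1 - x\<^sup>2) * poly (pderiv (pderiv (cheb d))) x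
     = x * poly (pderiv (cheb d)) x - (real d)\<^sup>2 * poly (cheb d) x" for x :: real
proof -
  have e: "poly (pderiv (pderiv (cheb d))) (of_real x :: complex) = of_real (poly (pderiv (pderiv (cheb d))) x)"
    by (subst cheb_map_of_real)
      (metis of_real_hom.map_poly_pderiv of_real_hom.poly_map_poly)
  have "complex_of_real ((1 - x\<^sup>2) * poly (pderiv (pderiv (cheb d))) x)
     = of_real (x * poly (pderiv (cheb d)) x - (real d)\<^sup>2 * poly (cheb d) x)"
    using cheb_ode[of "of_real x" d] by (simp add: e poly_pderiv_cheb_of_real poly_cheb_of_real)
  then show ?thesis by (simp only: of_real_eq_iff)
qed

lemma cheb_pell_real:
  "(1 - x\<^sup>2) * (poly (pderiv (cheb d)) x)\<^sup>2 = (real d)\<^sup>2 * (1 - (poly (cheb d) x)\<^sup>2)" for x :: real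
proof -
  have "complex_of_real ((1 - x\<^sup>2) * (poly (pderiv (cheb d)) x)\<^sup>2)
     = of_real ((real d)\<^sup>2 * (1 - (poly (cheb d) x)\<^sup>2))"
    using cheb_pell[of "of_real x" d] by (simp add: poly_pderiv_cheb_of_real poly_cheb_of_real)
  then show ?thesis by (simp only: of_real_eq_iff)
qed

lemma cheb_one: "poly (cheb d) 1 = (1::'a::comm_ring_1)"
  by (induction d rule: cheb.induct) auto

lemma cheb_minus_one: "poly (cheb d) (-1) = ((-1) ^ d::'a::comm_ring_1)"
  by (induction d rule: cheb.induct) auto

lemma pderiv_cheb_unit:
  assumes "d > 0" "(u::complex)\<^sup>2 = 1" shows "poly (pderiv (cheb d)) u \<noteq> 0"
proof -
  have "u = 1 \<or> u = -1" using assms(2) by (simp add: power2_eq_1_iff)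
  then show ?thesis using cheb_ode[of u d] assms by (auto simp: cheb_one cheb_minus_one)
qed

lemma pderiv_cheb_zeroD:
  assumes "d > 0" "poly (pderiv (cheb d)) (cos z) = (0::complex)"
  shows "sin z \<noteq> 0" "sin (of_nat d * z) = 0"
proof -
  show "sin z \<noteq> 0" using pderiv_cheb_unit[of d "cos z"] assms
    by (auto simp: cos_squared_eq)
  show "sin (of_nat d * z) = 0" using pderiv_cheb_cos[of d z] assms by auto
qed

text \<open>A common zero \<open>cos z\<close> of the derivatives makes \<open>d\<^sub>1 z\<close> and
  \<open>d\<^sub>2 z\<close> multiples of \<open>\<pi>\<close>. By Bezout so is \<open>z\<close>, that
  is \<open>cos z = \<plusminus>1\<close>, where the differential equation shows that the derivatives
  do not vanish. Hence the curve \<open>(T\<^sub>d\<^sub>1, T\<^sub>d\<^sub>2)\<close> is immersed.\<close>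
lemma pderiv_cheb_no_common_zero:
  assumes "d1 > 0" "d2 > 0" "coprime d1 d2"
  shows "poly (pderiv (cheb d1)) u \<noteq> 0 \<or> poly (pderiv (cheb d2)) (u::complex) \<noteq> 0"
proof (rule ccontr)
  assume nz: "\<not> ?thesis"
  define z where "z = Arccos u"
  have u: "u = cos z" by (simp add: z_def)
  have s: "sin z \<noteq> 0" "sin (of_nat d1 * z) = 0" "sin (of_nat d2 * z) = 0"
    using pderiv_cheb_zeroD[of d1 z] pderiv_cheb_zeroD[of d2 z] assms nz unfolding u by auto
  obtain m n where m: "of_nat d1 * z = of_real (of_int m * pi)" and n: "of_nat d2 * z = of_real (of_int n * pi)"
    using s(2,3) by (auto simp: sin_eq_0)
  have "coprime (int d1) (int d2)" using assms(3) by simp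
  then obtain a b where ab: "a * int d1 + b * int d2 = 1"
    by (metis bezout_int coprime_imp_gcd_eq_1)
  have "z = of_int (a * int d1 + b * int d2) * z" unfolding ab by simp
  also have "\<dots> = of_int a * (of_nat d1 * z) + of_int b * (of_nat d2 * z)" by (simp add: algebra_simps)
  also have "\<dots> = of_real (of_int (a * m + b * n) * pi)" unfolding m n by (simp add: algebra_simps)
  finally have "sin z = of_real (sin (of_int (a * m + b * n) * pi))" by (metis sin_of_real)
  also have "\<dots> = 0" by (metis sin_int_times_real mult.commute of_real_0 sin_npi_int)
  finally show False using s(1) by simp
qed

lemma pderiv_cheb_no_common_zero_real:
  assumes "d1 > 0" "d2 > 0" "coprime d1 d2"
  shows "poly (pderiv (cheb d1)) u \<noteq> 0 \<or> poly (pderiv (cheb d2)) (u::real) \<noteq> 0"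
  using pderiv_cheb_no_common_zero[OF assms, of "of_real u"] by (auto simp: poly_pderiv_cheb_of_real)

text \<open>Working with a complex angle excludes critical points outside \<open>[-1, 1]\<close> as well.\<close>
lemma pderiv_cheb_critical:
  assumes "d > 0" "poly (pderiv (cheb d)) x = (0::real)"
  obtains i where "0 < i" "i < d" "x = cos (real i * pi / real d)"
proof -
  define z where "z = Arccos (of_real x)"
  have x: "of_real x = cos z" by (simp add: z_def)
  have s: "sin z \<noteq> 0" "sin (of_nat d * z) = 0"
    using pderiv_cheb_zeroD[of d z] assms unfolding x[symmetric] by (simp_all add: poly_pderiv_cheb_of_real)
  obtain m where m: "of_nat d * z = of_real (of_int m * pi)"
    using s(2) by (auto simp: sin_eq_0)
  have z: "z = of_real (of_int m * pi / d)" using m assms by (simp add: field_simps)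
  have xc: "x = cos (of_int m * pi / d)" using x unfolding z
    by (metis cos_of_real of_real_eq_iff)
  have "x\<^sup>2 \<noteq> 1"
  proof
    assume "x\<^sup>2 = 1"
    then have "(sin z)\<^sup>2 = 0" unfolding sin_squared_eq x[symmetric]
      by (metis of_real_1 of_real_power right_minus_eq)
    with s show False by simp
  qed
  then have "-1 < x" "x < 1" using xc by (auto simp: less_le power2_eq_1_iff)
  define t where "t = arccos x"
  have t: "0 < t" "t < pi" "cos t = x" using \<open>-1 < x\<close> \<open>x < 1\<close> arccos_lt_bounded
    by (auto simp: t_def)
  have "sin (real d * t) = 0" using pderiv_cheb_cos[of d t] assms t by simp
  then obtain k where k: "real d * t = of_int k * pi" by (auto simp: sin_zero_iff_int2)
  have "of_int k * pi > 0" unfolding k[symmetric] using assms t by simp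
  then have "k > 0" by (simp add: zero_less_mult_iff)
  have "of_int k * pi < real d * pi" unfolding k[symmetric] using assms t by simp
  then have "k < int d" by simp
  show ?thesis
  proof
    show "0 < nat k" "nat k < d" using \<open>k > 0\<close> \<open>k < int d\<close> by auto
    have "t = real (nat k) * pi / real d" using k \<open>k > 0\<close> assms by (simp add: field_simps)
    then show "x = cos (real (nat k) * pi / real d)" using t by simp
  qed
qed

lemma cheb_at_critical:
  assumes "d > 0" shows "poly (cheb d) (cos (real i * pi / real d)) = (-1) ^ i"
  using assms by (simp add: cheb_cos cos_npi mult.commute)

lemma cheb_commute:
  "poly (cheb m) (poly (cheb n) u) = poly (cheb n) (poly (cheb m) u)" for u :: real
proof -
  define z where "z = Arccos (of_real u)"
  have "poly (cheb m) (poly (cheb n) (cos z)) = poly (cheb n) (poly (cheb m) (cos z))"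
    unfolding cheb_cos by (simp add: algebra_simps)
  moreover have "cos z = of_real u" by (simp add: z_def)
  ultimately show ?thesis by (simp add: poly_cheb_of_real)
qed

text \<open>This is where coprimality enters: the parametrised arc fills all of the plane curve
  \<open>T\<^sub>d\<^sub>2(x) = T\<^sub>d\<^sub>1(y)\<close> inside the square. With \<open>x = cos
  a\<close> and \<open>y = cos b\<close> the equation says \<open>d\<^sub>2 a \<equiv>
  \<plusminus>d\<^sub>1 b\<close> modulo \<open>2\<pi>\<close>, and the parameter is \<open>cos
  t\<close> for an angle \<open>t\<close> with \<open>d\<^sub>1 t \<equiv> a\<close> and
  \<open>d\<^sub>2 t \<equiv> \<plusminus>b\<close>.\<close>
lemma cheb_curve_param:
  assumes "d1 > 0" "d2 > 0" "coprime d1 d2" "\<bar>x\<bar> \<le> 1" "\<bar>y\<bar> \<le> (1::real)"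
    "poly (cheb d2) x = poly (cheb d1) y"
  obtains u where "\<bar>u\<bar> \<le> 1" "x = poly (cheb d1) u" "y = poly (cheb d2) u"
proof -
  obtain a where a: "x = cos a" using assms by (metis cos_arccos_abs)
  obtain b where b: "y = cos b" using assms by (metis cos_arccos_abs)
  have "cos (d2 * a) = cos (d1 * b)" using assms unfolding a b cheb_cos by simp
  then obtain n where "n \<in> \<int>" "d2 * a = d1 * b + 2 * n * pi \<or> d2 * a = - (d1 * b) + 2 * n * pi"
    by (auto simp: cos_eq)
  moreover from this obtain k where "n = of_int k" by (auto elim: Ints_cases)
  ultimately have "d2 * a = d1 * b + 2 * of_int k * pi \<or> d2 * a = - (d1 * b) + 2 * of_int k * pi" by simp
  then obtain s :: real where s: "s = b \<or> s = -b" "d2 * a = d1 * s + 2 * of_int k * pi" by fastforce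
  have "coprime (int d1) (int d2)" using assms(3) by simp
  then obtain p q where pq: "p * int d1 + q * int d2 = 1"
    by (metis bezout_int coprime_imp_gcd_eq_1)
  \<comment> \<open>shift the angle by a multiple of \<open>2\<pi>\<close> chosen so that the remaining multiple becomes divisible by \<open>d1\<close>\<close>
  define t where "t = (a + 2 * of_int (- k * q) * pi) / d1"
  have t1: "d1 * t = a + 2 * of_int (- k * q) * pi" using assms by (simp add: t_def)
  have "d1 * (d2 * t) = d2 * a + 2 * of_int (- k * q) * pi * d2" using arg_cong[OF t1, of "\<lambda>v. d2 * v"] by (simp add: algebra_simps)
  also have "\<dots> = d1 * s + 2 * of_int (k * (1 - q * int d2)) * pi" using s by (simp add: algebra_simps)
  also have "1 - q * int d2 = p * int d1" using pq by simp
  also have "d1 * s + 2 * of_int (k * (p * int d1)) * pi = d1 * (s + 2 * of_int (k * p) * pi)" by (simp add: algebra_simps)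
  finally have t2: "d2 * t = s + 2 * of_int (k * p) * pi" using assms by simp
  have c: "cos (v + 2 * of_int j * pi) = cos v" for v j
    using cos_eq[of "v + 2 * of_int j * pi" v] by (auto simp: mult_ac intro!: exI[of _ "of_int j"])
  show ?thesis
  proof
    show "\<bar>cos t\<bar> \<le> 1" by simp
    show "x = poly (cheb d1) (cos t)" unfolding cheb_cos t1 c a ..
    show "y = poly (cheb d2) (cos t)" unfolding cheb_cos t2 c b using s(1) by auto
  qed
qed

lemma degree_cheb: "degree (cheb d :: 'a::{idom,ring_char_0} poly) = d \<and> lead_coeff (cheb d :: 'a poly) = 2 ^ (d - 1)"
proof (induction d rule: cheb.induct)
  case (3 d)
  let ?P = "[:0, 2:] * cheb (Suc d) :: 'a poly"
  have "cheb (Suc d) \<noteq> (0 :: 'a poly)" using 3 by (metis leading_coeff_0_iff zero_neq_numeral power_eq_0_iff)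
  then have d: "degree ?P = Suc (Suc d)" using 3 by (subst degree_mult_eq) auto
  have l: "degree (cheb d :: 'a poly) < degree ?P" using 3 d by simp
  have l1: "coeff (cheb (Suc d)) (Suc d) = (2 ^ d :: 'a)"
  proof -
    have "degree (cheb (Suc d) :: 'a poly) = Suc d" using 3 by blast
    moreover have "lead_coeff (cheb (Suc d) :: 'a poly) = 2 ^ (Suc d - 1)" using 3 by blast
    ultimately show ?thesis by simp
  qed
  have "degree (?P - cheb d) = degree ?P" using degree_add_eq_left[of "- cheb d" ?P] l by simp
  moreover have "lead_coeff ?P = 2 ^ (Suc d)" using 3 l1 by (simp add: lead_coeff_mult del: mult_pCons_left)
  ultimately show ?case using d l by (simp add: coeff_eq_0 del: mult_pCons_left)
qed auto

section \<open>Bounded components of the complement of a tube\<close>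

text \<open>The discs touched by \<open>p\<close> are left at first order in the direction \<open>X\<close>, and
  by compactness of the parameter set the other discs stay away. The estimate has to be uniform for
  starting points \<open>z\<close> near \<open>p\<close>, because it is applied to points of a
  component that has \<open>p\<close> only on its boundary.\<close>
lemma push_off_tube:
  fixes gam :: "'b::metric_space \<Rightarrow> 'a::euclidean_space" and rad :: "'b \<Rightarrow> real"
  assumes I: "compact I" "continuous_on I gam" "continuous_on I rad"
    and p: "\<And>u. u \<in> I \<Longrightarrow> (norm (p - gam u))\<^sup>2 \<ge> rad u"
    and X: "\<And>u. u \<in> I \<Longrightarrow> (norm (p - gam u))\<^sup>2 = rad u \<Longrightarrow> X \<bullet> (p - gam u) > 0"
  shows "\<exists>\<delta>>0. \<forall>z t. dist z p < \<delta> \<and> (\<forall>u\<in>I. (norm (z - gam u))\<^sup>2 > rad u) \<and> 0 \<le> t \<and> t \<le> \<delta>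
           \<longrightarrow> (\<forall>u\<in>I. (norm (z + t *\<^sub>R X - gam u))\<^sup>2 > rad u)"
proof (rule ccontr)
  assume "\<not> ?thesis"
  then have "\<forall>\<delta>>0. \<exists>z t u. dist z p < \<delta> \<and> (\<forall>u\<in>I. (norm (z - gam u))\<^sup>2 > rad u) \<and> 0 \<le> t \<and> t \<le> \<delta>
           \<and> u \<in> I \<and> (norm (z + t *\<^sub>R X - gam u))\<^sup>2 \<le> rad u"
    by (meson not_le)
  then have "\<forall>n. \<exists>z t u. dist z p < inverse (Suc n) \<and> (\<forall>u\<in>I. (norm (z - gam u))\<^sup>2 > rad u) \<and> 0 \<le> t \<and> t \<le> inverse (Suc n)
           \<and> u \<in> I \<and> (norm (z + t *\<^sub>R X - gam u))\<^sup>2 \<le> rad u"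
    by (metis inverse_positive_iff_positive of_nat_0_less_iff zero_less_Suc)
  then obtain z t u where *: "\<And>n. dist (z n) p < inverse (Suc n)"
      "\<And>n v. v \<in> I \<Longrightarrow> (norm (z n - gam v))\<^sup>2 > rad v" "\<And>n. 0 \<le> t n" "\<And>n. t n \<le> inverse (Suc n)"
      "\<And>n. u n \<in> I" "\<And>n. (norm (z n + t n *\<^sub>R X - gam (u n)))\<^sup>2 \<le> rad (u n)"
    by metis
  obtain l r where r: "l \<in> I" "strict_mono (r :: nat \<Rightarrow> nat)" "(u \<circ> r) \<longlonglongrightarrow> l"
    using I(1) *(5) unfolding compact_def by metis
  have z: "z \<longlonglongrightarrow> p"
    using *(1) by (intro metric_tendsto_imp_tendsto[OF LIMSEQ_inverse_real_of_nat])
      (auto intro!: eventuallyI less_imp_le simp: dist_norm)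
  have t: "t \<longlonglongrightarrow> 0"
    by (rule tendsto_sandwich[OF _ _ tendsto_const LIMSEQ_inverse_real_of_nat]) (intro eventuallyI *(3,4))+
  have zr: "(\<lambda>n. z (r n)) \<longlonglongrightarrow> p" and tr: "(\<lambda>n. t (r n)) \<longlonglongrightarrow> 0"
    using LIMSEQ_subseq_LIMSEQ[OF z r(2)] LIMSEQ_subseq_LIMSEQ[OF t r(2)] by (auto simp: o_def)
  have ur: "(\<lambda>n. u (r n)) \<longlonglongrightarrow> l" using r(3) by (simp add: o_def)
  have gr: "(\<lambda>n. gam (u (r n))) \<longlonglongrightarrow> gam l" and rr: "(\<lambda>n. rad (u (r n))) \<longlonglongrightarrow> rad l"
    by (auto intro!: continuous_on_tendsto_compose[OF I(2)] continuous_on_tendsto_compose[OF I(3)] ur r(1) * eventuallyI)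
  have "(\<lambda>n. (norm (z (r n) + t (r n) *\<^sub>R X - gam (u (r n))))\<^sup>2) \<longlonglongrightarrow> (norm (p + 0 *\<^sub>R X - gam l))\<^sup>2"
    by (intro tendsto_intros zr tr gr)
  then have "(norm (p + 0 *\<^sub>R X - gam l))\<^sup>2 \<le> rad l"
    by (rule LIMSEQ_le[OF _ rr]) (use * in auto)
  then have "X \<bullet> (p - gam l) > 0" using X[OF r(1)] p[OF r(1)] by simp
  moreover have "(\<lambda>n. X \<bullet> (z (r n) - gam (u (r n)))) \<longlonglongrightarrow> X \<bullet> (p - gam l)"
    by (intro tendsto_intros zr gr)
  ultimately have "\<forall>\<^sub>F n in sequentially. X \<bullet> (z (r n) - gam (u (r n))) > 0"
    by (rule order_tendstoD(1)[rotated])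
  then obtain n where n: "X \<bullet> (z (r n) - gam (u (r n))) > 0"
    by (auto simp: eventually_sequentially)
  define m where "m = r n"
  define w where "w = z m - gam (u m)"
  have "(norm (z m + t m *\<^sub>R X - gam (u m)))\<^sup>2 = (norm (w + t m *\<^sub>R X))\<^sup>2" by (simp add: w_def algebra_simps)
  also have "\<dots> = (norm w)\<^sup>2 + 2 * t m * (X \<bullet> w) + (t m)\<^sup>2 * (norm X)\<^sup>2"
    unfolding power2_norm_eq_inner by (simp add: inner_add inner_commute power2_eq_square algebra_simps)
  also have "\<dots> \<ge> (norm w)\<^sup>2" using n *(3)[of m] by (simp add: m_def w_def)
  finally have "(norm w)\<^sup>2 \<le> rad (u m)" using *(6)[of m] by linarith
  then show False using *(2)[of "u m" m] *(5) by (simp add: w_def not_le)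
qed

text \<open>Take a maximum point \<open>p\<close> of \<open>\<bar>F\<bar>\<close> on the closure of
  \<open>C\<close>. If \<open>p\<close> were on the tube, points of \<open>C\<close> near
  \<open>p\<close> could be pushed along the escape direction without leaving \<open>C\<close>, and
  \<open>\<bar>F\<bar>\<close> would exceed its maximum. So \<open>p\<close> lies in the open set
  \<open>C\<close> and is a critical point.\<close>
lemma bounded_component_contains_critical_point:
  fixes gam :: "'b::metric_space \<Rightarrow> 'a::euclidean_space" and rad :: "'b \<Rightarrow> real" and I :: "'b set" and F :: "'a \<Rightarrow> real"
  defines "S \<equiv> {z. \<exists>u\<in>I. (norm (z - gam u))\<^sup>2 \<le> rad u}"
  assumes I: "compact I" "continuous_on I gam" "continuous_on I rad" and S: "closed S"
    and F: "\<And>z. (F has_derivative (\<lambda>h. grd z \<bullet> h)) (at z)"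
    and nz: "\<And>U. open U \<Longrightarrow> U \<noteq> {} \<Longrightarrow> \<exists>z\<in>U. F z \<noteq> 0"
    and escape: "\<And>p. F p \<noteq> 0 \<Longrightarrow> (\<And>u. u \<in> I \<Longrightarrow> (norm (p - gam u))\<^sup>2 \<ge> rad u) \<Longrightarrow>
       \<exists>u\<in>I. (norm (p - gam u))\<^sup>2 = rad u \<Longrightarrow>
       \<exists>X. (\<forall>u\<in>I. (norm (p - gam u))\<^sup>2 = rad u \<longrightarrow> X \<bullet> (p - gam u) > 0) \<and> sgn (F p) * (grd p \<bullet> X) > 0"
    and C: "C \<in> components (-S)" "bounded C"
  shows "\<exists>p\<in>C. F p \<noteq> 0 \<and> grd p = 0"
proof -
  have oC: "open C" using C(1) S by (metis open_components open_Compl)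
  have neC: "C \<noteq> {}" and CS: "C \<subseteq> -S" using C(1) in_components_nonempty in_components_subset by blast+
  have contF: "continuous_on A F" for A
    using F has_derivative_continuous continuous_at_imp_continuous_on by blast
  have cl: "compact (closure C)" "closure C \<noteq> {}" using C(2) neC by (auto simp: compact_closure)
  have "continuous_on (closure C) (\<lambda>z. \<bar>F z\<bar>)" by (intro continuous_intros contF)
  then obtain p where p: "p \<in> closure C" "\<And>z. z \<in> closure C \<Longrightarrow> \<bar>F z\<bar> \<le> \<bar>F p\<bar>"
    using continuous_attains_sup[OF cl] by blast
  obtain z0 where "z0 \<in> C" "F z0 \<noteq> 0" using nz[OF oC neC] by blast
  then have Fp: "F p \<noteq> 0" using p(2)[of z0] closure_subset[of C] by auto
  have sF: "\<bar>F z\<bar> \<ge> sgn (F p) * F z" for z by (auto simp: sgn_if)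
  have sFp: "\<bar>F p\<bar> = sgn (F p) * F p" by (auto simp: sgn_if)
  \<comment> \<open>a direction in which \<open>\<bar>F\<bar>\<close> increases at first order leads to larger values\<close>
  have inc: "\<exists>t0>0. \<forall>t. 0 < t \<and> t < t0 \<longrightarrow> sgn (F p) * F (p + t *\<^sub>R X) > \<bar>F p\<bar>"
    if "sgn (F p) * (grd p \<bullet> X) > 0" for X
  proof -
    have 1: "((\<lambda>t. p + t *\<^sub>R X) has_vector_derivative X) (at 0)"
      by (auto intro!: derivative_eq_intros)
    have "((\<lambda>t. F (p + t *\<^sub>R X)) has_vector_derivative grd p \<bullet> X) (at 0)"
      using vector_derivative_diff_chain_within[OF 1, of F "\<lambda>h. grd p \<bullet> h" ] F[of p]
      by (simp add: o_def has_derivative_at_withinI)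
    then have "((\<lambda>t. sgn (F p) * F (p + t *\<^sub>R X)) has_real_derivative sgn (F p) * (grd p \<bullet> X)) (at 0)"
      by (auto intro!: derivative_eq_intros simp: has_real_derivative_iff_has_vector_derivative[symmetric])
    from DERIV_pos_inc_right[OF this that] show ?thesis using sFp by auto
  qed
  show ?thesis
  proof (cases "p \<in> C")
    case True
    have "grd p = 0"
    proof (rule ccontr)
      assume g: "grd p \<noteq> 0"
      define X where "X = sgn (F p) *\<^sub>R grd p"
      have "sgn (F p) * (grd p \<bullet> X) > 0" using g Fp by (simp add: X_def sgn_if)
      then obtain t0 where t0: "t0 > 0" "\<And>t. 0 < t \<Longrightarrow> t < t0 \<Longrightarrow> sgn (F p) * F (p + t *\<^sub>R X) > \<bar>F p\<bar>"
        using inc by blast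
      have "((\<lambda>t. p + t *\<^sub>R X) \<longlongrightarrow> p + 0 *\<^sub>R X) (at_right 0)" by (intro tendsto_intros)
      then have "\<forall>\<^sub>F t in at_right 0. p + t *\<^sub>R X \<in> C"
        using topological_tendstoD[OF _ oC] True by simp
      moreover have "\<forall>\<^sub>F t in at_right (0::real). 0 < t \<and> t < t0"
        using t0(1) eventually_at_right_real by (auto simp: greaterThanLessThan_def)
      ultimately have "\<forall>\<^sub>F t in at_right (0::real). False"
      proof eventually_elim
        case (elim t)
        then show ?case using t0(2)[of t] p(2)[of "p + t *\<^sub>R X"] sF[of "p + t *\<^sub>R X"] closure_subset[of C]
          by (auto simp: not_le[symmetric])
      qed
      then show False by simp
    qed
    then show ?thesis using True Fp by blast
  next
    case False
    have pS: "p \<in> S"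
    proof (rule ccontr)
      assume "p \<notin> S"
      then obtain C' where C': "C' \<in> components (-S)" "p \<in> C'" by (metis ComplI UnionE Union_components)
      have "open C'" using C'(1) S by (metis open_components open_Compl)
      then have "C' \<inter> C \<noteq> {}" using p(1) C'(2) by (metis IntI closure_iff_nhds_not_empty empty_iff inf_commute order_refl)
      then show False using C' C(1) False components_nonoverlap by blast
    qed
    have psi: "(norm (p - gam u))\<^sup>2 \<ge> rad u" if "u \<in> I" for u
    proof -
      have "C \<subseteq> {z. (norm (z - gam u))\<^sup>2 \<ge> rad u}" using CS that by (force simp: S_def)
      moreover have "closed {z. (norm (z - gam u))\<^sup>2 \<ge> rad u}" by (intro closed_Collect_le continuous_intros)
      ultimately show ?thesis using p(1) closure_minimal by blast
    qed
    obtain u where u: "u \<in> I" "(norm (p - gam u))\<^sup>2 \<le> rad u" using pS unfolding S_def by blast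
    have tc: "\<exists>u\<in>I. (norm (p - gam u))\<^sup>2 = rad u"
      by (rule bexI[OF _ u(1)], rule antisym[OF u(2) psi[OF u(1)]])
    have "\<exists>X. (\<forall>u\<in>I. (norm (p - gam u))\<^sup>2 = rad u \<longrightarrow> X \<bullet> (p - gam u) > 0) \<and> sgn (F p) * (grd p \<bullet> X) > 0"
      by (rule escape) (fact Fp, fact psi, fact tc)
    then obtain X where X: "\<And>u. u \<in> I \<Longrightarrow> (norm (p - gam u))\<^sup>2 = rad u \<Longrightarrow> X \<bullet> (p - gam u) > 0" "sgn (F p) * (grd p \<bullet> X) > 0"
      by blast
    have "\<exists>\<delta>>0. \<forall>z t. dist z p < \<delta> \<and> (\<forall>u\<in>I. (norm (z - gam u))\<^sup>2 > rad u) \<and> 0 \<le> t \<and> t \<le> \<delta>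
           \<longrightarrow> (\<forall>u\<in>I. (norm (z + t *\<^sub>R X - gam u))\<^sup>2 > rad u)"
      by (rule push_off_tube[OF I]) (fact psi, fact X(1))
    then obtain \<delta> where d: "\<delta> > 0" "\<forall>z t. dist z p < \<delta> \<and> (\<forall>u\<in>I. (norm (z - gam u))\<^sup>2 > rad u) \<and> 0 \<le> t \<and> t \<le> \<delta>
           \<longrightarrow> (\<forall>u\<in>I. (norm (z + t *\<^sub>R X - gam u))\<^sup>2 > rad u)"
      by (elim exE conjE) (rule that)
    obtain t0 where t0: "t0 > 0" "\<And>t. 0 < t \<Longrightarrow> t < t0 \<Longrightarrow> sgn (F p) * F (p + t *\<^sub>R X) > \<bar>F p\<bar>"
      using inc[OF X(2)] by blast
    define t where "t = min (t0/2) \<delta>"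
    have t: "0 < t" "t < t0" "t \<le> \<delta>" using t0(1) d(1) by (auto simp: t_def)
    have "isCont (\<lambda>z. sgn (F p) * F (z + t *\<^sub>R X)) p"
      by (intro continuous_intros isCont_o2[OF _ has_derivative_continuous[OF F]])
    then have "((\<lambda>z. sgn (F p) * F (z + t *\<^sub>R X)) \<longlongrightarrow> sgn (F p) * F (p + t *\<^sub>R X)) (nhds p)"
      unfolding isCont_def by (rule tendsto_at_iff_tendsto_nhds[THEN iffD1])
    from order_tendstoD(1)[OF this t0(2)[OF t(1,2)]]
    have "\<forall>\<^sub>F z in nhds p. sgn (F p) * F (z + t *\<^sub>R X) > \<bar>F p\<bar>" .
    then obtain d2 where d2: "d2 > 0" "\<And>z. dist z p < d2 \<Longrightarrow> sgn (F p) * F (z + t *\<^sub>R X) > \<bar>F p\<bar>"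
      by (auto simp: eventually_nhds_metric)
    obtain z where z: "z \<in> C" "dist z p < min \<delta> d2"
      using p(1) d(1) d2(1) by (metis closure_approachable min_less_iff_conj)
    have seg: "closed_segment z (z + t *\<^sub>R X) \<subseteq> -S"
    proof
      fix w assume "w \<in> closed_segment z (z + t *\<^sub>R X)"
      then obtain s where s: "0 \<le> s" "s \<le> 1" "w = (1 - s) *\<^sub>R z + s *\<^sub>R (z + t *\<^sub>R X)"
        by (auto simp: closed_segment_def)
      have w: "w = z + (s * t) *\<^sub>R X" using s(3) by (simp add: algebra_simps)
      have "s * t \<le> 1 * t" using s t by (intro mult_right_mono) auto
      then have st: "s * t \<le> \<delta>" "0 \<le> s * t" using t s by (linarith, simp)
      have zz: "\<forall>u\<in>I. (norm (z - gam u))\<^sup>2 > rad u" using z(1) CS by (force simp: S_def)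
      have "dist z p < \<delta>" using z(2) by simp
      then have "\<forall>u\<in>I. (norm (w - gam u))\<^sup>2 > rad u"
        using d(2)[rule_format, of z "s * t"] zz st unfolding w by simp
      then show "w \<in> -S" by (force simp: S_def)
    qed
    have "closed_segment z (z + t *\<^sub>R X) \<subseteq> C"
      using components_maximal[OF C(1) connected_segment(1) seg] z(1) by auto
    then have "z + t *\<^sub>R X \<in> closure C" using closure_subset[of C] by auto
    then have "\<bar>F (z + t *\<^sub>R X)\<bar> \<le> \<bar>F p\<bar>" by (rule p(2))
    moreover have "sgn (F p) * F (z + t *\<^sub>R X) > \<bar>F p\<bar>" using d2(2)[of z] z(2) by simp
    ultimately show ?thesis using sF[of "z + t *\<^sub>R X"] by linarith
  qed
qed

section \<open>Escape directions at the boundary of a thin tube\<close>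

lemma inner2: "x \<bullet> y = x $ 1 * y $ 1 + x $ 2 * y $ 2" for x y :: "real^2"
  by (simp add: inner_vec_def sum_2)

lemma norm2_sq: "(norm x)\<^sup>2 = (x $ 1)\<^sup>2 + (x $ 2)\<^sup>2" for x :: "real^2"
  by (simp add: power2_norm_eq_inner inner2) (simp add: power2_eq_square)

lemma vec2_eq_iff: "x = y \<longleftrightarrow> x $ 1 = y $ 1 \<and> x $ 2 = y $ 2" for x y :: "'a^2"
  by (simp add: Finite_Cartesian_Product.vec_eq_iff forall_2)

lemma poly_MVT_between:
  "\<exists>\<xi>. \<bar>\<xi> - a\<bar> \<le> \<bar>b - a\<bar> \<and> poly P b - poly P a = poly (pderiv P) \<xi> * (b - a)" for a b :: real
proof (cases a b rule: linorder_cases)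
  case less
  from poly_MVT[OF less, of P] obtain x where "a < x" "x < b" "poly P b - poly P a = (b - a) * poly (pderiv P) x" by blast
  then show ?thesis by (intro exI[of _ x]) auto
next
  case greater
  from poly_MVT[OF greater, of P] obtain x where "b < x" "x < a" "poly P a - poly P b = (a - b) * poly (pderiv P) x" by blast
  then show ?thesis by (intro exI[of _ x]) (auto simp: algebra_simps)
qed auto

lemma deriv_sign_near_min:
  fixes P :: "real poly"
  assumes "poly (pderiv P) a = 0" "poly (pderiv (pderiv P)) a > 0"
  shows "\<exists>\<delta>>0. \<forall>x. 0 < \<bar>x - a\<bar> \<and> \<bar>x - a\<bar> < \<delta> \<longrightarrow> poly (pderiv P) x * (x - a) > 0"
proof -
  have D: "(poly (pderiv P) has_real_derivative poly (pderiv (pderiv P)) a) (at a)" by (rule poly_DERIV)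
  obtain d1 where d1: "d1 > 0" "\<And>h. 0 < h \<Longrightarrow> h < d1 \<Longrightarrow> poly (pderiv P) (a + h) > 0"
    using DERIV_pos_inc_right[OF D assms(2)] assms(1) by auto
  obtain d2 where d2: "d2 > 0" "\<And>h. 0 < h \<Longrightarrow> h < d2 \<Longrightarrow> poly (pderiv P) (a - h) < 0"
    using DERIV_pos_inc_left[OF D assms(2)] assms(1) by auto
  show ?thesis
  proof (intro exI[of _ "min d1 d2"] conjI allI impI)
    fix x assume x: "0 < \<bar>x - a\<bar> \<and> \<bar>x - a\<bar> < min d1 d2"
    show "poly (pderiv P) x * (x - a) > 0"
    proof (cases "x > a")
      case True then show ?thesis using d1(2)[of "x - a"] x by simp
    next
      case False then show ?thesis using d2(2)[of "a - x"] x by (simp add: mult_neg_neg)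
    qed
  qed (use d1 d2 in auto)
qed

lemma strict_mono_away_from_min:
  fixes P :: "real poly"
  assumes "\<And>x. 0 < \<bar>x - a\<bar> \<Longrightarrow> \<bar>x - a\<bar> < \<delta> \<Longrightarrow> poly (pderiv P) x * (x - a) > 0"
    and "(x - a) * (x' - x) \<ge> 0" "x' \<noteq> x" "(x' - a) * (x' - x) > 0" "\<bar>x' - a\<bar> < \<delta>"
  shows "poly P x < poly P x'"
proof (cases "x < x'")
  case True
  then have "x \<ge> a" using assms(2) by (simp add: zero_le_mult_iff)
  from poly_MVT[OF True, of P] obtain z where z: "x < z" "z < x'" "poly P x' - poly P x = (x' - x) * poly (pderiv P) z" by blast
  then have "poly (pderiv P) z > 0" using assms(1)[of z] assms(5) \<open>x \<ge> a\<close> by (auto simp: zero_less_mult_iff)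
  then show ?thesis using mult_pos_pos[of "x' - x" "poly (pderiv P) z"] z(3) True by linarith
next
  case False
  then have l: "x' < x" using assms(3) by simp
  then have "x \<le> a" using assms(2) by (simp add: zero_le_mult_iff)
  from poly_MVT[OF l, of P] obtain z where z: "x' < z" "z < x" "poly P x - poly P x' = (x - x') * poly (pderiv P) z" by blast
  then have "poly (pderiv P) z < 0" using assms(1)[of z] assms(5) \<open>x \<le> a\<close> by (auto simp: zero_less_mult_iff)
  then have "(x - x') * poly (pderiv P) z < 0" using l by (simp add: mult_pos_neg)
  then show ?thesis using z(3) by simp
qed

text \<open>Consider the level curve \<open>fa(x) = ga(y)\<close> through a common minimum of \<open>fa\<close>
  and \<open>ga\<close>, and a point \<open>(x, y)\<close> on the side \<open>fa > ga\<close> whose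
  displacement from the curve point \<open>(x', y')\<close> is roughly normal to the curve: hypothesis
  \<open>sgn\<close> says that displacement and tangent \<open>(G1, G2)\<close> have opposite slope
  signs. If the curve point were farther from the saddle in the
  \<open>x\<close>-coordinate than \<open>(x, y)\<close>, monotonicity of \<open>fa\<close> and \<open>ga\<close> away from their minima would give
  \<open>fa(x) < fa(x') = ga(y') < ga(y)\<close>.\<close>
lemma saddle_sign:
  fixes fa ga :: "real poly"
  assumes f: "\<And>x. 0 < \<bar>x - a\<bar> \<Longrightarrow> \<bar>x - a\<bar> < \<delta> \<Longrightarrow> poly (pderiv fa) x * (x - a) > 0"
    and g: "\<And>y. 0 < \<bar>y - b\<bar> \<Longrightarrow> \<bar>y - b\<bar> < \<delta> \<Longrightarrow> poly (pderiv ga) y * (y - b) > 0"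
    and g0: "poly (pderiv ga) b = 0" and eq: "poly fa a = poly ga b"
    and near: "\<bar>x - a\<bar> < \<delta>" "\<bar>x' - a\<bar> < \<delta>" "\<bar>y - b\<bar> < \<delta>" "\<bar>y' - b\<bar> < \<delta>"
    and on: "poly fa x' = poly ga y'" and gt: "poly fa x > poly ga y"
    and tan: "poly (pderiv fa) x' * G1 = poly (pderiv ga) y' * G2"
    and sgn: "(x - x') * (y - y') * (G1 * G2) < 0"
  shows "(x - a) * (x - x') > 0"
proof (rule ccontr)
  have gmin: "poly ga y \<ge> poly ga b"
    using strict_mono_away_from_min[of b \<delta> ga b y, OF g] near(3)
    by (cases "y = b") (auto simp: zero_less_mult_iff linorder_neq_iff)
  assume n: "\<not> (x - a) * (x - x') > 0"
  have "x \<noteq> a" using gmin gt eq by auto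
  have "x \<noteq> x'" using sgn by auto
  have n': "(x - a) * (x' - x) > 0" using n \<open>x \<noteq> a\<close> \<open>x \<noteq> x'\<close> by (auto simp: zero_less_mult_iff not_less)
  have n2: "(x' - a) * (x' - x) > 0" and n3: "(x' - a) * (x - x') < 0" using n' by (auto simp: zero_less_mult_iff mult_less_0_iff)
  have lt: "poly fa x < poly fa x'"
    by (rule strict_mono_away_from_min[where a = a and \<delta> = \<delta>]) (use f n' n2 near \<open>x \<noteq> x'\<close> in auto)
  have "x' \<noteq> a" using n2 by auto
  then have fp: "poly (pderiv fa) x' * (x' - a) > 0" using f near by auto
  have G: "G1 \<noteq> 0" "G2 \<noteq> 0" "y \<noteq> y'" using sgn by auto
  then have "poly (pderiv ga) y' \<noteq> 0" using fp tan by auto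
  then have "y' \<noteq> b" using g0 by auto
  then have gp: "poly (pderiv ga) y' * (y' - b) > 0" using g near by auto
  have "(poly (pderiv fa) x' * G1) * (poly (pderiv ga) y' * G2) > 0"
    unfolding tan using G \<open>poly (pderiv ga) y' \<noteq> 0\<close> by (metis mult_eq_0_iff not_real_square_gt_zero)
  then have s1: "(poly (pderiv fa) x' * poly (pderiv ga) y') * (G1 * G2) > 0" by (simp add: mult_ac)
  have "(y - y') * (y' - b) > 0"
  proof -
    have sq: "0 < t" if "0 < c\<^sup>2 * t" for c t :: real using that by (auto simp: zero_less_mult_iff)
    define A where "A = poly (pderiv fa) x'"
    define B where "B = poly (pderiv ga) y'"
    define G where "G = G1 * G2"
    have "0 < (A * B)\<^sup>2 * ((x' - a) * (y' - b) * G)"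
      using mult_pos_pos[OF mult_pos_pos[OF fp gp] s1] by (simp add: A_def B_def G_def power2_eq_square mult_ac)
    moreover have "0 < (x - x')\<^sup>2 * ((x' - a) * (y - y') * G)"
      using mult_neg_neg[OF n3 sgn] by (simp add: G_def power2_eq_square mult_ac)
    ultimately have "0 < ((x' - a) * (y' - b) * G) * ((x' - a) * (y - y') * G)"
      using mult_pos_pos[OF sq sq] by blast
    then have "0 < ((x' - a) * G)\<^sup>2 * ((y - y') * (y' - b))" by (simp add: power2_eq_square mult_ac)
    then show ?thesis by (rule sq)
  qed
  then have "poly ga y' < poly ga y"
    by (intro strict_mono_away_from_min[where a = b and \<delta> = \<delta>]) (use g near in \<open>auto simp: zero_less_mult_iff zero_le_mult_iff\<close>)
  then show False using lt on gt by simp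
qed

locale cheb_curve =
  fixes d1 d2 :: nat
  assumes d1: "0 < d1" and d12: "d1 < d2" and cop: "coprime d1 d2"
begin

abbreviation "f \<equiv> (cheb d2 :: real poly)"
abbreviation "g \<equiv> (cheb d1 :: real poly)"

definition gam :: "real \<Rightarrow> real^2" where "gam u = vector [poly (cheb d1) u, poly (cheb d2) u]"
definition gam' :: "real \<Rightarrow> real^2" where "gam' u = vector [poly (pderiv (cheb d1)) u, poly (pderiv (cheb d2)) u]"
text \<open>An equation of the curve: \<open>F\<close> vanishes at every \<open>gam u\<close> because Chebyshev
  polynomials commute under composition.\<close>
definition F :: "real^2 \<Rightarrow> real" where "F z = poly f (z $ 1) - poly g (z $ 2)"
definition gradF :: "real^2 \<Rightarrow> real^2" where "gradF z = vector [poly (pderiv f) (z $ 1), - poly (pderiv g) (z $ 2)]"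

text \<open>The point \<open>p\<close> is in no open disc of the tube of radius parameter \<open>e\<close>; in
  \<open>touch\<close> it lies on the boundary circle of the disc with parameter \<open>u\<close>.
  Both together describe the boundary points of the tube.\<close>
definition above_tube :: "real \<Rightarrow> real^2 \<Rightarrow> bool" where
  "above_tube e p \<longleftrightarrow> (\<forall>u. \<bar>u\<bar> \<le> 1 \<longrightarrow> (norm (p - gam u))\<^sup>2 \<ge> e\<^sup>2 * (1 - u\<^sup>2))"
definition touch :: "real \<Rightarrow> real^2 \<Rightarrow> real \<Rightarrow> bool" where
  "touch e p u \<longleftrightarrow> \<bar>u\<bar> \<le> 1 \<and> (norm (p - gam u))\<^sup>2 = e\<^sup>2 * (1 - u\<^sup>2)"

lemma d2: "0 < d2" using d1 d12 by simp

lemma gam_nth [simp]: "gam u $ 1 = poly g u" "gam u $ 2 = poly f u" by (simp_all add: gam_def)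
lemma gam'_nth [simp]: "gam' u $ 1 = poly (pderiv g) u" "gam' u $ 2 = poly (pderiv f) u" by (simp_all add: gam'_def)
lemma gradF_nth [simp]: "gradF z $ 1 = poly (pderiv f) (z $ 1)" "gradF z $ 2 = - poly (pderiv g) (z $ 2)"
  by (simp_all add: gradF_def)

lemma vec2_tendsto:
  "((\<lambda>x. h x) \<longlongrightarrow> l) A" if "((\<lambda>x. h x $ 1) \<longlongrightarrow> l $ 1) A" "((\<lambda>x. h x $ 2) \<longlongrightarrow> l $ 2) A" for h :: "_ \<Rightarrow> real^2"
proof (rule vec_tendstoI)
  show "((\<lambda>x. h x $ i) \<longlongrightarrow> l $ i) A" for i using that exhaust_2[of i] by auto
qed

lemma tendsto_gam [tendsto_intros]: "(h \<longlongrightarrow> l) A \<Longrightarrow> ((\<lambda>x. gam (h x)) \<longlongrightarrow> gam l) A"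
  by (rule vec2_tendsto) (auto intro!: tendsto_intros)
lemma tendsto_gam' [tendsto_intros]: "(h \<longlongrightarrow> l) A \<Longrightarrow> ((\<lambda>x. gam' (h x)) \<longlongrightarrow> gam' l) A"
  by (rule vec2_tendsto) (auto intro!: tendsto_intros)
lemma tendsto_gradF [tendsto_intros]: "(h \<longlongrightarrow> l) A \<Longrightarrow> ((\<lambda>x. gradF (h x)) \<longlongrightarrow> gradF l) A"
  by (rule vec2_tendsto) (auto intro!: tendsto_intros)

lemma continuous_gam: "continuous_on A gam"
  by (auto simp: continuous_on_def intro!: tendsto_intros)

lemma F_gam: "F (gam u) = 0" by (simp add: F_def cheb_commute)

lemma gradF_gam: "gradF (gam u) \<bullet> gam' u = 0"
proof -
  have "((\<lambda>u. poly f (poly g u) - poly g (poly f u)) has_real_derivative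
      poly (pderiv f) (poly g u) * poly (pderiv g) u - poly (pderiv g) (poly f u) * poly (pderiv f) u) (at u)"
    by (intro DERIV_diff DERIV_chain2[of "poly _"] poly_DERIV)
  moreover have "(\<lambda>u. poly f (poly g u) - poly g (poly f u)) = (\<lambda>_. 0)" by (simp add: cheb_commute)
  ultimately show ?thesis using DERIV_unique DERIV_const by (fastforce simp: inner2)
qed

lemma gam'_nz: "gam' u \<noteq> 0"
  using pderiv_cheb_no_common_zero_real[OF d1 d2 cop, of u] by (auto simp: vec2_eq_iff)

text \<open>The function \<open>\<bar>p - gam u\<bar>\<^sup>2 - e\<^sup>2 (1 - u\<^sup>2)\<close> has a minimum
  with value 0 at a contact parameter. At \<open>u = \<plusminus>1\<close> its derivative would be
  \<open>2 e\<^sup>2 u\<close>, which points the wrong way for a minimum at an end of the interval; so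
  \<open>u\<close> is interior and the derivative vanishes.\<close>
lemma touch_interior:
  assumes "e > 0" "above_tube e p" "touch e p u"
  shows "\<bar>u\<bar> < 1" "(p - gam u) \<bullet> gam' u = e\<^sup>2 * u"
proof -
  define psi where "psi v = (p$1 - poly g v)\<^sup>2 + (p$2 - poly f v)\<^sup>2 - e\<^sup>2 * (1 - v\<^sup>2)" for v
  have psi: "psi v = (norm (p - gam v))\<^sup>2 - e\<^sup>2 * (1 - v\<^sup>2)" for v by (simp add: psi_def norm2_sq)
  have u: "\<bar>u\<bar> \<le> 1" "psi u = 0" using assms(3) by (auto simp: touch_def psi)
  have pos: "\<bar>v\<bar> \<le> 1 \<Longrightarrow> psi v \<ge> 0" for v using assms(2) by (auto simp: above_tube_def psi)
  have D: "(psi has_real_derivative 2 * (e\<^sup>2 * u - (p - gam u) \<bullet> gam' u)) (at u)"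
    unfolding psi_def inner2
    by (auto intro!: derivative_eq_intros poly_DERIV simp: algebra_simps)
  show lt: "\<bar>u\<bar> < 1"
  proof (rule ccontr)
    assume "\<not> \<bar>u\<bar> < 1"
    then have u1: "u = 1 \<or> u = -1" using u by auto
    then have "p = gam u" using assms(3) by (auto simp: touch_def)
    with D have D': "(psi has_real_derivative 2 * (e\<^sup>2 * u)) (at u)" by simp
    show False
    proof (cases "u = 1")
      case True
      then have "2 * (e\<^sup>2 * u) > 0" using assms(1) by simp
      from DERIV_pos_inc_left[OF D' this] obtain d where d: "d > 0" "\<forall>h>0. h < d \<longrightarrow> psi (u - h) < psi u" by auto
      have "psi (u - min 1 (d/2)) < psi u" using d by auto
      then show False using u pos[of "u - min 1 (d/2)"] True d by auto
    next
      case False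
      then have "2 * (e\<^sup>2 * u) < 0" using assms(1) u1 by simp
      from DERIV_neg_dec_right[OF D' this] obtain d where d: "d > 0" "\<forall>h>0. h < d \<longrightarrow> psi (u + h) < psi u" by auto
      have "psi (u + min 1 (d/2)) < psi u" using d by auto
      then show False using u pos[of "u + min 1 (d/2)"] False u1 d by auto
    qed
  qed
  have "2 * (e\<^sup>2 * u - (p - gam u) \<bullet> gam' u) = 0"
    by (rule DERIV_local_min[OF D, of "1 - \<bar>u\<bar>"]) (use lt u pos in auto)
  then show "(p - gam u) \<bullet> gam' u = e\<^sup>2 * u" by simp
qed

lemma touch_norm:
  assumes "e > 0" "above_tube e p" "touch e p u"
  shows "norm (p - gam u) = e * sqrt (1 - u\<^sup>2)" "norm (p - gam u) > 0" "norm (p - gam u) \<le> e"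
proof -
  have "u\<^sup>2 < 1" using touch_interior(1)[OF assms] by (simp add: abs_square_less_1)
  have "norm (p - gam u) = sqrt (e\<^sup>2 * (1 - u\<^sup>2))" using assms(3) by (metis norm_ge_zero real_sqrt_unique touch_def)
  then show 1: "norm (p - gam u) = e * sqrt (1 - u\<^sup>2)" using assms(1) by (simp add: real_sqrt_mult)
  show "norm (p - gam u) > 0" unfolding 1 using \<open>u\<^sup>2 < 1\<close> assms by simp
  have "sqrt (1 - u\<^sup>2) \<le> 1" by simp
  then show "norm (p - gam u) \<le> e" unfolding 1 using assms(1) by (simp add: mult_left_le)
qed

text \<open>Compactness for shrinking tubes: a subsequence of the contact parameters and of the unit normals
  converges. The product of the normal with \<open>gam' u\<close> is
  \<open>e u / sqrt (1 - u\<^sup>2)\<close>. It disappears in the limit at an inner point of the curve, whereas near an end point only its sign is controlled: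
  it points outwards.\<close>
lemma touch_limit:
  assumes e: "\<And>n. e n > 0" "e \<longlonglongrightarrow> 0" and p: "p \<longlonglongrightarrow> a"
    and t: "\<And>n. above_tube (e n) (p n)" "\<And>n. touch (e n) (p n) (u n)"
  obtains r l \<nu> where "strict_mono (r :: nat \<Rightarrow> nat)" "(\<lambda>n. u (r n)) \<longlonglongrightarrow> l" "\<bar>l\<bar> \<le> 1" "gam l = a"
     "(\<lambda>n. (1 / norm (p (r n) - gam (u (r n)))) *\<^sub>R (p (r n) - gam (u (r n)))) \<longlonglongrightarrow> \<nu>" "norm \<nu> = 1"
     "\<bar>l\<bar> < 1 \<longrightarrow> \<nu> \<bullet> gam' l = 0" "\<bar>l\<bar> = 1 \<longrightarrow> l * (\<nu> \<bullet> gam' l) \<ge> 0"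
proof -
  define N where "N n = (1 / norm (p n - gam (u n))) *\<^sub>R (p n - gam (u n))" for n
  have nN: "norm (N n) = 1" for n using touch_norm(2)[OF e(1) t] by (simp add: N_def)
  have "compact ({-1..1::real} \<times> sphere (0::real^2) 1)" by (intro compact_Times compact_Icc compact_sphere)
  moreover have "(u n, N n) \<in> {-1..1::real} \<times> sphere (0::real^2) 1" for n
    using t(2)[of n] nN by (auto simp: touch_def abs_le_iff)
  ultimately obtain z r where r: "z \<in> {-1..1::real} \<times> sphere (0::real^2) 1" "strict_mono (r :: nat \<Rightarrow> nat)"
      "((\<lambda>n. (u n, N n)) \<circ> r) \<longlonglongrightarrow> z"
    unfolding compact_def by (metis (no_types, lifting))
  obtain l \<nu> where z: "z = (l, \<nu>)" by fastforce
  have ul: "(\<lambda>n. u (r n)) \<longlonglongrightarrow> l" using tendsto_fst[OF r(3)] by (simp add: z o_def)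
  have Nl: "(\<lambda>n. N (r n)) \<longlonglongrightarrow> \<nu>" using tendsto_snd[OF r(3)] by (simp add: z o_def)
  have er: "(\<lambda>n. e (r n)) \<longlonglongrightarrow> 0" using LIMSEQ_subseq_LIMSEQ[OF e(2) r(2)] by (simp add: o_def)
  have pr: "(\<lambda>n. p (r n)) \<longlonglongrightarrow> a" using LIMSEQ_subseq_LIMSEQ[OF p r(2)] by (simp add: o_def)
  have d0: "(\<lambda>n. p (r n) - gam (u (r n))) \<longlonglongrightarrow> 0"
    by (rule Lim_null_comparison[OF _ er]) (use touch_norm(3)[OF e(1) t] in \<open>auto intro!: eventuallyI\<close>)
  have "(\<lambda>n. p (r n) - (p (r n) - gam (u (r n)))) \<longlonglongrightarrow> a - 0" by (intro tendsto_intros pr d0)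
  then have "(\<lambda>n. gam (u (r n))) \<longlonglongrightarrow> a" by simp
  then have ga: "gam l = a" using tendsto_gam[OF ul] LIMSEQ_unique by blast
  have Ng: "(\<lambda>n. N (r n) \<bullet> gam' (u (r n))) \<longlonglongrightarrow> \<nu> \<bullet> gam' l" by (intro tendsto_intros Nl ul)
  have val: "N n \<bullet> gam' (u n) = e n * u n / sqrt (1 - (u n)\<^sup>2)" for n
  proof -
    have "N n \<bullet> gam' (u n) = (e n)\<^sup>2 * u n / (e n * sqrt (1 - (u n)\<^sup>2))"
      using touch_interior(2)[OF e(1) t, of n] touch_norm(1)[OF e(1) t, of n] by (simp add: N_def)
    then show ?thesis using e(1)[of n] by (simp add: power2_eq_square)
  qed
  show ?thesis
  proof (rule that[OF r(2) ul _ ga, of \<nu>])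
    show "\<bar>l\<bar> \<le> 1" "norm \<nu> = 1" using r(1) by (auto simp: z)
    show "(\<lambda>n. (1 / norm (p (r n) - gam (u (r n)))) *\<^sub>R (p (r n) - gam (u (r n)))) \<longlonglongrightarrow> \<nu>"
      using Nl by (simp add: N_def)
    show "\<bar>l\<bar> < 1 \<longrightarrow> \<nu> \<bullet> gam' l = 0"
    proof
      assume that: "\<bar>l\<bar> < 1"
      have "l\<^sup>2 < 1" using that by (simp add: abs_square_less_1)
      then have "(\<lambda>n. e (r n) * u (r n) / sqrt (1 - (u (r n))\<^sup>2)) \<longlonglongrightarrow> 0 * l / sqrt (1 - l\<^sup>2)"
        by (intro tendsto_intros er ul) auto
      then show "\<nu> \<bullet> gam' l = 0" using Ng LIMSEQ_unique unfolding val by fastforce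
    qed
    show "\<bar>l\<bar> = 1 \<longrightarrow> l * (\<nu> \<bullet> gam' l) \<ge> 0"
    proof
      have "(\<lambda>n. u (r n) * (N (r n) \<bullet> gam' (u (r n)))) \<longlonglongrightarrow> l * (\<nu> \<bullet> gam' l)" by (intro tendsto_intros Ng ul)
      moreover have "u n * (N n \<bullet> gam' (u n)) \<ge> 0" for n
      proof -
        have "u n * (N n \<bullet> gam' (u n)) = e n * (u n)\<^sup>2 / sqrt (1 - (u n)\<^sup>2)" unfolding val by (simp add: power2_eq_square)
        moreover have "(u n)\<^sup>2 < 1" using touch_interior(1)[OF e(1) t, of n] by (simp add: abs_square_less_1)
        ultimately show ?thesis using e(1)[of n] by simp
      qed
      ultimately show "l * (\<nu> \<bullet> gam' l) \<ge> 0" by (intro LIMSEQ_le_const) auto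
    qed
  qed
qed


text \<open>The direction \<open>X\<close> leaves all touched discs and increases \<open>\<sigma> F\<close>; it
  is used with \<open>\<sigma>\<close> the sign of \<open>F p\<close>.\<close>
definition escapes :: "real \<Rightarrow> real \<Rightarrow> real^2 \<Rightarrow> bool" where
  "escapes \<sigma> e p \<longleftrightarrow> (\<exists>X. (\<forall>u. touch e p u \<longrightarrow> X \<bullet> (p - gam u) > 0) \<and> \<sigma> * (gradF p \<bullet> X) > 0)"

lemma tendsto_harmonic_bound: "x \<longlonglongrightarrow> a" if "\<And>n. dist (x n) a < inverse (Suc n)" for a :: "'z::metric_space"
  using that by (intro metric_tendsto_imp_tendsto[OF LIMSEQ_inverse_real_of_nat])
      (auto intro!: eventuallyI less_imp_le simp: dist_norm)

lemma F_difference: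
  "\<exists>\<xi> \<eta>. \<bar>\<xi> - q$1\<bar> \<le> \<bar>p$1 - q$1\<bar> \<and> \<bar>\<eta> - q$2\<bar> \<le> \<bar>p$2 - q$2\<bar> \<and>
     F p - F q = poly (pderiv f) \<xi> * (p - q)$1 - poly (pderiv g) \<eta> * (p - q)$2"
proof -
  obtain \<xi> where 1: "\<bar>\<xi> - q$1\<bar> \<le> \<bar>p$1 - q$1\<bar>" "poly f (p$1) - poly f (q$1) = poly (pderiv f) \<xi> * (p$1 - q$1)"
    using poly_MVT_between[of "q$1" "p$1" f] by auto
  obtain \<eta> where 2: "\<bar>\<eta> - q$2\<bar> \<le> \<bar>p$2 - q$2\<bar>" "poly g (p$2) - poly g (q$2) = poly (pderiv g) \<eta> * (p$2 - q$2)"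
    using poly_MVT_between[of "q$2" "p$2" g] by auto
  show ?thesis
    by (intro exI[of _ \<xi>] exI[of _ \<eta>]) (use 1 2 in \<open>simp add: F_def\<close>)
qed

text \<open>To first order \<open>F(p)\<close> is the gradient of \<open>F\<close> applied to the displacement
  of \<open>p\<close> from the curve, so the limiting normal cannot point to the side where
  \<open>F\<close> has the sign opposite to \<open>\<sigma>\<close>.\<close>
lemma limit_normal_side:
  assumes p: "p \<longlonglongrightarrow> a" and u: "u \<longlonglongrightarrow> l" "gam l = a"
    and N: "(\<lambda>n. (1 / norm (p n - gam (u n))) *\<^sub>R (p n - gam (u n))) \<longlonglongrightarrow> \<nu>"
    and F: "\<And>n. \<sigma> * F (p n) > 0"
  shows "\<sigma> * (gradF a \<bullet> \<nu>) \<ge> 0"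
proof -
  define r where "r n = norm (p n - gam (u n))" for n
  have "\<exists>\<xi> \<eta>. \<bar>\<xi> - gam (u n)$1\<bar> \<le> \<bar>p n$1 - gam (u n)$1\<bar> \<and> \<bar>\<eta> - gam (u n)$2\<bar> \<le> \<bar>p n$2 - gam (u n)$2\<bar> \<and>
     F (p n) = poly (pderiv f) \<xi> * (p n - gam (u n))$1 - poly (pderiv g) \<eta> * (p n - gam (u n))$2" for n
    using F_difference[of "gam (u n)" "p n"] unfolding F_gam diff_0_right .
  then obtain \<xi> \<eta> where h: "\<And>n. \<bar>\<xi> n - gam (u n)$1\<bar> \<le> \<bar>p n$1 - gam (u n)$1\<bar>" "\<And>n. \<bar>\<eta> n - gam (u n)$2\<bar> \<le> \<bar>p n$2 - gam (u n)$2\<bar>"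
     "\<And>n. F (p n) = poly (pderiv f) (\<xi> n) * (p n - gam (u n))$1 - poly (pderiv g) (\<eta> n) * (p n - gam (u n))$2"
    by metis
  have gu: "(\<lambda>n. gam (u n)) \<longlonglongrightarrow> a" using tendsto_gam[OF u(1)] u(2) by simp
  have sq: "x \<longlonglongrightarrow> b" if "y \<longlonglongrightarrow> b" "z \<longlonglongrightarrow> b" "\<And>n. \<bar>x n - y n\<bar> \<le> \<bar>z n - y n\<bar>" for x y z :: "nat \<Rightarrow> real" and b
  proof -
    have "(\<lambda>n. \<bar>z n - y n\<bar>) \<longlonglongrightarrow> \<bar>b - b\<bar>" by (intro tendsto_intros that)
    then have "(\<lambda>n. x n - y n) \<longlonglongrightarrow> 0"
      by (intro Lim_null_comparison[of "\<lambda>n. x n - y n"]) (use that(3) in \<open>auto intro!: eventuallyI\<close>)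
    from tendsto_add[OF this that(1)] show ?thesis by simp
  qed
  have xi: "\<xi> \<longlonglongrightarrow> a$1" by (rule sq[OF _ _ h(1)]) (intro tendsto_intros gu p)+
  have eta: "\<eta> \<longlonglongrightarrow> a$2" by (rule sq[OF _ _ h(2)]) (intro tendsto_intros gu p)+
  define w where "w n = (1 / r n) *\<^sub>R (p n - gam (u n))" for n
  have w: "w \<longlonglongrightarrow> \<nu>" using N by (simp add: w_def[abs_def] r_def)
  have "(\<lambda>n. \<sigma> * (poly (pderiv f) (\<xi> n) * w n $1 - poly (pderiv g) (\<eta> n) * w n $2)) \<longlonglongrightarrow>
     \<sigma> * (poly (pderiv f) (a$1) * \<nu> $1 - poly (pderiv g) (a$2) * \<nu>$2)"
    by (intro tendsto_intros xi eta w)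
  moreover have "\<sigma> * (poly (pderiv f) (\<xi> n) * w n $1 - poly (pderiv g) (\<eta> n) * w n $2) \<ge> 0" for n
  proof -
    have "\<sigma> * (poly (pderiv f) (\<xi> n) * w n $1 - poly (pderiv g) (\<eta> n) * w n $2) = (1 / r n) * (\<sigma> * F (p n))"
      unfolding h(3)[of n] by (simp add: w_def algebra_simps)
    then show ?thesis using F[of n] by (simp add: r_def)
  qed
  ultimately have "\<sigma> * (poly (pderiv f) (a$1) * \<nu> $1 - poly (pderiv g) (a$2) * \<nu>$2) \<ge> 0"
    by (intro LIMSEQ_le_const) auto
  then show ?thesis by (simp add: inner2)
qed

lemma gam_endpoints: "gam 1 \<noteq> gam (-1)"
proof
  assume "gam 1 = gam (-1)"
  then have "(-1) ^ d1 = (1::real)" "(-1) ^ d2 = (1::real)"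
    using gam_nth[of 1] gam_nth[of "-1"] by (auto simp: cheb_one cheb_minus_one vec2_eq_iff)
  then have "even d1" "even d2" by (auto simp: minus_one_power_iff split: if_splits)
  then show False using cop coprime_common_divisor[of d1 d2 2] by simp
qed

text \<open>Two vectors orthogonal to the same nonzero vector of the plane are parallel; the identities express
  this and Pythagoras through the rotated vector \<open>(-N\<^sub>2, N\<^sub>1)\<close>.\<close>
lemma plane_orthogonal_identities:
  fixes N G \<nu> :: "real^2"
  assumes "N \<bullet> G = 0"
  shows "(N$1 * \<nu>$2 - N$2 * \<nu>$1) * (G \<bullet> G) = (\<nu> \<bullet> G) * (N$1 * G$2 - N$2 * G$1)"
    "(N \<bullet> N) * (\<nu> \<bullet> \<nu>) = (N \<bullet> \<nu>)\<^sup>2 + (N$1 * \<nu>$2 - N$2 * \<nu>$1)\<^sup>2"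
    "(N \<bullet> N) * (G \<bullet> G) = (N$1 * G$2 - N$2 * G$1)\<^sup>2"
proof -
  have 0: "N$1 * G$1 = - (N$2 * G$2)" using assms by (simp add: inner2)
  have "(N$1 * \<nu>$2 - N$2 * \<nu>$1) * (G$1 * G$1 + G$2 * G$2) - (\<nu>$1 * G$1 + \<nu>$2 * G$2) * (N$1 * G$2 - N$2 * G$1)
     = (\<nu>$2 * G$1 - \<nu>$1 * G$2) * (N$1 * G$1 + N$2 * G$2)" by (simp add: algebra_simps)
  then show "(N$1 * \<nu>$2 - N$2 * \<nu>$1) * (G \<bullet> G) = (\<nu> \<bullet> G) * (N$1 * G$2 - N$2 * G$1)"
    using 0 by (simp add: inner2)
  show 2: "(N \<bullet> N) * (\<nu> \<bullet> \<nu>) = (N \<bullet> \<nu>)\<^sup>2 + (N$1 * \<nu>$2 - N$2 * \<nu>$1)\<^sup>2" for \<nu>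
    by (simp add: inner2 power2_eq_square algebra_simps)
  show "(N \<bullet> N) * (G \<bullet> G) = (N$1 * G$2 - N$2 * G$1)\<^sup>2" using 2[of G] assms by simp
qed

text \<open>At a point with nonzero gradient \<open>N\<close>, every limiting unit normal \<open>\<nu>\<close>
  satisfies \<open>\<sigma> N \<bullet> \<nu> \<ge> 0\<close>, and its tangential part is zero or, at
  an end point, points outwards. The sum \<open>X\<close> of \<open>\<sigma> N\<close> and the outward
  tangent therefore has a positive product with all such \<open>\<nu>\<close>, and a sequence of
  counterexamples shrinking to \<open>a\<close> is impossible.\<close>
lemma escape_smooth:
  assumes a: "gradF a \<noteq> 0" and \<sigma>: "\<bar>\<sigma>\<bar> = 1"
  shows "\<exists>\<delta>>0. \<forall>e p. 0 < e \<and> e < \<delta> \<and> dist p a < \<delta> \<and> \<sigma> * F p > 0 \<and> above_tube e p \<longrightarrow> escapes \<sigma> e p"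
proof (rule ccontr)
  assume neg: "\<not> ?thesis"
  define N where "N = gradF a"
  define R where "R = (vector [- (N$2), N$1] :: real^2)"
  have R: "R$1 = - (N$2)" "R$2 = N$1" by (simp_all add: R_def)
  have NR: "N \<bullet> R = 0" and RR: "R \<bullet> v = N$1 * v$2 - N$2 * v$1" for v by (simp_all add: inner2 R)
  \<comment> \<open>at an end point of the curve the tangential part has to point outwards\<close>
  define c where "c = (if a = gam 1 then sgn (R \<bullet> gam' 1) else if a = gam (-1) then - sgn (R \<bullet> gam' (-1)) else (1::real))"
  define X where "X = \<sigma> *\<^sub>R N + c *\<^sub>R R"
  have s1: "\<sigma> * \<sigma> = 1" using \<sigma> by (metis abs_mult_self_eq mult_1)
  have "((\<lambda>p. \<sigma> * (gradF p \<bullet> X)) \<longlongrightarrow> \<sigma> * (gradF a \<bullet> X)) (nhds a)"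
    by (intro tendsto_intros tendsto_gradF filterlim_ident)
  moreover have "\<sigma> * (gradF a \<bullet> X) > 0"
  proof -
    have "\<sigma> * (gradF a \<bullet> X) = (\<sigma> * \<sigma>) * (N \<bullet> N)" using NR unfolding N_def[symmetric] X_def by (simp add: inner_add)
    then show ?thesis using s1 a by (simp add: N_def)
  qed
  ultimately have "\<forall>\<^sub>F p in nhds a. \<sigma> * (gradF p \<bullet> X) > 0" by (rule order_tendstoD(1))
  then obtain \<delta>1 where d1: "\<delta>1 > 0" "\<And>p. dist p a < \<delta>1 \<Longrightarrow> \<sigma> * (gradF p \<bullet> X) > 0"
    by (auto simp: eventually_nhds_metric)
  have "\<exists>e p u. 0 < e \<and> e < inverse (Suc n) \<and> dist p a < inverse (Suc n) \<and> \<sigma> * F p > 0 \<and> above_tube e p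
      \<and> touch e p u \<and> X \<bullet> (p - gam u) \<le> 0" for n
  proof -
    have "min \<delta>1 (inverse (Suc n)) > 0" using d1(1) by simp
    then obtain e p where ep: "0 < e" "e < min \<delta>1 (inverse (Suc n))" "dist p a < min \<delta>1 (inverse (Suc n))"
       "\<sigma> * F p > 0" "above_tube e p" "\<not> escapes \<sigma> e p" using neg by blast
    have "\<sigma> * (gradF p \<bullet> X) > 0" using d1(2)[of p] ep(3,4) by simp
    then have "\<exists>u. touch e p u \<and> \<not> X \<bullet> (p - gam u) > 0" using ep(6) unfolding escapes_def by blast
    then obtain u where "touch e p u" "X \<bullet> (p - gam u) \<le> 0" by (auto simp: not_less)
    then show ?thesis using ep by (intro exI[of _ e] exI[of _ p] exI[of _ u]) simp
  qed
  then obtain e p u where *: "\<And>n. 0 < e n" "\<And>n. e n < inverse (Suc n)" "\<And>n. dist (p n) a < inverse (Suc n)" "\<And>n. \<sigma> * F (p n) > 0"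
      "\<And>n. above_tube (e n) (p n)" "\<And>n. touch (e n) (p n) (u n)" "\<And>n. X \<bullet> (p n - gam (u n)) \<le> 0"
    by metis
  have p: "p \<longlonglongrightarrow> a" by (rule tendsto_harmonic_bound) (rule *)
  have e: "e \<longlonglongrightarrow> 0" by (rule tendsto_harmonic_bound) (simp only: dist_norm diff_0_right real_norm_def abs_of_pos[OF *(1)] *(2))
  obtain r l \<nu> where L: "strict_mono (r :: nat \<Rightarrow> nat)" "(\<lambda>n. u (r n)) \<longlonglongrightarrow> l" "\<bar>l\<bar> \<le> 1" "gam l = a"
     "(\<lambda>n. (1 / norm (p (r n) - gam (u (r n)))) *\<^sub>R (p (r n) - gam (u (r n)))) \<longlonglongrightarrow> \<nu>" "norm \<nu> = 1"
     "\<bar>l\<bar> < 1 \<longrightarrow> \<nu> \<bullet> gam' l = 0" "\<bar>l\<bar> = 1 \<longrightarrow> l * (\<nu> \<bullet> gam' l) \<ge> 0"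
    by (rule touch_limit[OF *(1) e p *(5,6)])
  have pr: "(\<lambda>n. p (r n)) \<longlonglongrightarrow> a" using LIMSEQ_subseq_LIMSEQ[OF p L(1)] by (simp add: o_def)
  have side: "\<sigma> * (N \<bullet> \<nu>) \<ge> 0"
    using limit_normal_side[OF pr L(2,4,5) *(4)] by (simp add: N_def)
  have "(\<lambda>n. X \<bullet> ((1 / norm (p (r n) - gam (u (r n)))) *\<^sub>R (p (r n) - gam (u (r n))))) \<longlonglongrightarrow> X \<bullet> \<nu>"
    by (intro tendsto_intros L(5))
  moreover have "X \<bullet> ((1 / norm (p (r n) - gam (u (r n)))) *\<^sub>R (p (r n) - gam (u (r n)))) \<le> 0" for n
    using *(7)[of "r n"] by (simp add: divide_nonpos_nonneg)
  ultimately have "X \<bullet> \<nu> \<le> 0" by (intro LIMSEQ_le_const2) auto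
  then have Xn: "\<sigma> * (N \<bullet> \<nu>) + c * (R \<bullet> \<nu>) \<le> 0" by (simp add: X_def inner_add inner_commute)
  define G where "G = gam' l"
  have NG: "N \<bullet> G = 0" using gradF_gam[of l] L(4) by (simp add: N_def G_def)
  have GG: "G \<bullet> G > 0" using gam'_nz[of l] by (simp add: G_def)
  have NN: "N \<bullet> N > 0" using a by (simp add: N_def)
  have k1: "(R \<bullet> \<nu>) * (G \<bullet> G) = (\<nu> \<bullet> G) * (R \<bullet> G)" using plane_orthogonal_identities(1)[OF NG] by (simp add: RR)
  have k2: "(N \<bullet> N) = (N \<bullet> \<nu>)\<^sup>2 + (R \<bullet> \<nu>)\<^sup>2" using plane_orthogonal_identities(2)[OF NG, of \<nu>] L(6) by (simp add: RR norm_eq_sqrt_inner)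
  have k3: "R \<bullet> G \<noteq> 0" using plane_orthogonal_identities(3)[OF NG] NN GG by (auto simp: RR)
  have cR: "c * (R \<bullet> \<nu>) \<ge> 0 \<and> (\<bar>l\<bar> = 1 \<longrightarrow> c \<noteq> 0) \<and> (\<bar>l\<bar> < 1 \<longrightarrow> R \<bullet> \<nu> = 0)"
  proof (cases "\<bar>l\<bar> < 1")
    case True
    then have "R \<bullet> \<nu> = 0" using L(7) k1 GG by (simp add: G_def)
    then show ?thesis using True by simp
  next
    case False
    then have l1: "\<bar>l\<bar> = 1" using L(3) by simp
    have lc: "c = l * sgn (R \<bullet> G)"
      using l1 L(4) gam_endpoints by (auto simp: c_def G_def abs_if split: if_splits)
    have "c * (R \<bullet> \<nu>) * (G \<bullet> G) = (l * (\<nu> \<bullet> G)) * \<bar>R \<bullet> G\<bar>" using k1 by (simp add: lc mult_ac) (simp add: abs_sgn mult_ac)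
    also have "\<dots> \<ge> 0" using L(8) l1 by (simp add: G_def)
    finally have "c * (R \<bullet> \<nu>) \<ge> 0" using GG by (simp add: zero_le_mult_iff)
    then show ?thesis using lc k3 l1 by (auto simp: sgn_eq_0_iff)
  qed
  have "\<sigma> * (N \<bullet> \<nu>) = 0" and cR0: "c * (R \<bullet> \<nu>) = 0" using cR side Xn by linarith+
  then have "N \<bullet> \<nu> = 0" using \<sigma> by auto
  then show False using cR0 cR k2 NN L(3) by (cases "\<bar>l\<bar> < 1") auto
qed

text \<open>At a node the gradient of \<open>F\<close> vanishes, and the tube has two branches with transversal,
  nowhere axis-parallel tangents. On each side of the crossing one of the coordinate directions leaves
  both branches: the one in which \<open>\<bar>F\<bar>\<close> grows. The limiting normals fix the
  slope signs, and \<open>saddle_sign\<close> does the rest.\<close>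
lemma escape_node:
  assumes a: "gradF a = 0" "a \<in> gam ` {-1..1}" and \<sigma>: "\<bar>\<sigma>\<bar> = 1"
  shows "\<exists>\<delta>>0. \<forall>e p. 0 < e \<and> e < \<delta> \<and> dist p a < \<delta> \<and> \<sigma> * F p > 0 \<and> above_tube e p \<longrightarrow> escapes \<sigma> e p"
proof (rule ccontr)
  assume neg: "\<not> ?thesis"
  have crit: "poly (pderiv f) (a$1) = 0" "poly (pderiv g) (a$2) = 0"
    using a(1) gradF_nth[of a] by auto
  obtain u0 where u0: "\<bar>u0\<bar> \<le> 1" "a = gam u0" using a(2) by (auto simp: abs_le_iff)
  have fg: "poly f (a$1) = poly g (a$2)" using F_gam[of u0] u0 by (simp add: F_def)
  define \<tau> where "\<tau> = poly f (a$1)"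
  have \<tau>2: "\<tau>\<^sup>2 = 1" using cheb_pell_real[of "a$1" d2] crit d2 by (simp add: \<tau>_def)
  have lt1: "\<bar>x\<bar> < 1" if z: "poly (pderiv (cheb d)) x = 0" "d > 0" for x :: real and d
  proof -
    obtain i where i: "0 < i" "i < d" "x = cos (real i * pi / real d)" by (rule pderiv_cheb_critical[OF z(2,1)])
    have "sin (real i * pi / real d) > 0" by (rule sin_gt_zero) (use i in \<open>auto simp: field_simps\<close>)
    then have "(cos (real i * pi / real d))\<^sup>2 < 1" by (simp add: cos_squared_eq)
    then show ?thesis using i by (simp add: abs_square_less_1)
  qed
  have a1: "\<bar>a$1\<bar> < 1" "\<bar>a$2\<bar> < 1" using lt1 crit d1 d2 by blast+
  define fa where "fa = Polynomial.smult (-\<tau>) f"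
  define ga where "ga = Polynomial.smult (-\<tau>) g"
  have min: "poly (pderiv (pderiv (Polynomial.smult (-\<tau>) (cheb d)))) x > 0"
    if "poly (pderiv (cheb d)) x = 0" "poly (cheb d) x = \<tau>" "\<bar>x\<bar> < 1" "d > 0" for x :: real and d
  proof -
    have o: "(1 - x\<^sup>2) * poly (pderiv (pderiv (cheb d))) x = - (real d)\<^sup>2 * \<tau>"
      using cheb_ode_real[of x d] that by simp
    have "(1 - x\<^sup>2) * (- \<tau> * poly (pderiv (pderiv (cheb d))) x) = - \<tau> * ((1 - x\<^sup>2) * poly (pderiv (pderiv (cheb d))) x)"
      by (simp add: algebra_simps)
    then have "(1 - x\<^sup>2) * (- \<tau> * poly (pderiv (pderiv (cheb d))) x) = (real d)\<^sup>2 * \<tau>\<^sup>2"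
      unfolding o by (simp add: power2_eq_square)
    moreover have "1 - x\<^sup>2 > 0" using that(3) by (simp add: abs_square_less_1)
    ultimately have "- \<tau> * poly (pderiv (pderiv (cheb d))) x > 0" using \<tau>2 that(4)
      by (metis mult_1_right of_nat_0_less_iff zero_less_mult_pos zero_less_power)
    then show ?thesis by (simp add: pderiv_smult pderiv_minus)
  qed
  have fa0: "poly (pderiv fa) (a$1) = 0" and ga0: "poly (pderiv ga) (a$2) = 0"
    using crit by (simp_all add: fa_def ga_def pderiv_smult pderiv_minus)
  obtain \<delta>1 where d1': "\<delta>1 > 0" "\<And>x. 0 < \<bar>x - a$1\<bar> \<Longrightarrow> \<bar>x - a$1\<bar> < \<delta>1 \<Longrightarrow> poly (pderiv fa) x * (x - a$1) > 0"
    using deriv_sign_near_min[OF fa0] min[OF crit(1) _ a1(1) d2] by (auto simp: fa_def \<tau>_def)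
  obtain \<delta>2 where d2': "\<delta>2 > 0" "\<And>x. 0 < \<bar>x - a$2\<bar> \<Longrightarrow> \<bar>x - a$2\<bar> < \<delta>2 \<Longrightarrow> poly (pderiv ga) x * (x - a$2) > 0"
    using deriv_sign_near_min[OF ga0] min[OF crit(2) _ a1(2) d1] fg by (auto simp: ga_def \<tau>_def)
  define \<delta> where "\<delta> = min \<delta>1 \<delta>2"
  have \<delta>: "\<delta> > 0" using d1' d2' by (simp add: \<delta>_def)
  have fs: "\<And>x. 0 < \<bar>x - a$1\<bar> \<Longrightarrow> \<bar>x - a$1\<bar> < \<delta> \<Longrightarrow> poly (pderiv fa) x * (x - a$1) > 0"
   and gs: "\<And>x. 0 < \<bar>x - a$2\<bar> \<Longrightarrow> \<bar>x - a$2\<bar> < \<delta> \<Longrightarrow> poly (pderiv ga) x * (x - a$2) > 0"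
    using d1'(2) d2'(2) by (simp_all add: \<delta>_def)
  have eq: "poly fa (a$1) = poly ga (a$2)" using fg by (simp add: fa_def ga_def)
  have \<sigma>\<tau>: "\<sigma> = - \<tau> \<or> \<sigma> = \<tau>" "\<tau> \<noteq> 0" using \<sigma> \<tau>2 by (auto simp: power2_eq_1_iff abs_if split: if_splits)
  \<comment> \<open>move away from the node along the coordinate in which \<open>\<bar>F\<bar>\<close> grows\<close>
  define X where "X p = (if \<sigma> = -\<tau> then axis 1 (p$1 - a$1) else axis 2 (p$2 - a$2) :: real^2)" for p :: "real^2"
  have near: "\<bar>p$1 - a$1\<bar> < \<delta>" "\<bar>p$2 - a$2\<bar> < \<delta>" if "dist p a < \<delta>" for p
    using that component_le_norm_cart[of "p - a" 1] component_le_norm_cart[of "p - a" 2] by (auto simp: dist_norm)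
  have Fp: "poly fa (p$1) - poly ga (p$2) = - \<tau> * F p" for p by (simp add: fa_def ga_def F_def algebra_simps)
  have gr: "\<sigma> * (gradF p \<bullet> X p) > 0" if "dist p a < \<delta>" "\<sigma> * F p > 0" for p
  proof (cases "\<sigma> = -\<tau>")
    case True
    then have gt: "poly fa (p$1) > poly ga (p$2)" using that Fp[of p] by simp
    have "poly ga (p$2) \<ge> poly ga (a$2)"
      using strict_mono_away_from_min[of "a$2" \<delta> ga "a$2" "p$2", OF gs] near(2)[OF that(1)]
      by (cases "p$2 = a$2") (auto simp: zero_less_mult_iff linorder_neq_iff)
    then have "p$1 \<noteq> a$1" using gt eq by auto
    then have "poly (pderiv fa) (p$1) * (p$1 - a$1) > 0" using fs near that by auto
    then show ?thesis using True by (simp add: X_def inner_axis fa_def pderiv_smult pderiv_minus)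
  next
    case False
    then have st: "\<sigma> = \<tau>" using \<sigma>\<tau> by blast
    then have gt: "poly fa (p$1) < poly ga (p$2)" using that Fp[of p] by simp
    have "poly fa (p$1) \<ge> poly fa (a$1)"
      using strict_mono_away_from_min[of "a$1" \<delta> fa "a$1" "p$1", OF fs] near(1)[OF that(1)]
      by (cases "p$1 = a$1") (auto simp: zero_less_mult_iff linorder_neq_iff)
    then have "p$2 \<noteq> a$2" using gt eq by auto
    then have "poly (pderiv ga) (p$2) * (p$2 - a$2) > 0" using gs near that by auto
    then show ?thesis using False st by (simp add: X_def inner_axis ga_def pderiv_smult pderiv_minus)
  qed
  have "\<exists>e p u. 0 < e \<and> e < inverse (Suc n) \<and> dist p a < inverse (Suc n) \<and> dist p a < \<delta> \<and> \<sigma> * F p > 0 \<and> above_tube e p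
      \<and> touch e p u \<and> X p \<bullet> (p - gam u) \<le> 0" for n
  proof -
    have "min \<delta> (inverse (Suc n)) > 0" using \<delta> by simp
    then obtain e p where ep: "0 < e" "e < min \<delta> (inverse (Suc n))" "dist p a < min \<delta> (inverse (Suc n))"
       "\<sigma> * F p > 0" "above_tube e p" "\<not> escapes \<sigma> e p" using neg by blast
    have "\<sigma> * (gradF p \<bullet> X p) > 0" using gr[of p] ep(3,4) by simp
    then have "\<exists>u. touch e p u \<and> \<not> X p \<bullet> (p - gam u) > 0" using ep(6) unfolding escapes_def by blast
    then obtain u where "touch e p u" "X p \<bullet> (p - gam u) \<le> 0" by (auto simp: not_less)
    then show ?thesis using ep by (intro exI[of _ e] exI[of _ p] exI[of _ u]) simp
  qed
  then obtain e p u where *: "\<And>n. 0 < e n" "\<And>n. e n < inverse (Suc n)" "\<And>n. dist (p n) a < inverse (Suc n)" "\<And>n. dist (p n) a < \<delta>" "\<And>n. \<sigma> * F (p n) > 0"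
      "\<And>n. above_tube (e n) (p n)" "\<And>n. touch (e n) (p n) (u n)" "\<And>n. X (p n) \<bullet> (p n - gam (u n)) \<le> 0"
    by metis
  have p: "p \<longlonglongrightarrow> a" by (rule tendsto_harmonic_bound) (rule *)
  have e: "e \<longlonglongrightarrow> 0" by (rule tendsto_harmonic_bound) (simp only: dist_norm diff_0_right real_norm_def abs_of_pos[OF *(1)] *(2))
  obtain r l \<nu> where L: "strict_mono (r :: nat \<Rightarrow> nat)" "(\<lambda>n. u (r n)) \<longlonglongrightarrow> l" "\<bar>l\<bar> \<le> 1" "gam l = a"
     "(\<lambda>n. (1 / norm (p (r n) - gam (u (r n)))) *\<^sub>R (p (r n) - gam (u (r n)))) \<longlonglongrightarrow> \<nu>" "norm \<nu> = 1"
     "\<bar>l\<bar> < 1 \<longrightarrow> \<nu> \<bullet> gam' l = 0" "\<bar>l\<bar> = 1 \<longrightarrow> l * (\<nu> \<bullet> gam' l) \<ge> 0"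
    by (rule touch_limit[OF *(1) e p *(6,7)])
  have pr: "(\<lambda>n. p (r n)) \<longlonglongrightarrow> a" using LIMSEQ_subseq_LIMSEQ[OF p L(1)] by (simp add: o_def)
  define w where "w n = (1 / norm (p (r n) - gam (u (r n)))) *\<^sub>R (p (r n) - gam (u (r n)))" for n
  have wl: "w \<longlonglongrightarrow> \<nu>" using L(5) by (simp add: w_def[abs_def])
  have lG: "poly g l = a$1" "poly f l = a$2" using L(4) gam_nth[of l] by auto
  have G: "poly (pderiv (cheb d)) l \<noteq> 0" if "\<bar>poly (cheb d) l\<bar> < 1" "d > 0" for d
    using cheb_pell_real[of l d] that abs_square_less_1[of "poly (cheb d) l"] by auto
  have G1: "poly (pderiv g) l \<noteq> 0" "poly (pderiv f) l \<noteq> 0" using G[of d1] G[of d2] lG a1 d1 d2 by auto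
  have "\<bar>l\<bar> \<noteq> 1"
  proof
    assume "\<bar>l\<bar> = 1"
    then have "l = 1 \<or> l = -1" by linarith
    then have "\<bar>poly g l\<bar> = 1" by (auto simp: cheb_one cheb_minus_one power_abs)
    then show False using lG(1) a1 by simp
  qed
  then have perp: "\<nu>$1 * poly (pderiv g) l = - (\<nu>$2 * poly (pderiv f) l)" using L(3,7) by (simp add: inner2)
  have "(\<nu>$1 * poly (pderiv g) l) * (\<nu>$2 * poly (pderiv f) l) < 0"
  proof -
    have "\<nu> \<noteq> 0" using L(6) by auto
    then have "\<nu>$2 * poly (pderiv f) l \<noteq> 0" using perp G1 by (auto simp: vec2_eq_iff)
    then have "0 < (\<nu>$2 * poly (pderiv f) l) * (\<nu>$2 * poly (pderiv f) l)" using not_real_square_gt_zero by blast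
    then show ?thesis unfolding perp by simp
  qed
  moreover have "(\<lambda>n. (w n$1 * poly (pderiv g) (u (r n))) * (w n$2 * poly (pderiv f) (u (r n)))) \<longlonglongrightarrow>
      (\<nu>$1 * poly (pderiv g) l) * (\<nu>$2 * poly (pderiv f) l)" by (intro tendsto_intros wl L(2))
  ultimately have ev1: "\<forall>\<^sub>F n in sequentially. (w n$1 * poly (pderiv g) (u (r n))) * (w n$2 * poly (pderiv f) (u (r n))) < 0"
    by (rule order_tendstoD(2)[rotated])
  have "(\<lambda>n. gam (u (r n))) \<longlonglongrightarrow> a" using tendsto_gam[OF L(2)] L(4) by simp
  then have ev2: "\<forall>\<^sub>F n in sequentially. dist (gam (u (r n))) a < \<delta>" using \<delta> tendstoD by blast
  obtain n where n: "(w n$1 * poly (pderiv g) (u (r n))) * (w n$2 * poly (pderiv f) (u (r n))) < 0" "dist (gam (u (r n))) a < \<delta>"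
    using eventually_happens'[OF _ eventually_conj[OF ev1 ev2]] by auto
  define P where "P = p (r n)"
  define U where "U = u (r n)"
  define s where "s = 1 / norm (P - gam U)"
  have "s\<^sup>2 * ((P$1 - poly g U) * (P$2 - poly f U) * (poly (pderiv g) U * poly (pderiv f) U)) < 0"
    using n(1) by (simp add: w_def P_def[symmetric] U_def[symmetric] s_def[symmetric] power2_eq_square mult_ac)
  then have sg: "(P$1 - poly g U) * (P$2 - poly f U) * (poly (pderiv g) U * poly (pderiv f) U) < 0"
    by (simp add: mult_less_0_iff not_less)
  have nP: "dist P a < \<delta>" "dist (gam U) a < \<delta>" "\<sigma> * F P > 0" using *(4,5) n by (auto simp: P_def U_def)
  have XP: "X P \<bullet> (P - gam U) \<le> 0" using *(8) by (simp add: P_def U_def)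
  have nU: "\<bar>poly g U - a$1\<bar> < \<delta>" "\<bar>poly f U - a$2\<bar> < \<delta>" using near[OF nP(2)] by simp_all
  have on: "poly fa (poly g U) = poly ga (poly f U)" by (simp add: fa_def ga_def cheb_commute)
  have tan: "poly (pderiv fa) (poly g U) * poly (pderiv g) U = poly (pderiv ga) (poly f U) * poly (pderiv f) U"
    using gradF_gam[of U] by (simp add: fa_def ga_def pderiv_smult pderiv_minus inner2)
  show False
  proof (cases "\<sigma> = -\<tau>")
    case True
    then have gt: "poly fa (P$1) > poly ga (P$2)" using nP Fp[of P] by simp
    have "(P$1 - a$1) * (P$1 - poly g U) > 0"
      by (rule saddle_sign[OF fs gs ga0 eq near(1)[OF nP(1)] nU(1) near(2)[OF nP(1)] nU(2) on gt tan sg])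
    then show False using XP True by (simp add: X_def inner_axis')
  next
    case False
    then have gt: "poly ga (P$2) > poly fa (P$1)" using nP Fp[of P] \<sigma>\<tau> by auto
    have sg2: "(P$2 - poly f U) * (P$1 - poly g U) * (poly (pderiv f) U * poly (pderiv g) U) < 0"
      using sg by (simp add: mult_ac)
    have "(P$2 - a$2) * (P$2 - poly f U) > 0"
      by (rule saddle_sign[OF gs fs fa0 eq[symmetric] near(2)[OF nP(1)] nU(2) near(1)[OF nP(1)] nU(1) on[symmetric] gt tan[symmetric] sg2])
    then show False using XP False by (simp add: X_def inner_axis')
  qed
qed

text \<open>Boundary points of a thin tube are close to the compact curve, which is covered by finitely many of
  the neighbourhoods where escape directions exist.\<close>
lemma escape_uniform:
  "\<exists>\<epsilon>>0. \<forall>e p. 0 < e \<and> e < \<epsilon> \<and> F p \<noteq> 0 \<and> above_tube e p \<and> (\<exists>u. touch e p u) \<longrightarrow> escapes (sgn (F p)) e p"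
proof -
  have "\<exists>\<delta>>0. \<forall>e p. 0 < e \<and> e < \<delta> \<and> dist p a < \<delta> \<and> F p \<noteq> 0 \<and> above_tube e p \<longrightarrow> escapes (sgn (F p)) e p"
    if "a \<in> gam ` {-1..1}" for a
  proof -
    have "\<exists>\<delta>>0. \<forall>e p. 0 < e \<and> e < \<delta> \<and> dist p a < \<delta> \<and> \<sigma> * F p > 0 \<and> above_tube e p \<longrightarrow> escapes \<sigma> e p"
      if "\<bar>\<sigma>\<bar> = 1" for \<sigma>
      using escape_smooth[of a \<sigma>] escape_node[of a \<sigma>] \<open>a \<in> gam ` {-1..1}\<close> that by blast
    from this[of 1] this[of "-1"] obtain \<delta>1 \<delta>2 where
      1: "\<delta>1 > 0" "\<And>e p. 0 < e \<and> e < \<delta>1 \<and> dist p a < \<delta>1 \<and> F p > 0 \<and> above_tube e p \<longrightarrow> escapes 1 e p" and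
      2: "\<delta>2 > 0" "\<And>e p. 0 < e \<and> e < \<delta>2 \<and> dist p a < \<delta>2 \<and> F p < 0 \<and> above_tube e p \<longrightarrow> escapes (-1) e p"
      by auto
    show ?thesis
    proof (intro exI[of _ "min \<delta>1 \<delta>2"] conjI allI impI)
      fix e p assume *: "0 < e \<and> e < min \<delta>1 \<delta>2 \<and> dist p a < min \<delta>1 \<delta>2 \<and> F p \<noteq> 0 \<and> above_tube e p"
      show "escapes (sgn (F p)) e p"
        by (cases "F p > 0") (use * 1(2)[of e p] 2(2)[of e p] in auto)
    qed (use 1 2 in auto)
  qed
  then obtain \<delta> where d: "\<And>a. a \<in> gam ` {-1..1} \<Longrightarrow> \<delta> a > 0"
    "\<And>a e p. a \<in> gam ` {-1..1} \<Longrightarrow> 0 < e \<Longrightarrow> e < \<delta> a \<Longrightarrow> dist p a < \<delta> a \<Longrightarrow> F p \<noteq> 0 \<Longrightarrow> above_tube e p \<Longrightarrow> escapes (sgn (F p)) e p"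
    by metis
  have "compact (gam ` {-1..1})" by (intro compact_continuous_image continuous_gam compact_Icc)
  moreover have "gam ` {-1..1} \<subseteq> (\<Union>a\<in>gam ` {-1..1}. ball a (\<delta> a / 2))" using d(1) by force
  ultimately obtain A where A: "A \<subseteq> gam ` {-1..1}" "finite A" "gam ` {-1..1} \<subseteq> (\<Union>a\<in>A. ball a (\<delta> a / 2))"
    using compactE_image[of "gam ` {-1..1}" "gam ` {-1..1}" "\<lambda>a. ball a (\<delta> a / 2)"] by auto
  have neA: "A \<noteq> {}" using A(3) by auto
  define \<epsilon> where "\<epsilon> = Min ((\<lambda>a. \<delta> a / 2) ` A)"
  have "\<epsilon> > 0" using A d(1) neA by (auto simp: \<epsilon>_def Min_gr_iff)
  moreover have "escapes (sgn (F p)) e p" if h: "0 < e" "e < \<epsilon>" "F p \<noteq> 0" "above_tube e p" "touch e p u" for e p u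
  proof -
    have "gam u \<in> gam ` {-1..1}" using h(5) by (auto simp: touch_def abs_le_iff)
    then obtain a where a: "a \<in> A" "dist a (gam u) < \<delta> a / 2" using A(3) by auto
    have "e < \<delta> a / 2" using h(2) a(1) A(2) by (simp add: \<epsilon>_def neA Min_gr_iff)
    moreover have "dist p (gam u) \<le> e" using touch_norm(3)[OF h(1,4,5)] by (simp add: dist_norm)
    ultimately have "dist p a < \<delta> a" using a(2) dist_triangle[of p a "gam u"] by (simp add: dist_commute)
    then show ?thesis using d(2)[of a e p] a(1) A(1) h \<open>e < \<delta> a / 2\<close> by (auto simp: subset_iff)
  qed
  ultimately show ?thesis by blast
qed

end

section \<open>Counting the components\<close>

lemma compact_unit_ball: "compact unit_ball"
proof -
  have "unit_ball = cball (0::real^3) 1"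
  proof -
    have "(norm p)\<^sup>2 = (p $ 1)\<^sup>2 + (p $ 2)\<^sup>2 + (p $ 3)\<^sup>2" for p :: "real^3"
      by (simp add: power2_norm_eq_inner inner_vec_def sum_3) (simp add: power2_eq_square)
    then have "p \<in> unit_ball \<longleftrightarrow> (norm p)\<^sup>2 \<le> 1" for p by (simp add: unit_ball_def)
    moreover have "(norm p)\<^sup>2 \<le> 1 \<longleftrightarrow> norm p \<le> 1" for p :: "real^3" using abs_square_le_1[of "norm p"] by simp
    ultimately show ?thesis by (simp add: set_eq_iff)
  qed
  then show ?thesis using compact_cball[of "0::real^3" 1] by metis
qed

context cheb_curve begin

definition tube :: "real \<Rightarrow> (real^2) set" where
  "tube e = {z. \<exists>u\<in>{-1..1}. (norm (z - gam u))\<^sup>2 \<le> e\<^sup>2 * (1 - u\<^sup>2)}"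

lemma phi_image_ball:
  assumes "e > 0" shows "phi d1 d2 e ` unit_ball = tube e"
proof (intro equalityI subsetI)
  fix z assume "z \<in> phi d1 d2 e ` unit_ball"
  then obtain p where p: "(p $ 1)\<^sup>2 + (p $ 2)\<^sup>2 + (p $ 3)\<^sup>2 \<le> 1" "z = phi d1 d2 e p" by (auto simp: unit_ball_def)
  have "(p $ 1)\<^sup>2 \<le> 1" using p(1) zero_le_power2[of "p $ 2"] zero_le_power2[of "p $ 3"] by linarith
  then have u: "p $ 1 \<in> {-1..1}" by (simp add: abs_square_le_1 abs_le_iff)
  have "(norm (z - gam (p $ 1)))\<^sup>2 = e\<^sup>2 * ((p $ 2)\<^sup>2 + (p $ 3)\<^sup>2)"
    by (simp add: norm2_sq p(2) phi_def power_mult_distrib algebra_simps)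
  also have "\<dots> \<le> e\<^sup>2 * (1 - (p $ 1)\<^sup>2)" using p(1) by (intro mult_left_mono) auto
  finally show "z \<in> tube e" using u by (auto simp: tube_def)
next
  fix z assume "z \<in> tube e"
  then obtain u where u: "u \<in> {-1..1}" "(norm (z - gam u))\<^sup>2 \<le> e\<^sup>2 * (1 - u\<^sup>2)" by (auto simp: tube_def)
  define p where "p = (vector [u, (z $ 1 - poly g u) / e, (z $ 2 - poly f u) / e] :: real^3)"
  have pn: "p $ 1 = u" "p $ 2 = (z $ 1 - poly g u) / e" "p $ 3 = (z $ 2 - poly f u) / e" by (simp_all add: p_def)
  have "(z $ 1 - poly g u)\<^sup>2 + (z $ 2 - poly f u)\<^sup>2 \<le> e\<^sup>2 * (1 - u\<^sup>2)" using u(2) by (simp add: norm2_sq)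
  then have "((z $ 1 - poly g u)\<^sup>2 + (z $ 2 - poly f u)\<^sup>2) / e\<^sup>2 \<le> 1 - u\<^sup>2"
    using assms by (simp add: divide_le_eq mult.commute)
  then have "p \<in> unit_ball" by (simp add: unit_ball_def pn power_divide add_divide_distrib)
  moreover have "phi d1 d2 e p = z" using assms by (simp add: phi_def pn vec2_eq_iff)
  ultimately show "z \<in> phi d1 d2 e ` unit_ball" by blast
qed

lemma compact_tube: assumes "e > 0" shows "compact (tube e)"
proof -
  have "continuous_on unit_ball (phi d1 d2 e)"
    unfolding continuous_on_def
    by (intro ballI vec2_tendsto) (auto simp: phi_def intro!: tendsto_intros)
  then show ?thesis using compact_continuous_image compact_unit_ball phi_image_ball[OF assms] by metis
qed

lemma gam_in_tube: "u \<in> {-1..1} \<Longrightarrow> gam u \<in> tube e"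
  by (auto simp: tube_def abs_square_le_1 abs_le_iff intro!: bexI[of _ u])

lemma F_has_derivative: "(F has_derivative (\<lambda>h. gradF z \<bullet> h)) (at z)"
proof -
  have "((\<lambda>z. poly f (z $ 1) - poly g (z $ 2)) has_derivative
     (\<lambda>h. h $ 1 * poly (pderiv f) (z $ 1) - h $ 2 * poly (pderiv g) (z $ 2))) (at z)"
    by (intro has_derivative_diff DERIV_compose_FDERIV[of "poly _"] poly_DERIV
        bounded_linear.has_derivative[OF bounded_linear_vec_nth has_derivative_ident])
  moreover have "F = (\<lambda>z. poly f (z $ 1) - poly g (z $ 2))" by (simp add: fun_eq_iff F_def)
  ultimately show ?thesis by (simp add: inner2 mult.commute)
qed

text \<open>On a vertical segment \<open>F\<close> is a nonconstant polynomial.\<close>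
lemma F_not_locally_zero:
  assumes "open U" "U \<noteq> {}" shows "\<exists>z\<in>U. F z \<noteq> 0"
proof (rule ccontr)
  assume neg: "\<not> ?thesis"
  obtain z r where z: "r > 0" "ball z r \<subseteq> U" using assms by (metis all_not_in_conv openE)
  let ?Q = "g - [:poly f (z $ 1):]"
  have "poly ?Q (z $ 2 + t) = 0" if "t \<in> {0<..<r}" for t
  proof -
    have "z + t *\<^sub>R axis 2 1 \<in> ball z r" using that by (simp add: dist_norm norm_axis_1)
    then have "F (z + t *\<^sub>R axis 2 1) = 0" using z(2) neg by blast
    then show ?thesis by (simp add: F_def axis_def)
  qed
  then have "(\<lambda>t. z $ 2 + t) ` {0<..<r} \<subseteq> {x. poly ?Q x = 0}" by blast
  moreover have "infinite ((\<lambda>t. z $ 2 + t) ` {0<..<r})"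
    using z(1) by (subst finite_image_iff) (auto simp: inj_on_def)
  ultimately have "?Q = 0" using poly_roots_finite[of ?Q] finite_subset by blast
  then have "g = [:poly f (z $ 1):]" by simp
  then have "degree g = 0" by (metis degree_pCons_0)
  then show False using degree_cheb[of d1, where 'a = real] d1 by simp
qed

text \<open>Indices of the critical points of \<open>F\<close> with a nonzero critical value.\<close>
definition grid :: "(nat \<times> nat) set" where
  "grid = {(i, j). 0 < i \<and> i < d2 \<and> 0 < j \<and> j < d1 \<and> odd (i + j)}"

definition centre :: "nat \<times> nat \<Rightarrow> real^2" where
  "centre a = vector [cos (real (fst a) * pi / real d2), cos (real (snd a) * pi / real d1)]"

lemma centre_nth [simp]: "centre a $ 1 = cos (real (fst a) * pi / real d2)" "centre a $ 2 = cos (real (snd a) * pi / real d1)"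
  by (simp_all add: centre_def)

lemma F_centre: "F (centre a) = (-1) ^ fst a - (-1) ^ snd a"
  using cheb_at_critical[OF d1] cheb_at_critical[OF d2] by (simp add: F_def)

lemma critical_points:
  assumes "gradF p = 0" "F p \<noteq> 0" obtains a where "a \<in> grid" "p = centre a"
proof -
  have c: "poly (pderiv f) (p$1) = 0" "poly (pderiv g) (p$2) = 0" using assms(1) gradF_nth[of p] by auto
  obtain i where i: "0 < i" "i < d2" "p$1 = cos (real i * pi / real d2)" by (rule pderiv_cheb_critical[OF d2 c(1)])
  obtain j where j: "0 < j" "j < d1" "p$2 = cos (real j * pi / real d1)" by (rule pderiv_cheb_critical[OF d1 c(2)])
  have p: "p = centre (i, j)" using i j by (simp add: vec2_eq_iff)
  have "odd (i + j)"
  proof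
    assume "even (i + j)"
    then have "(-1::real) ^ i = (-1) ^ j" by (auto simp: minus_one_power_iff)
    then show False using assms(2) unfolding p F_centre by simp
  qed
  then show ?thesis using that[of "(i, j)"] p i j by (simp add: grid_def)
qed

text \<open>In the coordinates \<open>d\<^sub>2 arccos x / \<pi>\<close> and \<open>d\<^sub>1 arccos y /
  \<pi>\<close> the curve consists of the diagonal lines through the integer points with even
  coordinate sum; the diamonds are the squares of this pattern around the points with odd sum.\<close>
definition diamond :: "nat \<times> nat \<Rightarrow> (real^2) set" where
  "diamond a = {z. \<bar>z $ 1\<bar> < 1 \<and> \<bar>z $ 2\<bar> < 1 \<and>
     \<bar>d2 * arccos (z $ 1) / pi - real (fst a)\<bar> + \<bar>d1 * arccos (z $ 2) / pi - real (snd a)\<bar> < 1}"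

lemma continuous_on_diamond_fun:
  "continuous_on {z. \<bar>z $ 1\<bar> \<le> 1 \<and> \<bar>z $ 2\<bar> \<le> 1}
     (\<lambda>z::real^2. \<bar>d2 * arccos (z $ 1) / pi - real (fst a)\<bar> + \<bar>d1 * arccos (z $ 2) / pi - real (snd a)\<bar>)"
  by (intro continuous_intros continuous_on_arccos) auto

lemma centre_in_diamond: assumes "a \<in> grid" shows "centre a \<in> diamond a"
proof -
  have k: "\<bar>cos (real i * pi / real d)\<bar> < 1 \<and> arccos (cos (real i * pi / real d)) = real i * pi / real d"
    if "0 < i" "i < d" for i d :: nat
  proof -
    have r: "0 < real i * pi / real d" "real i * pi / real d < pi" using that by (auto simp: field_simps)
    then have "(cos (real i * pi / real d))\<^sup>2 < 1" using sin_gt_zero[OF r] by (simp add: cos_squared_eq)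
    then show ?thesis using r by (simp add: abs_square_less_1 arccos_cos)
  qed
  show ?thesis using assms k[of "fst a" d2] k[of "snd a" d1] d1 d2
    by (auto simp: grid_def diamond_def)
qed

text \<open>Distinct integer points with odd coordinate sum have distance at least 2 in the sum norm.\<close>
lemma diamonds_disjoint:
  assumes "a \<in> grid" "b \<in> grid" "diamond a \<inter> diamond b \<noteq> {}" shows "a = b"
proof -
  obtain z where z: "z \<in> diamond a" "z \<in> diamond b" using assms(3) by blast
  have "\<bar>real (fst a) - real (fst b)\<bar> + \<bar>real (snd a) - real (snd b)\<bar> < 2"
  proof -
    have "\<bar>d2 * arccos (z $ 1) / pi - real (fst a)\<bar> + \<bar>d1 * arccos (z $ 2) / pi - real (snd a)\<bar> < 1"
      "\<bar>d2 * arccos (z $ 1) / pi - real (fst b)\<bar> + \<bar>d1 * arccos (z $ 2) / pi - real (snd b)\<bar> < 1"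
      using z by (auto simp: diamond_def)
    moreover have "\<bar>a1 - b1\<bar> + \<bar>a2 - b2\<bar> < 2" if "\<bar>P - a1\<bar> + \<bar>R - a2\<bar> < 1" "\<bar>P - b1\<bar> + \<bar>R - b2\<bar> < 1"
      for P R a1 a2 b1 b2 :: real using that by linarith
    ultimately show ?thesis by blast
  qed
  then have l: "\<bar>int (fst a) - int (fst b)\<bar> + \<bar>int (snd a) - int (snd b)\<bar> < 2" by linarith
  have "odd (int (fst a) + int (snd a))" "odd (int (fst b) + int (snd b))"
    using assms by (auto simp: grid_def)
  then have "int (fst a) = int (fst b) \<and> int (snd a) = int (snd b)" using l by presburger
  then show ?thesis by (simp add: prod_eq_iff)
qed

lemma bounded_diamond: "bounded (diamond a)"
proof (rule boundedI)
  fix z assume "z \<in> diamond a"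
  then show "norm z \<le> 2" using norm_le_l1_cart[of z] by (simp add: diamond_def sum_2)
qed

lemma open_diamond: "open (diamond a)"
proof -
  have "open {z::real^2. \<bar>z $ 1\<bar> < 1 \<and> \<bar>z $ 2\<bar> < 1}"
    by (intro open_Collect_conj open_Collect_less continuous_intros)
  moreover have "continuous_on {z::real^2. \<bar>z $ 1\<bar> < 1 \<and> \<bar>z $ 2\<bar> < 1}
     (\<lambda>z::real^2. \<bar>d2 * arccos (z $ 1) / pi - real (fst a)\<bar> + \<bar>d1 * arccos (z $ 2) / pi - real (snd a)\<bar>)"
    by (rule continuous_on_subset[OF continuous_on_diamond_fun]) auto
  ultimately have "open ({z::real^2. \<bar>z $ 1\<bar> < 1 \<and> \<bar>z $ 2\<bar> < 1} \<inter>
     (\<lambda>z::real^2. \<bar>d2 * arccos (z $ 1) / pi - real (fst a)\<bar> + \<bar>d1 * arccos (z $ 2) / pi - real (snd a)\<bar>) -` {..<1})"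
    by (intro continuous_open_preimage[OF _ _ open_lessThan])
  then show ?thesis by (simp add: diamond_def Collect_conj_eq vimage_def Int_assoc)
qed

text \<open>On the frontier the sum of the two absolute values is 1: the sides \<open>\<bar>x\<bar> = 1\<close>
  and \<open>\<bar>y\<bar> = 1\<close> of the square have at least this distance from the centre. The
  sum being 1 means that sum or difference of the coordinates is an even integer, hence \<open>F =
  0\<close>.\<close>
lemma frontier_diamond:
  assumes "a \<in> grid" shows "frontier (diamond a) \<subseteq> gam ` {-1..1}"
proof
  fix z assume z: "z \<in> frontier (diamond a)"
  define i where "i = fst a"
  define j where "j = snd a"
  have ij: "0 < i" "i < d2" "0 < j" "j < d1" "odd (i + j)" using assms by (auto simp: grid_def i_def j_def)
  define \<alpha> where "\<alpha> = arccos (z $ 1)"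
  define \<beta> where "\<beta> = arccos (z $ 2)"
  define P where "P = d2 * \<alpha> / pi"
  define R where "R = d1 * \<beta> / pi"
  let ?Q = "{z::real^2. \<bar>z $ 1\<bar> \<le> 1 \<and> \<bar>z $ 2\<bar> \<le> 1}"
  let ?E = "?Q \<inter> (\<lambda>z::real^2. \<bar>d2 * arccos (z $ 1) / pi - real (fst a)\<bar> + \<bar>d1 * arccos (z $ 2) / pi - real (snd a)\<bar>) -` {..1}"
  have "closed ?Q" by (intro closed_Collect_conj closed_Collect_le continuous_intros)
  then have "closed ?E" using continuous_on_diamond_fun by (intro continuous_closed_preimage) auto
  moreover have "diamond a \<subseteq> ?E" by (auto simp: diamond_def)
  ultimately have "closure (diamond a) \<subseteq> ?E" by (rule closure_minimal[rotated])
  then have zE: "\<bar>z $ 1\<bar> \<le> 1" "\<bar>z $ 2\<bar> \<le> 1" "\<bar>P - i\<bar> + \<bar>R - j\<bar> \<le> 1"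
    using z by (auto simp: frontier_def P_def R_def \<alpha>_def \<beta>_def i_def j_def)
  have zD: "z \<notin> diamond a" using z by (simp add: frontier_def interior_open[OF open_diamond])
  have edge: "\<bar>real d * arccos x / pi - real k\<bar> \<ge> 1" if "\<bar>x\<bar> = 1" "0 < k" "k < d" for x and k d :: nat
  proof -
    have "x = 1 \<or> x = -1" using that(1) by auto
    then show ?thesis using that(2,3) by auto
  qed
  have eq: "\<bar>P - i\<bar> + \<bar>R - j\<bar> = 1"
  proof (rule ccontr)
    assume "\<not> ?thesis"
    then have lt: "\<bar>P - i\<bar> + \<bar>R - j\<bar> < 1" using zE by simp
    then have "\<bar>z $ 1\<bar> \<noteq> 1" "\<bar>z $ 2\<bar> \<noteq> 1"
      using edge[of "z $ 1" i d2] edge[of "z $ 2" j d1] ij by (auto simp: P_def R_def \<alpha>_def \<beta>_def)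
    then have "z \<in> diamond a" using lt zE by (simp add: diamond_def P_def R_def \<alpha>_def \<beta>_def i_def j_def)
    then show False using zD by simp
  qed
  have per: "cos (pi * P) = cos (pi * R)" if "P = of_int (2 * k) - R \<or> P = of_int (2 * k) + R" for k
  proof -
    have "pi * P = 2 * of_int k * pi - pi * R \<or> pi * P = 2 * of_int k * pi + pi * R"
      using that
    proof
      assume h: "P = of_int (2 * k) - R" show ?thesis unfolding h by (simp add: algebra_simps)
    next
      assume h: "P = of_int (2 * k) + R" show ?thesis unfolding h by (simp add: algebra_simps)
    qed
    then show ?thesis
    proof
      assume "pi * P = 2 * of_int k * pi - pi * R"
      then show ?thesis by (intro cos_eq[THEN iffD2] bexI[of _ "of_int k"]) auto
    next
      assume "pi * P = 2 * of_int k * pi + pi * R"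
      then show ?thesis by (intro cos_eq[THEN iffD2] bexI[of _ "of_int k"]) auto
    qed
  qed
  have "\<exists>k::int. P = of_int (2 * k) - R \<or> P = of_int (2 * k) + R"
  proof -
    have "\<exists>m::int. odd m \<and> (P - i + (R - j) = of_int m \<or> P - i - (R - j) = of_int m)"
    proof (cases "0 \<le> P - i"; cases "0 \<le> R - j")
      assume "0 \<le> P - i" "0 \<le> R - j" then show ?thesis using eq by (intro exI[of _ 1]) auto
    next
      assume "0 \<le> P - i" "\<not> 0 \<le> R - j" then show ?thesis using eq by (intro exI[of _ 1]) auto
    next
      assume "\<not> 0 \<le> P - i" "0 \<le> R - j" then show ?thesis using eq by (intro exI[of _ "-1"]) auto
    next
      assume "\<not> 0 \<le> P - i" "\<not> 0 \<le> R - j" then show ?thesis using eq by (intro exI[of _ "-1"]) auto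
    qed
    then obtain m :: int where m: "odd m" "P - i + (R - j) = of_int m \<or> P - i - (R - j) = of_int m" by blast
    from m(2) show ?thesis
    proof
      assume h: "P - i + (R - j) = of_int m"
      have "even (m + int i + int j)" using m(1) ij(5) by simp
      then obtain k where "m + int i + int j = 2 * k" by blast
      then have "of_int (2 * k) = (of_int m + real i + real j :: real)" by (metis of_int_add of_int_of_nat_eq)
      then show ?thesis using h by (intro exI[of _ k] disjI1) linarith
    next
      assume h: "P - i - (R - j) = of_int m"
      have "even (m + int i - int j)" using m(1) ij(5) by simp
      then obtain k where "m + int i - int j = 2 * k" by blast
      then have "of_int (2 * k) = (of_int m + real i - real j :: real)" by (metis of_int_add of_int_diff of_int_of_nat_eq)
      then show ?thesis using h by (intro exI[of _ k] disjI2) linarith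
    qed
  qed
  then have "cos (pi * P) = cos (pi * R)" using per by blast
  then have "cos (d2 * \<alpha>) = cos (d1 * \<beta>)" by (simp add: P_def R_def)
  moreover have "z $ 1 = cos \<alpha>" "z $ 2 = cos \<beta>" using zE by (simp_all add: \<alpha>_def \<beta>_def cos_arccos_abs)
  ultimately have "poly f (z $ 1) = poly g (z $ 2)" by (simp add: cheb_cos)
  then obtain u where "\<bar>u\<bar> \<le> 1" "z $ 1 = poly g u" "z $ 2 = poly f u"
    using cheb_curve_param[OF d1 d2 cop zE(1,2)] by blast
  then show "z \<in> gam ` {-1..1}" by (intro image_eqI[of _ _ u]) (auto simp: vec2_eq_iff abs_le_iff)
qed

text \<open>The component avoids the curve and thus the frontier of the diamond.\<close>
lemma component_in_diamond:
  assumes "a \<in> grid" "C \<in> components (- tube e)" "centre a \<in> C" shows "C \<subseteq> diamond a"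
proof (rule ccontr)
  assume "\<not> C \<subseteq> diamond a"
  then have "C \<inter> frontier (diamond a) \<noteq> {}"
    using centre_in_diamond[OF assms(1)] assms(3) in_components_connected[OF assms(2)]
    by (intro connected_Int_frontier) auto
  then show False using frontier_diamond[OF assms(1)] gam_in_tube in_components_subset[OF assms(2)] by blast
qed

lemma finite_grid: "finite grid"
  by (rule finite_subset[of _ "{..<d2} \<times> {..<d1}"]) (auto simp: grid_def)

text \<open>Reflecting in an odd direction exchanges the points of odd and even coordinate sum; one of the two
  numbers is odd by coprimality.\<close>
lemma card_grid: "2 * card grid = (d1 - 1) * (d2 - 1)"
proof -
  define E where "E = {1..<d2} \<times> {1..<d1}"
  define ev where "ev = {a \<in> E. even (fst a + snd a)}"
  have gr: "grid = {a \<in> E. odd (fst a + snd a)}" by (auto simp: grid_def E_def)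
  \<comment> \<open>reflection in the midpoint of an odd side length changes the parity of the sum\<close>
  define flip where "flip a = (if odd d2 then (d2 - fst a, snd a) else (fst a, d1 - snd a))" for a :: "nat \<times> nat"
  have oo: "odd d2 \<or> odd d1" using cop coprime_common_divisor[of d1 d2 2] by auto
  have "bij_betw flip grid ev"
    by (rule bij_betw_byWitness[of _ flip]) (use oo in \<open>auto simp: gr ev_def E_def flip_def\<close>)
  then have "card grid = card ev" by (rule bij_betw_same_card)
  moreover have "card E = card grid + card ev"
  proof -
    have "E = grid \<union> ev" "grid \<inter> ev = {}" by (auto simp: gr ev_def)
    moreover have "finite E" by (simp add: E_def)
    ultimately show ?thesis by (metis card_Un_disjoint finite_Un)
  qed
  moreover have "card E = (d1 - 1) * (d2 - 1)" by (simp add: E_def)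
  ultimately show ?thesis by simp
qed

lemma centres_outside_tube:
  "\<exists>\<epsilon>>0. \<forall>e. 0 < e \<and> e < \<epsilon> \<longrightarrow> centre ` grid \<inter> tube e = {}"
proof -
  have cl: "closed (gam ` {-1..1})"
    by (intro compact_imp_closed compact_continuous_image continuous_gam compact_Icc)
  have "\<exists>d>0. \<forall>x\<in>gam ` {-1..1}. d \<le> dist (centre a) x" if "a \<in> grid" for a
  proof (rule separate_point_closed[OF cl])
    have "F (centre a) \<noteq> 0" using that unfolding F_centre by (auto simp: grid_def minus_one_power_iff)
    then show "centre a \<notin> gam ` {-1..1}" using F_gam by force
  qed
  then obtain d where d: "\<And>a. a \<in> grid \<Longrightarrow> d a > 0" "\<And>a u. a \<in> grid \<Longrightarrow> u \<in> {-1..1} \<Longrightarrow> d a \<le> dist (centre a) (gam u)"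
    by (metis imageI)
  define \<epsilon> where "\<epsilon> = Min (insert 1 (d ` grid))"
  have "\<epsilon> > 0" using finite_grid d(1) by (auto simp: \<epsilon>_def Min_gr_iff)
  moreover have "centre a \<notin> tube e" if h: "a \<in> grid" "0 < e" "e < \<epsilon>" for a e
  proof
    assume "centre a \<in> tube e"
    then obtain u where u: "u \<in> {-1..1}" "(norm (centre a - gam u))\<^sup>2 \<le> e\<^sup>2 * (1 - u\<^sup>2)" by (auto simp: tube_def)
    have "e\<^sup>2 * (1 - u\<^sup>2) \<le> e\<^sup>2" by (simp add: mult_left_le)
    then have "norm (centre a - gam u) \<le> e" using u(2) h(2) by (meson less_imp_le order_trans power2_le_imp_le)
    moreover have "e < d a" using h finite_grid by (simp add: \<epsilon>_def Min_gr_iff)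
    ultimately show False using d(2)[OF h(1) u(1)] by (simp add: dist_norm)
  qed
  ultimately show ?thesis by blast
qed

text \<open>Assigning to a grid point the component of its centre is a bijection onto the bounded components: it
  is injective since components stay in disjoint diamonds, and surjective since a bounded component
  contains a critical point. There is exactly one unbounded component.\<close>
lemma tube_components:
  "\<exists>\<epsilon>>0. \<forall>e. 0 < e \<and> e < \<epsilon> \<longrightarrow> finite (components (- tube e)) \<and> card (components (- tube e)) = card grid + 1"
proof -
  obtain \<epsilon>1 where e1: "\<epsilon>1 > 0" "\<And>e p u. 0 < e \<Longrightarrow> e < \<epsilon>1 \<Longrightarrow> F p \<noteq> 0 \<Longrightarrow> above_tube e p \<Longrightarrow> touch e p u \<Longrightarrow> escapes (sgn (F p)) e p"
    using escape_uniform by blast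
  obtain \<epsilon>2 where e2: "\<epsilon>2 > 0" "\<And>e. 0 < e \<Longrightarrow> e < \<epsilon>2 \<Longrightarrow> centre ` grid \<inter> tube e = {}"
    using centres_outside_tube by blast
  have "finite (components (- tube e)) \<and> card (components (- tube e)) = card grid + 1" if e: "0 < e" "e < \<epsilon>1" "e < \<epsilon>2" for e
  proof -
    have cmp: "compact (tube e)" by (rule compact_tube[OF e(1)])
    define B where "B = {C \<in> components (- tube e). bounded C}"
    have crit: "\<exists>a\<in>grid. centre a \<in> C" if C: "C \<in> components (- tube e)" "bounded C" for C
    proof -
      have "\<exists>p\<in>C. F p \<noteq> 0 \<and> gradF p = 0"
      proof (rule bounded_component_contains_critical_point[where I = "{-1..1::real}" and gam = gam and rad = "\<lambda>u. e\<^sup>2 * (1 - u\<^sup>2)"])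
        show "continuous_on {-1..1} (\<lambda>u. e\<^sup>2 * (1 - u\<^sup>2))" by (intro continuous_intros)
        show "closed {z. \<exists>u\<in>{- 1..1}. (norm (z - gam u))\<^sup>2 \<le> e\<^sup>2 * (1 - u\<^sup>2)}"
          using compact_imp_closed[OF cmp] by (simp add: tube_def)
        show "C \<in> components (- {z. \<exists>u\<in>{- 1..1}. (norm (z - gam u))\<^sup>2 \<le> e\<^sup>2 * (1 - u\<^sup>2)})"
          using C(1) by (simp add: tube_def)
        show "\<exists>X. (\<forall>u\<in>{- 1..1}. (norm (p - gam u))\<^sup>2 = e\<^sup>2 * (1 - u\<^sup>2) \<longrightarrow> 0 < X \<bullet> (p - gam u)) \<and> 0 < sgn (F p) * (gradF p \<bullet> X)"
          if p: "F p \<noteq> 0" "\<And>u. u \<in> {- 1..1} \<Longrightarrow> e\<^sup>2 * (1 - u\<^sup>2) \<le> (norm (p - gam u))\<^sup>2"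
            "\<exists>u\<in>{- 1..1}. (norm (p - gam u))\<^sup>2 = e\<^sup>2 * (1 - u\<^sup>2)" for p
        proof -
          have I: "u \<in> {-1..1} \<longleftrightarrow> \<bar>u\<bar> \<le> 1" for u :: real by auto
          have "above_tube e p" unfolding above_tube_def
          proof (intro allI impI)
            fix u :: real assume "\<bar>u\<bar> \<le> 1"
            then show "e\<^sup>2 * (1 - u\<^sup>2) \<le> (norm (p - gam u))\<^sup>2" using p(2)[of u] by (simp only: I)
          qed
          moreover obtain u where "u \<in> {-1..1}" "(norm (p - gam u))\<^sup>2 = e\<^sup>2 * (1 - u\<^sup>2)" using p(3) by blast
          then have "touch e p u" unfolding touch_def I by blast
          ultimately have "escapes (sgn (F p)) e p" using e1(2) e p(1) by blast
          then show ?thesis unfolding escapes_def touch_def Ball_def I by blast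
        qed
      qed (use C F_has_derivative F_not_locally_zero continuous_gam in auto)
      then obtain p where p: "p \<in> C" "F p \<noteq> 0" "gradF p = 0" by blast
      then obtain a where "a \<in> grid" "p = centre a" using critical_points by blast
      then show ?thesis using p(1) by blast
    qed
    define K where "K a = connected_component_set (- tube e) (centre a)" for a
    have K: "K a \<in> components (- tube e)" "centre a \<in> K a" if "a \<in> grid" for a
    proof -
      have "centre a \<in> - tube e" using e2(2)[OF e(1,3)] that by blast
      then show "K a \<in> components (- tube e)" "centre a \<in> K a"
        by (auto simp: K_def componentsI connected_component_refl)
    qed
    have "bij_betw K grid B"
    proof (rule bij_betwI')
      fix a b assume ab: "a \<in> grid" "b \<in> grid"
      show "(K a = K b) = (a = b)"
      proof
        assume "K a = K b"
        then have "centre a \<in> diamond a" "centre a \<in> diamond b"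
          using centre_in_diamond[OF ab(1)] K[OF ab(1)] component_in_diamond[OF ab(2) K[OF ab(2)]] by auto
        then show "a = b" using diamonds_disjoint[OF ab] by blast
      qed simp
    next
      fix a assume "a \<in> grid"
      then have "K a \<subseteq> diamond a" using component_in_diamond[OF _ K] by simp
      then show "K a \<in> B" using K(1)[OF \<open>a \<in> grid\<close>] bounded_subset[OF bounded_diamond] by (simp add: B_def)
    next
      fix C assume C: "C \<in> B"
      then obtain a where a: "a \<in> grid" "centre a \<in> C" using crit[of C] unfolding B_def by blast
      have "C = K a" using components_nonoverlap[of C "- tube e" "K a"] C a K[OF a(1)] by (auto simp: B_def)
      then show "\<exists>a\<in>grid. C = K a" using a by blast
    qed
    then have cB: "card B = card grid" and fB: "finite B"
      using bij_betw_same_card bij_betw_finite finite_grid by metis+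
    have bt: "bounded (- (- tube e))" using compact_imp_bounded[OF cmp] by simp
    obtain V where V: "V \<in> components (- tube e)" "\<not> bounded V"
      using cobounded_unbounded_components[OF bt] by blast
    have uniq: "W = V" if "W \<in> components (- tube e)" "\<not> bounded W" for W
      by (rule cobounded_unique_unbounded_components[OF bt V that]) simp
    have "components (- tube e) = insert V B" using V(1) uniq unfolding B_def by blast
    moreover have "V \<notin> B" using V by (simp add: B_def)
    ultimately show ?thesis using cB fB by simp
  qed
  then show ?thesis using e1(1) e2(1) by (intro exI[of _ "min \<epsilon>1 \<epsilon>2"]) auto
qed

theorem components_of_complement:
  "\<exists>\<epsilon>>0. \<forall>e. 0 < e \<and> e < \<epsilon> \<longrightarrow> finite (components (- (phi d1 d2 e ` unit_ball))) \<and>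
      real (card (components (- (phi d1 d2 e ` unit_ball)))) = (real d1 - 1) * (real d2 - 1) / 2 + 1"
proof -
  have "real (2 * card grid) = real ((d1 - 1) * (d2 - 1))" by (simp only: card_grid)
  then have "real (card grid + 1) = (real d1 - 1) * (real d2 - 1) / 2 + 1"
    using d1 d2 by (simp add: of_nat_diff)
  moreover obtain \<epsilon> where "\<epsilon> > 0"
    "\<And>e. 0 < e \<Longrightarrow> e < \<epsilon> \<Longrightarrow> finite (components (- tube e)) \<and> card (components (- tube e)) = card grid + 1"
    using tube_components by blast
  ultimately show ?thesis by (intro exI[of _ \<epsilon>]) (simp add: phi_image_ball)
qed

end

section \<open>Plane polynomials: total degree, weights and resultants\<close>

lemma eval2_pCons: "eval2 (pCons c P) z = poly c (z $ 1) + z $ 2 * eval2 P z"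
  by (simp add: eval2_def)
lemma eval2_0 [simp]: "eval2 0 z = 0" by (simp add: eval2_def)
lemma eval2_1 [simp]: "eval2 1 z = 1" by (simp add: eval2_def)
lemma eval2_add: "eval2 (P + Q) z = eval2 P z + eval2 Q z" by (simp add: eval2_def)
lemma eval2_mult: "eval2 (P * Q) z = eval2 P z * eval2 Q z" by (simp add: eval2_def)

lemma eval2_hom: "comm_ring_hom (\<lambda>P. eval2 P z)"
  by unfold_locales (auto simp: eval2_add eval2_mult)

lemma eval2_dvd: "P dvd Q \<Longrightarrow> eval2 P z = 0 \<Longrightarrow> eval2 Q z = 0"
  by (auto simp: dvd_def eval2_mult)

text \<open>The substitution of \<open>x t\<close> for \<open>x\<close> and \<open>t\<close> for
  \<open>y\<close> is a ring homomorphism that sends \<open>x\<^sup>i y\<^sup>j\<close> to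
  \<open>x\<^sup>i t\<^sup>i\<^sup>+\<^sup>j\<close>. It turns the total degree into the degree in
  \<open>t\<close>, which is additive on products.\<close>
definition scale_x :: "complex poly \<Rightarrow> complex poly poly" where
  "scale_x c = poly (map_poly (\<lambda>a. [:[:a:]:]) c) [:0, [:0, 1:]:]"
definition homog :: "complex poly poly \<Rightarrow> complex poly poly" where
  "homog P = poly (map_poly scale_x P) [:0, 1:]"

lemma const_hom: "comm_ring_hom (\<lambda>a::complex. [:[:a:]:])"
  by unfold_locales auto

lemma scale_x_hom: "comm_ring_hom scale_x"
proof -
  interpret comm_ring_hom "\<lambda>a::complex. [:[:a:]:]" by (rule const_hom)
  interpret m: map_poly_comm_ring_hom "\<lambda>a::complex. [:[:a:]:]" by unfold_locales
  show ?thesis by unfold_locales (auto simp: scale_x_def m.hom_add m.hom_mult)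
qed

lemma homog_mult: "homog (P * Q) = homog P * homog Q"
proof -
  interpret comm_ring_hom scale_x by (rule scale_x_hom)
  interpret m: map_poly_comm_ring_hom scale_x by unfold_locales
  show ?thesis by (simp add: homog_def m.hom_mult)
qed

lemma coeff_scale_x: "coeff (scale_x c) m = monom (coeff c m) m"
proof -
  interpret comm_ring_hom "\<lambda>a::complex. [:[:a:]:]" by (rule const_hom)
  have p: "scale_x (pCons a c) = [:[:a:]:] + [:0, [:0, 1:]:] * scale_x c" for a c
    by (simp add: scale_x_def map_poly_pCons_hom)
  show ?thesis
  proof (induction c arbitrary: m)
    case 0 then show ?case by (simp add: scale_x_def)
  next
    case (pCons a c)
    show ?case unfolding p using pCons.IH
      by (cases m) (simp_all add: monom_0 coeff_pCons monom_Suc)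
  qed
qed

lemma coeff_homog: "coeff (coeff (homog P) k) i = (if i \<le> k then coeff (coeff P (k - i)) i else 0)"
proof -
  interpret comm_ring_hom scale_x by (rule scale_x_hom)
  have p: "homog (pCons c P) = scale_x c + [:0, 1:] * homog P" for c P
    by (simp add: homog_def map_poly_pCons_hom)
  show ?thesis
  proof (induction P arbitrary: k)
    case 0 then show ?case by (simp add: homog_def)
  next
    case (pCons c P)
    show ?case unfolding p using pCons.IH
      by (cases k) (auto simp: coeff_scale_x coeff_pCons Suc_diff_le le_Suc_eq split: nat.split)
  qed
qed

lemma finite_monomials: "finite {i + j | i j. coeff (coeff P j) i \<noteq> (0::complex)}"
proof -
  have "{i + j | i j. coeff (coeff P j) i \<noteq> 0} \<subseteq> (\<Union>j\<in>{..degree P}. (\<lambda>i. i + j) ` {..degree (coeff P j)})"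
    by (force intro: le_degree)
  then show ?thesis by (rule finite_subset) auto
qed

lemma total_deg_le: "total_deg P \<le> n \<longleftrightarrow> (\<forall>i j. coeff (coeff P j) i \<noteq> 0 \<longrightarrow> i + j \<le> n)"
  unfolding total_deg_def using finite_monomials[of P] by (subst Max_le_iff) auto

lemma total_deg_eq_degree: "total_deg P = degree (homog P)"
proof (rule antisym)
  show "total_deg P \<le> degree (homog P)"
    unfolding total_deg_le
  proof (intro allI impI)
    fix i j assume "coeff (coeff P j) i \<noteq> 0"
    then have "coeff (coeff (homog P) (i + j)) i \<noteq> 0" by (simp add: coeff_homog)
    then have "coeff (homog P) (i + j) \<noteq> 0" by auto
    then show "i + j \<le> degree (homog P)" by (rule le_degree)
  qed
  show "degree (homog P) \<le> total_deg P"
  proof (rule degree_le, intro allI impI)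
    fix k assume k: "total_deg P < k"
    show "coeff (homog P) k = 0"
    proof (rule poly_eqI)
      fix i
      have "coeff (coeff P (k - i)) i = 0" if "i \<le> k"
        using k that total_deg_le[of P "total_deg P"] by (metis le_add_diff_inverse not_le order_refl)
      then show "coeff (coeff (homog P) k) i = coeff 0 i" by (simp add: coeff_homog)
    qed
  qed
qed

lemma homog_eq_0: "homog P = 0 \<Longrightarrow> P = 0"
proof -
  assume h: "homog P = 0"
  have "coeff (coeff P j) i = 0" for i j using coeff_homog[of P "i + j" i] h by simp
  then show "P = 0" by (intro poly_eqI) simp
qed

lemma total_deg_dvd_mono:
  assumes "P dvd Q" "Q \<noteq> 0" shows "total_deg P \<le> total_deg Q"
proof -
  obtain S where S: "Q = P * S" using assms(1) by (auto simp: dvd_def)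
  then have "homog P \<noteq> 0" "homog S \<noteq> 0" using assms(2) homog_eq_0 by auto
  then show ?thesis unfolding total_deg_eq_degree S homog_mult by (simp add: degree_mult_eq)
qed

text \<open>Weighted degrees: \<open>x\<close> and \<open>y\<close> have weight \<open>d\<close>, and in
  \<open>pwbound\<close> the outer variable \<open>u\<close> has weight 1. Bounds are integers since
  coefficients of high powers of \<open>u\<close> get negative bounds, which force them to vanish.\<close>
definition wbound :: "nat \<Rightarrow> complex poly poly \<Rightarrow> int \<Rightarrow> bool" where
  "wbound d P w \<longleftrightarrow> (\<forall>i j. coeff (coeff P j) i \<noteq> 0 \<longrightarrow> int (d * (i + j)) \<le> w)"

lemma wbound_0 [simp]: "wbound d 0 w" by (simp add: wbound_def)
lemma wbound_mono: "wbound d P w \<Longrightarrow> w \<le> w' \<Longrightarrow> wbound d P w'" by (force simp: wbound_def)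
lemma wbound_add: "wbound d P w \<Longrightarrow> wbound d Q w \<Longrightarrow> wbound d (P + Q) w"
  unfolding wbound_def by (metis add.right_neutral coeff_add)
lemma wbound_uminus: "wbound d P w \<Longrightarrow> wbound d (- P) w" by (simp add: wbound_def)
lemma wbound_const: assumes "w \<ge> 0" shows "wbound d [:[:a:]:] w"
  unfolding wbound_def
proof (intro allI impI)
  fix i j assume h: "coeff (coeff [:[:a:]:] j) i \<noteq> 0"
  have "j = 0" using h by (cases j) auto
  moreover have "i = 0" using h \<open>j = 0\<close> by (cases i) auto
  ultimately show "int (d * (i + j)) \<le> w" using assms by simp
qed
lemma wbound_1: "wbound d 1 0" using wbound_const[of 0 d 1] by (simp add: pCons_one)

lemma wbound_mult:
  assumes "wbound d P w" "wbound d Q w'" shows "wbound d (P * Q) (w + w')"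
  unfolding wbound_def
proof (intro allI impI)
  fix i j assume "coeff (coeff (P * Q) j) i \<noteq> 0"
  then have "(\<Sum>b\<le>j. \<Sum>a\<le>i. coeff (coeff P b) a * coeff (coeff Q (j - b)) (i - a)) \<noteq> 0"
    by (simp add: coeff_mult coeff_sum)
  then obtain b where b: "b \<le> j" "(\<Sum>a\<le>i. coeff (coeff P b) a * coeff (coeff Q (j - b)) (i - a)) \<noteq> 0"
    by (meson atMost_iff sum.not_neutral_contains_not_neutral)
  then obtain a where a: "a \<le> i" "coeff (coeff P b) a * coeff (coeff Q (j - b)) (i - a) \<noteq> 0"
    by (meson atMost_iff sum.not_neutral_contains_not_neutral)
  then have "coeff (coeff P b) a \<noteq> 0" "coeff (coeff Q (j - b)) (i - a) \<noteq> 0" by auto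
  then have "int (d * (a + b)) \<le> w" "int (d * ((i - a) + (j - b))) \<le> w'"
    using assms unfolding wbound_def by blast+
  moreover have "d * (i + j) = d * (a + b) + d * ((i - a) + (j - b))"
    using a(1) b(1) by (simp add: distrib_left[symmetric])
  ultimately show "int (d * (i + j)) \<le> w + w'" by linarith
qed

lemma wbound_sum: "(\<And>x. x \<in> A \<Longrightarrow> wbound d (h x) w) \<Longrightarrow> wbound d (sum h A) w"
  by (induction A rule: infinite_finite_induct) (auto intro: wbound_add)

lemma wbound_prod: "(\<And>x. x \<in> A \<Longrightarrow> wbound d (h x) (w x)) \<Longrightarrow> finite A \<Longrightarrow> wbound d (prod h A) (sum w A)"
  by (induction A rule: infinite_finite_induct) (auto intro: wbound_mult wbound_1)

definition pwbound :: "nat \<Rightarrow> complex poly poly poly \<Rightarrow> int \<Rightarrow> bool" where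
  "pwbound d P w \<longleftrightarrow> (\<forall>k. wbound d (coeff P k) (w - int k))"

lemma pwbound_add: "pwbound d P w \<Longrightarrow> pwbound d Q w \<Longrightarrow> pwbound d (P + Q) w"
  by (simp add: pwbound_def wbound_add)
lemma pwbound_uminus: "pwbound d P w \<Longrightarrow> pwbound d (- P) w"
  by (simp add: pwbound_def wbound_uminus)
lemma pwbound_diff: "pwbound d P w \<Longrightarrow> pwbound d Q w \<Longrightarrow> pwbound d (P - Q) w"
  using pwbound_add[of d P w "- Q"] pwbound_uminus[of d Q w] by simp
lemma pwbound_mult: "pwbound d P w \<Longrightarrow> pwbound d Q w' \<Longrightarrow> pwbound d (P * Q) (w + w')"
  unfolding pwbound_def coeff_mult
proof (intro allI wbound_sum)
  fix k x :: nat assume h: "\<forall>k. wbound d (coeff P k) (w - int k)" "\<forall>k. wbound d (coeff Q k) (w' - int k)" "x \<in> {..k}"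
  have "wbound d (coeff P x * coeff Q (k - x)) ((w - int x) + (w' - int (k - x)))"
    by (rule wbound_mult) (use h in blast)+
  then show "wbound d (coeff P x * coeff Q (k - x)) (w + w' - int k)"
    by (rule wbound_mono) (use h(3) in auto)
qed
lemma wbound_of_nat_mult: "wbound d P w \<Longrightarrow> wbound d (of_nat n * P) w"
  by (induction n) (auto simp: algebra_simps intro: wbound_add)
lemma pwbound_pderiv: "pwbound d P w \<Longrightarrow> pwbound d (pderiv P) (w - 1)"
  unfolding pwbound_def coeff_pderiv
proof (intro allI)
  fix k assume "\<forall>k. wbound d (coeff P k) (w - int k)"
  then have "wbound d (coeff P (Suc k)) (w - int (Suc k))" by blast
  then have "wbound d (of_nat (Suc k) * coeff P (Suc k)) (w - int (Suc k))" by (rule wbound_of_nat_mult)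
  then show "wbound d (of_nat (Suc k) * coeff P (Suc k)) (w - 1 - int k)" by (rule wbound_mono) simp
qed

text \<open>In the Sylvester matrix the entry at \<open>(i, j)\<close> has weight at most \<open>j - i\<close>
  in the rows of \<open>p\<close> and \<open>j - i + degree q\<close> in the rows of \<open>q\<close>.
  In every product of the Leibniz expansion the differences \<open>j - i\<close> cancel.\<close>
lemma wbound_resultant:
  assumes p: "pwbound d p (int (degree p))" and q: "pwbound d q (int (degree q))"
  shows "wbound d (resultant p q) (int (degree p * degree q))"
proof -
  define m where "m = degree p"
  define n where "n = degree q"
  define A where "A = sylvester_mat p q"
  define w where "w i j = int j - int i + (if i < n then 0 else int n)" for i j :: nat
  have entry: "wbound d (A $$ (i, j)) (w i j)" if "i < m + n" "j < m + n" for i j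
  proof -
    have e: "A $$ (i, j) = (if i < n then if i \<le> j \<and> j - i \<le> m then coeff p (m + i - j) else 0
      else if i - n \<le> j \<and> j \<le> i then coeff q (i - j) else 0)"
      using that unfolding A_def m_def n_def by (rule sylvester_index_mat)
    have 1: "wbound d (coeff p (m + i - j)) (w i j)" if "i < n" "i \<le> j" "j - i \<le> m"
    proof -
      have "wbound d (coeff p (m + i - j)) (int m - int (m + i - j))" using p by (simp add: pwbound_def m_def)
      then show ?thesis by (rule wbound_mono) (use that in \<open>simp add: w_def\<close>)
    qed
    have 2: "wbound d (coeff q (i - j)) (w i j)" if "\<not> i < n" "i - n \<le> j" "j \<le> i"
    proof -
      have "wbound d (coeff q (i - j)) (int n - int (i - j))" using q by (simp add: pwbound_def n_def)
      then show ?thesis by (rule wbound_mono) (use that in \<open>simp add: w_def\<close>)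
    qed
    consider "i < n" "i \<le> j" "j - i \<le> m" | "\<not> i < n" "i - n \<le> j" "j \<le> i" | "A $$ (i, j) = 0"
      using e by argo
    then show ?thesis using 1 2 e by cases simp_all
  qed
  have A: "A \<in> carrier_mat (m + n) (m + n)" unfolding A_def m_def n_def by (rule sylvester_carrier_mat)
  have "wbound d (Determinant.det A) (int (m * n))"
    unfolding det_def'[OF A]
  proof (rule wbound_sum)
    fix \<pi> assume "\<pi> \<in> {\<pi>. \<pi> permutes {0..<m + n}}"
    then have \<pi>: "\<pi> permutes {0..<m + n}" by simp
    have "wbound d (\<Prod>i = 0..<m + n. A $$ (i, \<pi> i)) (\<Sum>i = 0..<m + n. w i (\<pi> i))"
      using permutes_in_image[OF \<pi>] by (intro wbound_prod entry) auto
    also have "(\<Sum>i = 0..<m + n. w i (\<pi> i)) = (\<Sum>i = 0..<m + n. int (\<pi> i)) - (\<Sum>i = 0..<m + n. int i)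
        + (\<Sum>i = 0..<m + n. if i < n then 0 else int n)"
      by (simp add: w_def sum.distrib sum_subtractf)
    also have "(\<Sum>i = 0..<m + n. int (\<pi> i)) = (\<Sum>i = 0..<m + n. int i)"
      using sum.permute[OF \<pi>, of int] by (simp add: o_def)
    also have "(\<Sum>i = 0..<m + n. if i < n then 0 else int n) = int (m * n)"
    proof -
      have "(\<Sum>i = 0..<m + n. if i < n then 0 else int n) = (\<Sum>i = n..<m + n. int n)"
        by (rule sum.mono_neutral_cong_right) auto
      then show ?thesis by simp
    qed
    finally have *: "wbound d (\<Prod>i = 0..<m + n. A $$ (i, \<pi> i)) (int (m * n))" by simp
    show "wbound d (signof \<pi> * (\<Prod>i = 0..<m + n. A $$ (i, \<pi> i))) (int (m * n))"
      using * wbound_uminus[OF *] by (simp add: sign_def)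
  qed
  then show ?thesis by (simp add: resultant_def A_def m_def n_def)
qed

lemma resultant_eq_0_iff_common_root:
  fixes p q :: "complex poly"
  assumes "p \<noteq> 0"
  shows "resultant p q = 0 \<longleftrightarrow> (\<exists>u. poly p u = 0 \<and> poly q u = 0)"
proof -
  have "gcd p q \<noteq> 0" using assms by simp
  have "resultant p q = 0 \<longleftrightarrow> degree (gcd p q) \<noteq> 0" by (rule resultant_0_gcd)
  also have "\<dots> \<longleftrightarrow> (\<exists>u. poly (gcd p q) u = 0)"
  proof
    assume "degree (gcd p q) \<noteq> 0"
    then have "\<not> constant (poly (gcd p q))" by (simp add: constant_degree)
    then show "\<exists>u. poly (gcd p q) u = 0" by (rule fundamental_theorem_of_algebra)
  next
    assume "\<exists>u. poly (gcd p q) u = 0"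
    then show "degree (gcd p q) \<noteq> 0" using \<open>gcd p q \<noteq> 0\<close> by (metis degree_eq_zeroE pCons_0_0 poly_const_conv)
  qed
  also have "\<dots> \<longleftrightarrow> (\<exists>u. poly p u = 0 \<and> poly q u = 0)"
    by (simp only: poly_eq_0_iff_dvd gcd_greatest_iff)
  finally show ?thesis .
qed

lemma complex_poly_on_reals:
  "\<exists>\<alpha> \<beta> :: real poly. \<forall>t. poly c (complex_of_real t) = Complex (poly \<alpha> t) (poly \<beta> t)"
proof (induction c)
  case 0 then show ?case by (intro exI[of _ 0]) (simp add: complex_eq_iff)
next
  case (pCons a c)
  then obtain \<alpha> \<beta> where "\<forall>t. poly c (complex_of_real t) = Complex (poly \<alpha> t) (poly \<beta> t)" by blast
  then show ?case
    by (intro exI[of _ "pCons (Re a) \<alpha>"] exI[of _ "pCons (Im a) \<beta>"]) (simp add: complex_eq_iff)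
qed

text \<open>If \<open>\<Delta>\<close> is a square of a rational function then it is the square of a polynomial
  \<open>c\<close>. The square of \<open>c = \<alpha> + i \<beta>\<close> is real on the real line
  only if \<open>\<alpha> = 0\<close> or \<open>\<beta> = 0\<close>, and then it has constant sign
  there.\<close>
lemma sign_change_not_square:
  fixes a b \<Delta> :: "complex poly"
  assumes \<Delta>: "\<And>t. poly \<Delta> (complex_of_real t) = of_real (poly \<delta> t)"
    and sg: "poly \<delta> s > 0" "poly \<delta> t < 0" and eq: "a\<^sup>2 = b\<^sup>2 * \<Delta>"
  shows "a = 0 \<and> b = 0"
proof (cases "b = 0")
  case True then show ?thesis using eq by simp
next
  case False
  have "b\<^sup>2 dvd a\<^sup>2" using eq by simp
  then have "b dvd a" by simp
  then obtain c where "a = b * c" by (auto simp: dvd_def)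
  then have c: "\<Delta> = c\<^sup>2" using eq False by (simp add: power_mult_distrib)
  obtain \<alpha> \<beta> :: "real poly" where ab: "\<And>t. poly c (complex_of_real t) = Complex (poly \<alpha> t) (poly \<beta> t)"
    using complex_poly_on_reals by blast
  have v: "poly \<delta> t = (poly \<alpha> t)\<^sup>2 - (poly \<beta> t)\<^sup>2 \<and> poly \<alpha> t * poly \<beta> t = 0" for t
    using \<Delta>[of t] unfolding c by (auto simp: ab complex_eq_iff power2_eq_square)
  have "poly (\<alpha> * \<beta>) t = 0" for t using v by simp
  then have "\<alpha> * \<beta> = 0" by (metis poly_all_0_iff_0)
  then show ?thesis
  proof (elim mult_eq_0_iff[THEN iffD1, THEN disjE])
    assume "\<alpha> = 0" then show ?thesis using v[of s] sg(1) by (simp add: not_less[symmetric])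
  next
    assume "\<beta> = 0" then show ?thesis using v[of t] sg(2) by (simp add: not_less[symmetric])
  qed
qed

section \<open>The branch curve and its double cover\<close>

text \<open>Functions on the double cover \<open>s\<^sup>2 = D(u)\<close> of the line that have the normal form
  \<open>(a(u) + b(u) s) / q(u)\<^sup>N\<close>.\<close>
definition cover_fun :: "complex poly \<Rightarrow> complex poly \<Rightarrow> (complex \<Rightarrow> complex \<Rightarrow> complex) \<Rightarrow> bool" where
  "cover_fun q D h \<longleftrightarrow> (\<exists>N a b. \<forall>u s. s\<^sup>2 = poly D u \<longrightarrow> poly q u \<noteq> 0 \<longrightarrow>
     poly q u ^ N * h u s = poly a u + poly b u * s)"

lemma cover_fun_poly: "cover_fun q D (\<lambda>u s. poly c u)"
  unfolding cover_fun_def by (intro exI[of _ 0] exI[of _ c]) simp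

lemma cover_fun_add:
  assumes "cover_fun q D h1" "cover_fun q D h2" shows "cover_fun q D (\<lambda>u s. h1 u s + h2 u s)"
proof -
  obtain N1 a1 b1 where 1: "\<And>u s. s\<^sup>2 = poly D u \<Longrightarrow> poly q u \<noteq> 0 \<Longrightarrow> poly q u ^ N1 * h1 u s = poly a1 u + poly b1 u * s"
    using assms(1) unfolding cover_fun_def by blast
  obtain N2 a2 b2 where 2: "\<And>u s. s\<^sup>2 = poly D u \<Longrightarrow> poly q u \<noteq> 0 \<Longrightarrow> poly q u ^ N2 * h2 u s = poly a2 u + poly b2 u * s"
    using assms(2) unfolding cover_fun_def by blast
  show ?thesis
    unfolding cover_fun_def
  proof (rule exI[of _ "N1 + N2"], rule exI[of _ "q ^ N2 * a1 + q ^ N1 * a2"], rule exI[of _ "q ^ N2 * b1 + q ^ N1 * b2"], intro allI impI)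
    fix u s assume h: "s\<^sup>2 = poly D u" "poly q u \<noteq> 0"
    have "poly q u ^ (N1 + N2) * (h1 u s + h2 u s)
      = poly q u ^ N2 * (poly q u ^ N1 * h1 u s) + poly q u ^ N1 * (poly q u ^ N2 * h2 u s)"
      by (simp add: power_add algebra_simps)
    then show "poly q u ^ (N1 + N2) * (h1 u s + h2 u s) =
      poly (q ^ N2 * a1 + q ^ N1 * a2) u + poly (q ^ N2 * b1 + q ^ N1 * b2) u * s"
      unfolding 1[OF h] 2[OF h] by (simp add: algebra_simps)
  qed
qed

lemma cover_fun_mult:
  assumes "cover_fun q D h1" "cover_fun q D h2" shows "cover_fun q D (\<lambda>u s. h1 u s * h2 u s)"
proof -
  obtain N1 a1 b1 where 1: "\<And>u s. s\<^sup>2 = poly D u \<Longrightarrow> poly q u \<noteq> 0 \<Longrightarrow> poly q u ^ N1 * h1 u s = poly a1 u + poly b1 u * s"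
    using assms(1) unfolding cover_fun_def by blast
  obtain N2 a2 b2 where 2: "\<And>u s. s\<^sup>2 = poly D u \<Longrightarrow> poly q u \<noteq> 0 \<Longrightarrow> poly q u ^ N2 * h2 u s = poly a2 u + poly b2 u * s"
    using assms(2) unfolding cover_fun_def by blast
  show ?thesis
    unfolding cover_fun_def
  proof (rule exI[of _ "N1 + N2"], rule exI[of _ "a1 * a2 + b1 * b2 * D"], rule exI[of _ "a1 * b2 + b1 * a2"], intro allI impI)
    fix u s assume h: "s\<^sup>2 = poly D u" "poly q u \<noteq> 0"
    have "poly q u ^ (N1 + N2) * (h1 u s * h2 u s) = (poly q u ^ N1 * h1 u s) * (poly q u ^ N2 * h2 u s)"
      by (simp add: power_add)
    also have "\<dots> = poly a1 u * poly a2 u + poly b1 u * poly b2 u * s\<^sup>2 + (poly a1 u * poly b2 u + poly b1 u * poly a2 u) * s"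
      unfolding 1[OF h] 2[OF h] by (simp add: algebra_simps power2_eq_square)
    finally show "poly q u ^ (N1 + N2) * (h1 u s * h2 u s) =
      poly (a1 * a2 + b1 * b2 * D) u + poly (a1 * b2 + b1 * a2) u * s"
      by (simp add: h(1))
  qed
qed

lemma cover_fun_eval2:
  assumes "cover_fun q D (\<lambda>u s. Z u s $ 1)" "cover_fun q D (\<lambda>u s. Z u s $ 2)"
  shows "cover_fun q D (\<lambda>u s. eval2 Q (Z u s))"
proof (induction Q)
  case 0 show ?case using cover_fun_poly[of q D 0] by simp
next
  case (pCons c Q)
  have "cover_fun q D (\<lambda>u s. poly c (Z u s $ 1))"
  proof (induction c)
    case 0 show ?case using cover_fun_poly[of q D 0] by simp
  next
    case (pCons a c)
    have "cover_fun q D (\<lambda>u s. a)" using cover_fun_poly[of q D "[:a:]"] by simp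
    from cover_fun_add[OF this cover_fun_mult[OF assms(1) pCons.IH]] show ?case by simp
  qed
  from cover_fun_add[OF this cover_fun_mult[OF assms(2) pCons.IH]] show ?case by (simp add: eval2_pCons)
qed

text \<open>The norm \<open>a\<^sup>2 - b\<^sup>2 D\<close> vanishes at infinitely many \<open>u\<close>, hence
  identically, and \<open>D\<close> is not a square.\<close>
lemma cover_fun_zero_everywhere:
  assumes h: "cover_fun q D h" and inf: "infinite U"
    and U: "\<And>u. u \<in> U \<Longrightarrow> poly q u \<noteq> 0 \<and> (\<exists>s. s\<^sup>2 = poly D u \<and> h u s = 0)"
    and D: "\<And>t. poly D (complex_of_real t) = of_real (poly \<delta> t)" "poly \<delta> t0 > 0" "poly \<delta> t1 < 0"
    and us: "s\<^sup>2 = poly D u" "poly q u \<noteq> 0"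
  shows "h u s = 0"
proof -
  obtain N a b where ab: "\<And>u s. s\<^sup>2 = poly D u \<Longrightarrow> poly q u \<noteq> 0 \<Longrightarrow> poly q u ^ N * h u s = poly a u + poly b u * s"
    using h unfolding cover_fun_def by blast
  have "poly (a\<^sup>2 - b\<^sup>2 * D) u = 0" if uU: "u \<in> U" for u
  proof -
    obtain s where s: "poly q u \<noteq> 0" "s\<^sup>2 = poly D u" "h u s = 0" using U[OF uU] by blast
    then have "poly a u = - (poly b u * s)" using ab[of s u] by (simp add: eq_neg_iff_add_eq_0)
    then have "(poly a u)\<^sup>2 = (poly b u)\<^sup>2 * s\<^sup>2" by (simp add: power_mult_distrib)
    then show ?thesis by (simp add: s(2))
  qed
  then have "U \<subseteq> {u. poly (a\<^sup>2 - b\<^sup>2 * D) u = 0}" by blast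
  then have "a\<^sup>2 - b\<^sup>2 * D = 0" using poly_roots_finite inf finite_subset by blast
  then have "a\<^sup>2 = b\<^sup>2 * D" by simp
  from sign_change_not_square[OF D this] have "a = 0 \<and> b = 0" .
  then show ?thesis using ab[OF us] us by simp
qed

lemma eval2_tendsto:
  assumes "((\<lambda>x. Z x $ 1) \<longlongrightarrow> z $ 1) A" "((\<lambda>x. Z x $ 2) \<longlongrightarrow> z $ 2) A"
  shows "((\<lambda>x. eval2 Q (Z x)) \<longlongrightarrow> eval2 Q z) A"
proof (induction Q)
  case (pCons c Q)
  then show ?case unfolding eval2_pCons by (intro tendsto_intros assms)
qed simp

locale cheb_tube = cheb_curve +
  fixes e :: real assumes e: "e > 0"
begin

definition k :: complex where "k = complex_of_real (e\<^sup>2)"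
abbreviation "c1 \<equiv> (cheb d1 :: complex poly)"
abbreviation "c2 \<equiv> (cheb d2 :: complex poly)"

lemma k_nonzero: "k \<noteq> 0" using e by (simp add: k_def)

text \<open>The conditions say that \<open>z\<close> is the image of a critical point \<open>(u, v, w)\<close>
  of the sphere, after elimination of \<open>v = (z\<^sub>1 - T\<^sub>d\<^sub>1(u)) / e\<close> and
  \<open>w = (z\<^sub>2 - T\<^sub>d\<^sub>2(u)) / e\<close>.\<close>
definition crit :: "complex \<Rightarrow> complex^2 \<Rightarrow> bool" where
  "crit u z \<longleftrightarrow> (z$1 - poly c1 u)\<^sup>2 + (z$2 - poly c2 u)\<^sup>2 = k * (1 - u\<^sup>2) \<and>
     poly (pderiv c1) u * (z$1 - poly c1 u) + poly (pderiv c2) u * (z$2 - poly c2 u) = k * u"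
definition branch_curve :: "(complex^2) set" where "branch_curve = {z. \<exists>u. crit u z}"

text \<open>For fixed \<open>u\<close> the two equations of \<open>crit\<close> describe the intersection of a
  circle and a line. Where the direction of the line has nonzero square length \<open>q\<close>, the
  intersection points are \<open>generic_point u s\<close> with \<open>s\<^sup>2 = D(u)\<close>. The
  real polynomial \<open>\<delta>\<close> has the same values as \<open>D\<close> on the real line.\<close>
definition q :: "complex poly" where "q = (pderiv c1)\<^sup>2 + (pderiv c2)\<^sup>2"
definition D :: "complex poly" where "D = [:k:] * (q * [:1, 0, -1:] - [:0, 0, k:])"
definition \<delta> :: "real poly" where "\<delta> = [:e\<^sup>2:] * (((pderiv g)\<^sup>2 + (pderiv f)\<^sup>2) * [:1, 0, -1:] - [:0, 0, e\<^sup>2:])"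

lemma poly_q: "poly q u = (poly (pderiv c1) u)\<^sup>2 + (poly (pderiv c2) u)\<^sup>2" by (simp add: q_def)
lemma poly_D: "poly D u = k * (poly q u * (1 - u\<^sup>2) - k * u\<^sup>2)"
  by (simp add: D_def power2_eq_square algebra_simps)
lemma poly_\<delta>: "poly \<delta> t = e\<^sup>2 * (((poly (pderiv g) t)\<^sup>2 + (poly (pderiv f) t)\<^sup>2) * (1 - t\<^sup>2) - e\<^sup>2 * t\<^sup>2)"
  by (simp add: \<delta>_def power2_eq_square algebra_simps)

lemma poly_D_real: "poly D (complex_of_real t) = of_real (poly \<delta> t)"
  unfolding poly_D poly_\<delta> poly_q by (simp add: poly_pderiv_cheb_of_real k_def)

lemma q_0: "poly q 0 \<noteq> 0" and \<delta>_0: "poly \<delta> 0 > 0" and \<delta>_1: "poly \<delta> 1 < 0"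
proof -
  have pos: "(poly (pderiv g) (0::real))\<^sup>2 + (poly (pderiv f) 0)\<^sup>2 > 0"
    using pderiv_cheb_no_common_zero_real[OF d1 d2 cop, of 0] by (simp add: sum_power2_gt_zero_iff)
  then show "poly \<delta> 0 > 0" using e unfolding poly_\<delta> by simp
  show "poly \<delta> 1 < 0" unfolding poly_\<delta> using e by simp
  have "poly q (of_real 0) = of_real ((poly (pderiv g) 0)\<^sup>2 + (poly (pderiv f) 0)\<^sup>2)"
    unfolding poly_q poly_pderiv_cheb_of_real by simp
  then show "poly q 0 \<noteq> 0" using pos by (metis less_irrefl of_real_0 of_real_eq_0_iff)
qed

definition generic_point :: "complex \<Rightarrow> complex \<Rightarrow> complex^2" where
  "generic_point u s = vector [poly c1 u + (k * u * poly (pderiv c1) u - s * poly (pderiv c2) u) / poly q u,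
                    poly c2 u + (k * u * poly (pderiv c2) u + s * poly (pderiv c1) u) / poly q u]"

lemma crit_generic:
  assumes q: "poly q u \<noteq> 0" and c: "crit u z"
  obtains s where "s\<^sup>2 = poly D u" "z = generic_point u s"
proof -
  define p1 where "p1 = poly (pderiv c1) u"
  define p2 where "p2 = poly (pderiv c2) u"
  define A where "A = z$1 - poly c1 u"
  define B where "B = z$2 - poly c2 u"
  define s where "s = p1 * B - p2 * A"
  have Q: "poly q u = p1\<^sup>2 + p2\<^sup>2" by (simp add: poly_q p1_def p2_def)
  have h: "A\<^sup>2 + B\<^sup>2 = k * (1 - u\<^sup>2)" "p1 * A + p2 * B = k * u"
    using c by (simp_all add: crit_def A_def B_def p1_def p2_def)
  have "s\<^sup>2 + (p1 * A + p2 * B)\<^sup>2 = (p1\<^sup>2 + p2\<^sup>2) * (A\<^sup>2 + B\<^sup>2)"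
    by (simp add: s_def power2_eq_square algebra_simps)
  then have "s\<^sup>2 = poly D u" unfolding h Q[symmetric] poly_D
    by (simp add: algebra_simps power2_eq_square)
  moreover have "z = generic_point u s"
  proof -
    have "A * poly q u = k * u * p1 - s * p2" "B * poly q u = k * u * p2 + s * p1"
      unfolding h(2)[symmetric] Q s_def by (simp_all add: power2_eq_square algebra_simps)
    then have "A = (k * u * p1 - s * p2) / poly q u" "B = (k * u * p2 + s * p1) / poly q u"
      using q by (simp_all add: eq_divide_eq)
    then show ?thesis unfolding vec2_eq_iff generic_point_def A_def B_def p1_def p2_def by (simp add: algebra_simps)
  qed
  ultimately show ?thesis by (rule that)
qed

text \<open>For \<open>q(u) = 0\<close> the line is isotropic and meets the circle in a single finite point.\<close>
lemma crit_special:
  assumes q: "poly q u = 0" and c: "crit u z"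
  shows "u \<noteq> 0" "poly (pderiv c1) u \<noteq> 0" "poly (pderiv c2) u \<noteq> 0"
    "z$1 = poly c1 u + (k * u\<^sup>2 - (1 - u\<^sup>2) * (poly (pderiv c2) u)\<^sup>2) / (2 * u * poly (pderiv c1) u)"
    "z$2 = poly c2 u + (k * u - poly (pderiv c1) u * (z$1 - poly c1 u)) / poly (pderiv c2) u"
proof -
  define p1 where "p1 = poly (pderiv c1) u"
  define p2 where "p2 = poly (pderiv c2) u"
  define A where "A = z$1 - poly c1 u"
  define B where "B = z$2 - poly c2 u"
  show u: "u \<noteq> 0" using q q_0 by auto
  have Q: "p1\<^sup>2 + p2\<^sup>2 = 0" using q by (simp add: poly_q p1_def p2_def)
  have "p1 \<noteq> 0 \<or> p2 \<noteq> 0" using pderiv_cheb_no_common_zero[OF d1 d2 cop, of u] by (simp add: p1_def p2_def)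
  then have p: "p1 \<noteq> 0" "p2 \<noteq> 0" using Q by auto
  then show "poly (pderiv c1) u \<noteq> 0" "poly (pderiv c2) u \<noteq> 0" by (simp_all add: p1_def p2_def)
  have h: "A\<^sup>2 + B\<^sup>2 = k * (1 - u\<^sup>2)" "p1 * A + p2 * B = k * u"
    using c by (simp_all add: crit_def A_def B_def p1_def p2_def)
  have pB: "p2 * B = k * u - p1 * A" using h(2) by (simp add: algebra_simps)
  have "p2\<^sup>2 * (A\<^sup>2 + B\<^sup>2) = p2\<^sup>2 * A\<^sup>2 + (p2 * B)\<^sup>2" by (simp add: power2_eq_square algebra_simps)
  also have "\<dots> = (p1\<^sup>2 + p2\<^sup>2) * A\<^sup>2 + k\<^sup>2 * u\<^sup>2 - 2 * k * u * p1 * A"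
    unfolding pB by (simp add: power2_eq_square algebra_simps)
  finally have "k * (2 * u * p1 * A) = k * (k * u\<^sup>2 - (1 - u\<^sup>2) * p2\<^sup>2)"
    unfolding h(1) Q by (simp add: power2_eq_square algebra_simps)
  then have "2 * u * p1 * A = k * u\<^sup>2 - (1 - u\<^sup>2) * p2\<^sup>2" using k_nonzero by simp
  then have "A = (k * u\<^sup>2 - (1 - u\<^sup>2) * p2\<^sup>2) / (2 * u * p1)" using u p by (simp add: field_simps)
  then show "z$1 = poly c1 u + (k * u\<^sup>2 - (1 - u\<^sup>2) * (poly (pderiv c2) u)\<^sup>2) / (2 * u * poly (pderiv c1) u)"
    by (simp add: A_def p1_def p2_def algebra_simps)
  have "B = (k * u - p1 * A) / p2" using pB p by (simp add: field_simps)
  then show "z$2 = poly c2 u + (k * u - poly (pderiv c1) u * (z$1 - poly c1 u)) / poly (pderiv c2) u"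
    by (simp add: B_def A_def p1_def p2_def algebra_simps)
qed

lemma finite_fibre: "finite {z. crit u z}"
proof (cases "poly q u = 0")
  case True
  have "z = z'" if "crit u z" "crit u z'" for z z'
    using crit_special(4,5)[OF True that(1)] crit_special(4,5)[OF True that(2)] by (simp add: vec2_eq_iff)
  then have "{z. crit u z} \<subseteq> {SOME z. crit u z}" by (metis (mono_tags, lifting) mem_Collect_eq singletonI someI subsetI)
  then show ?thesis by (rule finite_subset) simp
next
  case False
  have "{z. crit u z} \<subseteq> generic_point u ` {s. poly [:- poly D u, 0, 1:] s = 0}"
  proof
    fix z assume "z \<in> {z. crit u z}"
    then obtain s where "s\<^sup>2 = poly D u" "z = generic_point u s" using crit_generic[OF False] by blast
    then show "z \<in> generic_point u ` {s. poly [:- poly D u, 0, 1:] s = 0}" by (auto simp: power2_eq_square)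
  qed
  then show ?thesis by (rule finite_subset) (intro finite_imageI poly_roots_finite, simp)
qed

text \<open>Near \<open>u0\<close> choose the branch of \<open>s = sqrt (D(u))\<close> for which the numerators
  of \<open>generic_point\<close> vanish at \<open>u0\<close>. Multiplying by the conjugate numerator
  cancels the factor \<open>q\<close>, so the generic points converge, and the limit is the only point
  over \<open>u0\<close>.\<close>
lemma special_limit:
  assumes q0: "poly q u0 = 0" and c: "crit u0 z"
    and Q: "\<And>u s. s\<^sup>2 = poly D u \<Longrightarrow> poly q u \<noteq> 0 \<Longrightarrow> eval2 Q (generic_point u s) = 0"
  shows "eval2 Q z = 0"
proof -
  note sp = crit_special[OF q0 c]
  define p1 where "p1 u = poly (pderiv c1) u" for u
  define p2 where "p2 u = poly (pderiv c2) u" for u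
  have qp: "poly q u = (p1 u)\<^sup>2 + (p2 u)\<^sup>2" for u by (simp add: poly_q p1_def p2_def)
  have p0: "p1 u0 \<noteq> 0" "p2 u0 \<noteq> 0" "u0 \<noteq> 0" using sp by (simp_all add: p1_def p2_def)
  have sq0: "(p1 u0)\<^sup>2 = - (p2 u0)\<^sup>2" using q0 qp[of u0] by (simp add: eq_neg_iff_add_eq_0)
  \<comment> \<open>the value of \<open>s\<close> at which both numerators of \<open>generic_point u0 s\<close> vanish\<close>
  define s0 where "s0 = k * u0 * p1 u0 / p2 u0"
  have D0: "poly D u0 = - (k\<^sup>2 * u0\<^sup>2)" by (simp add: poly_D q0 power2_eq_square)
  have s0: "s0\<^sup>2 = poly D u0"
    using p0 sq0 unfolding D0 s0_def by (simp add: power_divide power_mult_distrib)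
  have D0nz: "poly D u0 \<noteq> 0" using k_nonzero p0 by (simp add: D0)
  define s where "s u = s0 * csqrt (poly D u / poly D u0)" for u
  have ss: "(s u)\<^sup>2 = poly D u" for u
    using D0nz by (simp add: s_def power_mult_distrib s0)
  have "isCont csqrt (poly D u0 / poly D u0)" using D0nz by (intro continuous_at_csqrt) auto
  then have "((\<lambda>u. csqrt (poly D u / poly D u0)) \<longlongrightarrow> csqrt (poly D u0 / poly D u0)) (at u0)"
    by (rule isCont_tendsto_compose) (intro tendsto_intros D0nz)
  then have st: "(s \<longlongrightarrow> s0) (at u0)"
    using tendsto_mult[OF tendsto_const[of s0]] D0nz unfolding s_def by fastforce
  have p1t: "(p1 \<longlongrightarrow> p1 u0) (at u0)" and p2t: "(p2 \<longlongrightarrow> p2 u0) (at u0)"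
    unfolding p1_def p2_def by (intro tendsto_intros)+
  define E where "E u = k * u * p1 u + s u * p2 u" for u
  have "(E \<longlongrightarrow> k * u0 * p1 u0 + s0 * p2 u0) (at u0)" unfolding E_def by (intro tendsto_intros st p1t p2t)
  moreover have E0: "k * u0 * p1 u0 + s0 * p2 u0 = 2 * k * u0 * p1 u0" using p0 by (simp add: s0_def)
  ultimately have Et: "(E \<longlongrightarrow> 2 * k * u0 * p1 u0) (at u0)" by simp
  have E0nz: "2 * k * u0 * p1 u0 \<noteq> 0" using k_nonzero p0 by simp
  define A where "A u = k * (k * u\<^sup>2 - (1 - u\<^sup>2) * (p2 u)\<^sup>2) / E u" for u
  define B where "B u = (k * u - p1 u * A u) / p2 u" for u
  have At: "(A \<longlongrightarrow> k * (k * u0\<^sup>2 - (1 - u0\<^sup>2) * (p2 u0)\<^sup>2) / (2 * k * u0 * p1 u0)) (at u0)"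
    unfolding A_def by (intro tendsto_intros Et p2t E0nz)
  also have "k * (k * u0\<^sup>2 - (1 - u0\<^sup>2) * (p2 u0)\<^sup>2) / (2 * k * u0 * p1 u0) = z$1 - poly c1 u0"
    using sp(4) k_nonzero p0 by (simp add: p1_def p2_def)
  finally have At: "(A \<longlongrightarrow> z$1 - poly c1 u0) (at u0)" .
  have "(B \<longlongrightarrow> (k * u0 - p1 u0 * (z$1 - poly c1 u0)) / p2 u0) (at u0)"
    unfolding B_def by (intro tendsto_intros At p1t p2t p0)
  then have Bt: "(B \<longlongrightarrow> z$2 - poly c2 u0) (at u0)" using sp(5) by (simp add: p1_def p2_def)
  define W where "W u = (vector [poly c1 u + A u, poly c2 u + B u] :: complex^2)" for u
  have W1: "((\<lambda>u. W u $ 1) \<longlongrightarrow> poly c1 u0 + (z$1 - poly c1 u0)) (at u0)"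
    and W2: "((\<lambda>u. W u $ 2) \<longlongrightarrow> poly c2 u0 + (z$2 - poly c2 u0)) (at u0)"
    unfolding W_def vector_2 by (intro tendsto_intros At Bt)+
  have lim: "((\<lambda>u. eval2 Q (W u)) \<longlongrightarrow> eval2 Q z) (at u0)"
    using W1 W2 by (intro eval2_tendsto) simp_all
  have "finite {u. poly q u = 0}" using q_0 by (intro poly_roots_finite) auto
  then have "open (- ({u. poly q u = 0} - {u0}))" by (intro open_Compl finite_imp_closed) simp
  then have "\<forall>\<^sub>F u in at u0. poly q u \<noteq> 0" unfolding eventually_at_topological
    by (intro exI[of _ "- ({u. poly q u = 0} - {u0})"]) auto
  moreover have "\<forall>\<^sub>F u in at u0. E u \<noteq> 0" using Et E0nz by (rule tendsto_imp_eventually_ne)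
  moreover have "\<forall>\<^sub>F u in at u0. p2 u \<noteq> 0" using p2t p0(2) by (rule tendsto_imp_eventually_ne)
  ultimately have "\<forall>\<^sub>F u in at u0. eval2 Q (W u) = 0"
  proof eventually_elim
    case (elim u)
    have qn: "poly q u \<noteq> 0" by (rule elim)
    have "(k * u * p1 u - s u * p2 u) * E u = k\<^sup>2 * u\<^sup>2 * (p1 u)\<^sup>2 - (s u)\<^sup>2 * (p2 u)\<^sup>2"
      by (simp add: E_def power2_eq_square algebra_simps)
    also have "\<dots> = k * (k * u\<^sup>2 - (1 - u\<^sup>2) * (p2 u)\<^sup>2) * poly q u"
      unfolding ss poly_D qp by (simp add: power2_eq_square algebra_simps)
    also have "\<dots> = A u * E u * poly q u" using elim by (simp add: A_def)
    finally have "k * u * p1 u - s u * p2 u = A u * poly q u" using elim by simp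
    then have Aq: "A u = (k * u * p1 u - s u * p2 u) / poly q u" using qn by (simp add: field_simps)
    have "p2 u * B u = k * u - p1 u * A u" using elim by (simp add: B_def)
    then have "p2 u * (B u * poly q u) = k * u * poly q u - p1 u * (A u * poly q u)"
      by (metis left_diff_distrib mult.assoc)
    also have "\<dots> = p2 u * (k * u * p2 u + s u * p1 u)"
      using qn unfolding Aq by (simp add: qp[of u]) (simp add: power2_eq_square algebra_simps)
    finally have "B u * poly q u = k * u * p2 u + s u * p1 u" using elim by simp
    then have "B u = (k * u * p2 u + s u * p1 u) / poly q u" using qn by (simp add: field_simps)
    then have "W u = generic_point u (s u)" using Aq by (simp add: W_def generic_point_def p1_def p2_def)
    then show ?case using Q[OF ss qn] by simp
  qed
  then have "((\<lambda>u. eval2 Q (W u)) \<longlongrightarrow> 0) (at u0)" by (rule tendsto_eventually)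
  then show ?thesis using lim tendsto_unique[OF at_neq_bot] by blast
qed

text \<open>This expresses the irreducibility of the curve. Since the fibres over the \<open>u\<close>-line are
  finite, a polynomial with infinitely many zeros on the curve gives a function on the double cover
  with infinitely many zeros.\<close>
lemma vanish_on_branch_curve:
  assumes J: "infinite J" "J \<subseteq> branch_curve" and Q: "\<And>z. z \<in> J \<Longrightarrow> eval2 Q z = 0" and z: "z \<in> branch_curve"
  shows "eval2 Q z = 0"
proof -
  have "\<forall>z\<in>J. \<exists>u. crit u z" using J(2) by (auto simp: branch_curve_def)
  then obtain \<mu> where \<mu>: "\<And>z. z \<in> J \<Longrightarrow> crit (\<mu> z) z" by metis
  have "infinite (\<mu> ` J)"
  proof
    assume "finite (\<mu> ` J)"
    then have "finite (\<Union>u\<in>\<mu> ` J. {z. crit u z})" using finite_fibre by blast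
    moreover have "J \<subseteq> (\<Union>u\<in>\<mu> ` J. {z. crit u z})" using \<mu> by blast
    ultimately show False using J(1) finite_subset by blast
  qed
  moreover have "finite {u. poly q u = 0}" using q_0 by (intro poly_roots_finite) auto
  ultimately have inf: "infinite (\<mu> ` J - {u. poly q u = 0})" by simp
  have cov: "cover_fun q D (\<lambda>u s. eval2 Q (generic_point u s))"
  proof (rule cover_fun_eval2)
    have frac: "cover_fun q D (\<lambda>u s. poly c u + (poly a u + s * poly b u) / poly q u)" for a b c
      unfolding cover_fun_def
      by (rule exI[of _ 1], rule exI[of _ "c * q + a"], rule exI[of _ b]) (simp add: field_simps)
    show "cover_fun q D (\<lambda>u s. generic_point u s $ 1)" "cover_fun q D (\<lambda>u s. generic_point u s $ 2)"
      using frac[of c1 "[:0, k:] * pderiv c1" "- pderiv c2"] frac[of c2 "[:0, k:] * pderiv c2" "pderiv c1"]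
      by (simp_all add: generic_point_def mult_ac)
  qed
  have gen: "eval2 Q (generic_point u s) = 0" if "s\<^sup>2 = poly D u" "poly q u \<noteq> 0" for u s
  proof (rule cover_fun_zero_everywhere[OF cov inf _ poly_D_real \<delta>_0 \<delta>_1 that])
    fix u assume u: "u \<in> \<mu> ` J - {u. poly q u = 0}"
    then obtain z where "z \<in> J" "u = \<mu> z" "poly q u \<noteq> 0" by blast
    then have "crit u z" "poly q u \<noteq> 0" "eval2 Q z = 0" using \<mu> Q by auto
    then show "poly q u \<noteq> 0 \<and> (\<exists>s. s\<^sup>2 = poly D u \<and> eval2 Q (generic_point u s) = 0)"
      using crit_generic by metis
  qed
  obtain u where u: "crit u z" using z by (auto simp: branch_curve_def)
  show ?thesis
  proof (cases "poly q u = 0")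
    case True then show ?thesis using special_limit u gen by blast
  next
    case False
    then obtain s where "s\<^sup>2 = poly D u" "z = generic_point u s" using crit_generic u by blast
    then show ?thesis using gen False by simp
  qed
qed

text \<open>On a suitable vertical line \<open>z\<^sub>1 = x\<close> the parameter \<open>u\<close> of a point
  of the curve is a root of a nonzero polynomial \<open>H\<close>, obtained by eliminating
  \<open>z\<^sub>2\<close>; so the line has finitely many points of the curve.\<close>
lemma branch_curve_not_UNIV: "branch_curve \<noteq> UNIV"
proof
  assume univ: "branch_curve = UNIV"
  \<comment> \<open>a critical point of \<open>T\<^sub>d\<^sub>2\<close>; there \<open>H\<close> reduces to one square, which \<open>t\<close> makes nonzero\<close>
  define r where "r = cos (real 1 * pi / real d2)"
  have d22: "1 < d2" using d1 d12 by simp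
  have "poly (pderiv f) r = 0"
  proof -
    have "sin (real 1 * pi / real d2) > 0" using d22 by (intro sin_gt_zero) (auto simp: field_simps)
    moreover have "poly (pderiv f) r * sin (real 1 * pi / real d2) = 0"
      unfolding r_def pderiv_cheb_cos using d2 by simp
    ultimately show ?thesis by simp
  qed
  then have r2: "poly (pderiv c2) (of_real r) = 0" by (simp add: poly_pderiv_cheb_of_real)
  then have r1: "poly (pderiv c1) (of_real r) \<noteq> 0"
    using pderiv_cheb_no_common_zero[OF d1 d2 cop, of "of_real r"] by blast
  obtain t where t: "k * of_real r - t * poly (pderiv c1) (of_real r) \<noteq> 0"
  proof (cases "r = 0")
    case True then show ?thesis using that[of 1] r1 by simp
  next
    case False then show ?thesis using that[of 0] k_nonzero by simp
  qed
  define x where "x = poly c1 (of_real r) + t"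
  define H where "H = ([:0, k:] - ([:x:] - c1) * pderiv c1)\<^sup>2 - (pderiv c2)\<^sup>2 * ([:k, 0, -k:] - ([:x:] - c1)\<^sup>2)"
  have "poly H (of_real r) = (k * of_real r - t * poly (pderiv c1) (of_real r))\<^sup>2"
    by (simp add: H_def r2 x_def algebra_simps)
  then have "H \<noteq> 0" using t by auto
  then have fin: "finite {u. poly H u = 0}" by (rule poly_roots_finite)
  define v where "v u = k * (1 - u\<^sup>2) - (x - poly c1 u)\<^sup>2" for u
  have "UNIV \<subseteq> (\<Union>u\<in>{u. poly H u = 0}. {y. poly [:(poly c2 u)\<^sup>2 - v u, - 2 * poly c2 u, 1:] y = 0})"
  proof
    fix y :: complex
    have "vector [x, y] \<in> branch_curve" using univ by simp
    then obtain u where "crit u (vector [x, y])" by (auto simp: branch_curve_def)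
    then have 1: "(x - poly c1 u)\<^sup>2 + (y - poly c2 u)\<^sup>2 = k * (1 - u\<^sup>2)"
      and 2: "poly (pderiv c1) u * (x - poly c1 u) + poly (pderiv c2) u * (y - poly c2 u) = k * u"
      by (simp_all add: crit_def)
    have y: "(y - poly c2 u)\<^sup>2 = v u" using 1 by (simp add: v_def algebra_simps)
    have "k * u - (x - poly c1 u) * poly (pderiv c1) u = poly (pderiv c2) u * (y - poly c2 u)"
      using 2 by (simp add: algebra_simps)
    then have "(k * u - (x - poly c1 u) * poly (pderiv c1) u)\<^sup>2 = (poly (pderiv c2) u)\<^sup>2 * v u"
      unfolding y[symmetric] by (simp add: power_mult_distrib)
    then have "poly H u = 0" by (simp add: H_def v_def power2_eq_square algebra_simps)
    moreover have "poly [:(poly c2 u)\<^sup>2 - v u, - 2 * poly c2 u, 1:] y = 0"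
      unfolding y[symmetric] by (simp add: power2_eq_square algebra_simps)
    ultimately show "y \<in> (\<Union>u\<in>{u. poly H u = 0}. {y. poly [:(poly c2 u)\<^sup>2 - v u, - 2 * poly c2 u, 1:] y = 0})"
      by blast
  qed
  moreover have "finite (\<Union>u\<in>{u. poly H u = 0}. {y. poly [:(poly c2 u)\<^sup>2 - v u, - 2 * poly c2 u, 1:] y = 0})"
    using fin by (rule finite_UN_I) (rule poly_roots_finite, simp)
  ultimately have "finite (UNIV :: complex set)" by (rule finite_subset)
  then show False using infinite_UNIV_char_0 by blast
qed

end

section \<open>The equation of the branch curve\<close>

abbreviation (input) "const2 \<equiv> (\<lambda>a::complex. [:[:a:]:])"

lemma eval2_const2 [simp]: "eval2 [:[:a:]:] z = a" by (simp add: eval2_def)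

lemma map_eval2_const2: "map_poly (\<lambda>P. eval2 P z) (map_poly const2 c) = c"
  by (rule poly_eqI) (simp add: coeff_map_poly)

lemma pwbound_const: "wbound d P w \<Longrightarrow> pwbound d [:P:] w"
  by (auto simp: pwbound_def coeff_pCons split: nat.split)

lemma pwbound_map_const2:
  assumes "degree c \<le> m" shows "pwbound d (map_poly const2 c) (int m)"
  unfolding pwbound_def
proof
  fix n
  show "wbound d (coeff (map_poly const2 c) n) (int m - int n)"
  proof (cases "n \<le> m")
    case True then show ?thesis by (simp add: coeff_map_poly wbound_const)
  next
    case False then show ?thesis using assms by (simp add: coeff_map_poly coeff_eq_0)
  qed
qed

lemma wbound_x: "wbound d [:[:0, 1:]:] (int d)"
  unfolding wbound_def
proof (intro allI impI)
  fix i j assume h: "coeff (coeff [:[:0, 1:]:] j) i \<noteq> (0::complex)"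
  have "j = 0" using h by (cases j) auto
  moreover have "i \<le> 1" using h \<open>j = 0\<close> by (auto simp: coeff_pCons split: nat.splits)
  ultimately show "int (d * (i + j)) \<le> int d" by (simp add: mult_le_cancel_left2)
qed

lemma wbound_y: "wbound d [:0, 1:] (int d)"
  unfolding wbound_def
proof (intro allI impI)
  fix i j assume h: "coeff (coeff [:0, 1:] j) i \<noteq> (0::complex)"
  then have "coeff [:0, 1:] j \<noteq> (0 :: complex poly)" by auto
  then have "j \<le> 1" using le_degree[of "[:0, 1 :: complex poly:]" j] by simp
  moreover have "j \<noteq> 0" using h by (cases j) auto
  ultimately have j: "j = 1" by simp
  then have "i = 0" using h le_degree[of "1 :: complex poly" i] by simp
  with j show "int (d * (i + j)) \<le> int d" by simp
qed

lemma partial_derivI: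
  assumes "((\<lambda>t. F (\<chi> k. if k = j then t else p $ k)) has_field_derivative d) (at (p $ j))"
  shows "partial_deriv F j p = d"
  unfolding partial_deriv_def by (rule DERIV_imp_deriv) (rule assms)

text \<open>Removing finitely many points does not disconnect the plane.\<close>
lemma infinite_frontier_of_bounded:
  fixes S :: "(real^2) set"
  assumes "bounded S" "interior S \<noteq> {}" shows "infinite (frontier S)"
proof
  assume fin: "finite (frontier S)"
  have "connected (- frontier S)"
    by (intro path_connected_imp_connected path_connected_complement_countable countable_finite fin) simp
  moreover have "- frontier S \<inter> S \<noteq> {}" using assms(2) interior_subset[of S] by (auto simp: frontier_def)
  moreover have "- frontier S - S \<noteq> {}"
  proof
    assume "- frontier S - S = {}"
    then have "UNIV = closure S" using closure_subset[of S] by (auto simp: frontier_def)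
    then show False using assms(1) by (metis bounded_closure not_bounded_UNIV)
  qed
  ultimately have "- frontier S \<inter> frontier S \<noteq> {}" by (rule connected_Int_frontier)
  then show False by simp
qed

context cheb_tube begin

lemma d2_ge_2: "2 \<le> d2" using d1 d12 by simp

text \<open>As a polynomial in the outer variable \<open>u\<close> this is \<open>(x -
  T\<^sub>d\<^sub>1(u))\<^sup>2 + (y - T\<^sub>d\<^sub>2(u))\<^sup>2 - e\<^sup>2 (1 -
  u\<^sup>2)\<close>, the equation of the circle of the family that has parameter \<open>u\<close>.
  The branch curve is the envelope of the family, the locus where this polynomial has a double root;
  \<open>family_at z\<close> is the specialisation at the point \<open>z\<close>.\<close>
definition family_poly :: "complex poly poly poly" where
  "family_poly = ([:[:[:0, 1:]:]:] - map_poly const2 c1)\<^sup>2 + ([:[:0, 1:]:] - map_poly const2 c2)\<^sup>2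
     - map_poly const2 [:k, 0, -k:]"

definition family_at :: "complex^2 \<Rightarrow> complex poly" where
  "family_at z = ([:z$1:] - c1)\<^sup>2 + ([:z$2:] - c2)\<^sup>2 - [:k, 0, -k:]"

lemma map_family_poly: "map_poly (\<lambda>P. eval2 P z) family_poly = family_at z"
proof -
  interpret comm_ring_hom "\<lambda>P. eval2 P z" by (rule eval2_hom)
  interpret m: map_poly_comm_ring_hom "\<lambda>P. eval2 P z" by unfold_locales
  have "map_poly (\<lambda>P. eval2 P z) [:[:[:0, 1:]:]:] = [:z$1:]" "map_poly (\<lambda>P. eval2 P z) [:[:0, 1:]:] = [:z$2:]"
    by (simp_all add: map_poly_pCons_hom eval2_def)
  then show ?thesis
    unfolding family_poly_def family_at_def power2_eq_square
    by (simp only: m.hom_add m.hom_minus m.hom_mult map_eval2_const2)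
qed

lemma degree_c: "degree c1 = d1" "degree c2 = d2"
  using degree_cheb[of d1, where 'a = complex] degree_cheb[of d2, where 'a = complex] by auto

lemma degree_family_at: "degree (family_at z) = 2 * d2"
proof -
  have "degree ([:z$2:] - c2) = d2"
    using degree_add_eq_right[of "[:z$2:]" "- c2"] d2 by (simp add: degree_c)
  moreover from this have "[:z$2:] - c2 \<noteq> 0" using d2 by auto
  ultimately have 2: "degree (([:z$2:] - c2)\<^sup>2) = 2 * d2" by (simp add: degree_power_eq)
  have "degree ([:z$1:] - c1) \<le> d1" by (rule degree_diff_le) (simp_all add: degree_c)
  then have "degree (([:z$1:] - c1)\<^sup>2) \<le> d1 * 2" using degree_power_le[of "[:z$1:] - c1" 2] by simp
  then have a: "degree (([:z$1:] - c1)\<^sup>2) < 2 * d2" using d12 by simp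
  have b: "degree [:k, 0, -k:] < 2 * d2" using d2_ge_2 by simp
  have "degree (([:z$1:] - c1)\<^sup>2 - [:k, 0, -k:]) < 2 * d2" using a b by (rule degree_diff_less)
  then have "degree (([:z$2:] - c2)\<^sup>2 + (([:z$1:] - c1)\<^sup>2 - [:k, 0, -k:])) = 2 * d2"
    using 2 by (subst degree_add_eq_left) auto
  then show ?thesis by (simp add: family_at_def algebra_simps)
qed

lemma degree_family_poly: "degree family_poly = 2 * d2"
proof (rule antisym)
  have m: "degree (map_poly const2 c) = degree c" for c by (rule degree_map_poly) simp
  have "degree ([:[:[:0, 1:]:]:] - map_poly const2 c1) \<le> d2"
    using d12 by (intro degree_diff_le) (simp_all add: degree_c m)
  then have 1: "degree (([:[:[:0, 1:]:]:] - map_poly const2 c1)\<^sup>2) \<le> d2 * 2"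
    using degree_power_le[of "[:[:[:0, 1:]:]:] - map_poly const2 c1" 2] by simp
  have "degree ([:[:0, 1:]:] - map_poly const2 c2) \<le> d2"
    by (intro degree_diff_le) (simp_all add: degree_c m)
  then have 2: "degree (([:[:0, 1:]:] - map_poly const2 c2)\<^sup>2) \<le> d2 * 2"
    using degree_power_le[of "[:[:0, 1:]:] - map_poly const2 c2" 2] by simp
  have 3: "degree (map_poly const2 [:k, 0, -k:]) \<le> d2 * 2" unfolding m using d2_ge_2 by simp
  show "degree family_poly \<le> 2 * d2" unfolding family_poly_def using 1 2 3 by (intro degree_diff_le degree_add_le) simp_all
  have "coeff (family_at 0) (2 * d2) \<noteq> 0" using degree_family_at[of 0] d2 by (metis degree_0 leading_coeff_0_iff mult_eq_0_iff less_irrefl zero_neq_numeral)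
  then have "coeff family_poly (2 * d2) \<noteq> 0" unfolding map_family_poly[symmetric] by (auto simp: coeff_map_poly)
  then show "2 * d2 \<le> degree family_poly" by (rule le_degree)
qed

lemma double_root_iff_crit: "poly (family_at z) u = 0 \<and> poly (pderiv (family_at z)) u = 0 \<longleftrightarrow> crit u z"
proof -
  have 1: "poly (family_at z) u = (z$1 - poly c1 u)\<^sup>2 + (z$2 - poly c2 u)\<^sup>2 - k * (1 - u\<^sup>2)"
    by (simp add: family_at_def power2_eq_square algebra_simps)
  have 2: "poly (pderiv (family_at z)) u = 2 * (k * u - (poly (pderiv c1) u * (z$1 - poly c1 u) + poly (pderiv c2) u * (z$2 - poly c2 u)))"
  proof -
    define A where "A = [:z$1:] - c1"
    define B where "B = [:z$2:] - c2"
    have dA: "pderiv A = - pderiv c1" and dB: "pderiv B = - pderiv c2" and dk: "pderiv [:k, 0, -k:] = [:0, -2 * k:]"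
      by (simp_all add: A_def B_def pderiv_diff pderiv_pCons)
    have "family_at z = A * A + B * B - [:k, 0, -k:]" by (simp add: family_at_def A_def B_def power2_eq_square)
    then have pd: "pderiv (family_at z) = A * (- pderiv c1) + A * (- pderiv c1) + (B * (- pderiv c2) + B * (- pderiv c2)) - [:0, -2 * k:]"
      by (simp only: pderiv_add pderiv_diff pderiv_mult dA dB dk)
    have AB: "poly A u = z$1 - poly c1 u" "poly B u = z$2 - poly c2 u" by (simp_all add: A_def B_def)
    show ?thesis unfolding pd by (simp add: AB algebra_simps)
  qed
  have 3: "2 * (a - b) = 0 \<longleftrightarrow> b = a" for a b :: complex by auto
  show ?thesis unfolding 1 2 3 crit_def right_minus_eq ..
qed

definition branch_poly :: "complex poly poly" where "branch_poly = resultant family_poly (pderiv family_poly)"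

text \<open>The leading coefficient in \<open>u\<close> is constant, so the resultant commutes with evaluation
  at \<open>z\<close>.\<close>
lemma eval2_branch_poly: "eval2 branch_poly z = 0 \<longleftrightarrow> z \<in> branch_curve"
proof -
  interpret idom_hom "\<lambda>P. eval2 P z" by (simp add: idom_hom_def eval2_hom)
  have dG: "degree (map_poly (\<lambda>P. eval2 P z) family_poly) = degree family_poly" by (simp add: map_family_poly degree_family_at degree_family_poly)
  have m: "map_poly (\<lambda>P. eval2 P z) (pderiv family_poly) = pderiv (family_at z)" by (simp add: map_poly_pderiv map_family_poly[symmetric])
  have "resultant (map_poly (\<lambda>P. eval2 P z) family_poly) (map_poly (\<lambda>P. eval2 P z) (pderiv family_poly)) = eval2 branch_poly z"
    unfolding branch_poly_def by (rule resultant_map_poly[OF dG]) (simp add: m degree_pderiv degree_family_at degree_family_poly)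
  then have "eval2 branch_poly z = resultant (family_at z) (pderiv (family_at z))" by (simp add: map_family_poly m)
  moreover have "family_at z \<noteq> 0" using degree_family_at[of z] d2 by auto
  ultimately have "eval2 branch_poly z = 0 \<longleftrightarrow> (\<exists>u. poly (family_at z) u = 0 \<and> poly (pderiv (family_at z)) u = 0)"
    by (simp only: resultant_eq_0_iff_common_root not_False_eq_True)
  then show ?thesis unfolding double_root_iff_crit branch_curve_def by simp
qed

lemma branch_poly_nonzero: "branch_poly \<noteq> 0"
proof
  assume "branch_poly = 0"
  then have "z \<in> branch_curve" for z using eval2_branch_poly[of z] by simp
  then show False using branch_curve_not_UNIV by blast
qed

text \<open>For weight 1 of \<open>u\<close> and weight \<open>d\<^sub>2\<close> of \<open>x\<close> and
  \<open>y\<close> the resultant has weight at most \<open>2 d\<^sub>2 (2 d\<^sub>2 - 1)\<close>, and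
  its variables all have weight \<open>d\<^sub>2\<close>.\<close>
lemma total_deg_branch_poly: "total_deg branch_poly \<le> 4 * d2 - 2"
proof -
  have x: "pwbound d2 ([:[:[:0, 1:]:]:] - map_poly const2 c1) (int d2)"
    using d12 by (intro pwbound_diff pwbound_const wbound_x pwbound_map_const2) (simp add: degree_c)
  have y: "pwbound d2 ([:[:0, 1:]:] - map_poly const2 c2) (int d2)"
    by (intro pwbound_diff pwbound_const wbound_y pwbound_map_const2) (simp add: degree_c)
  have "degree [:k, 0, -k:] \<le> d2 + d2" using d2_ge_2 by simp
  from pwbound_map_const2[OF this] have c: "pwbound d2 (map_poly const2 [:k, 0, -k:]) (int d2 + int d2)" by simp
  have "pwbound d2 family_poly (int d2 + int d2)"
    unfolding family_poly_def power2_eq_square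
    by (rule pwbound_diff[OF pwbound_add[OF pwbound_mult[OF x x] pwbound_mult[OF y y]] c])
  then have G: "pwbound d2 family_poly (int (degree family_poly))" by (simp add: degree_family_poly)
  have "pwbound d2 (pderiv family_poly) (int (degree family_poly) - 1)" by (rule pwbound_pderiv[OF G])
  then have G': "pwbound d2 (pderiv family_poly) (int (degree (pderiv family_poly)))" using d2 by (simp add: degree_pderiv degree_family_poly)
  have w: "wbound d2 branch_poly (int (2 * d2 * (2 * d2 - 1)))"
    using wbound_resultant[OF G G'] by (simp add: branch_poly_def degree_pderiv degree_family_poly)
  show ?thesis unfolding total_deg_le
  proof (intro allI impI)
    fix i j assume "coeff (coeff branch_poly j) i \<noteq> 0"
    then have "int (d2 * (i + j)) \<le> int (2 * d2 * (2 * d2 - 1))" using w unfolding wbound_def by blast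
    then have "d2 * (i + j) \<le> d2 * (2 * (2 * d2 - 1))" by (simp only: of_nat_le_iff mult_ac)
    then have "i + j \<le> 2 * (2 * d2 - 1)" using d2 by simp
    then show "i + j \<le> 4 * d2 - 2" by simp
  qed
qed

text \<open>A frontier point touches a disc without being inside any other one, so it satisfies the contact
  conditions, which are the real form of \<open>crit\<close>.\<close>
lemma frontier_in_branch_curve: "complexify ` frontier (tube e) \<subseteq> branch_curve"
proof
  fix w assume "w \<in> complexify ` frontier (tube e)"
  then obtain z where z: "z \<in> frontier (tube e)" "w = complexify z" by blast
  have "z \<in> tube e" using z(1) compact_imp_closed[OF compact_tube[OF e]] by (auto simp: frontier_def)
  then obtain u where u: "\<bar>u\<bar> \<le> 1" "(norm (z - gam u))\<^sup>2 \<le> e\<^sup>2 * (1 - u\<^sup>2)" by (auto simp: tube_def abs_le_iff)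
  have above: "above_tube e z" unfolding above_tube_def
  proof (intro allI impI)
    fix v :: real assume v: "\<bar>v\<bar> \<le> 1"
    have "- tube e \<subseteq> {z. e\<^sup>2 * (1 - v\<^sup>2) \<le> (norm (z - gam v))\<^sup>2}"
    proof
      fix x assume x: "x \<in> - tube e"
      have "v \<in> {-1..1}" using v by auto
      then have "\<not> (norm (x - gam v))\<^sup>2 \<le> e\<^sup>2 * (1 - v\<^sup>2)" using x unfolding tube_def by blast
      then show "x \<in> {z. e\<^sup>2 * (1 - v\<^sup>2) \<le> (norm (z - gam v))\<^sup>2}" by simp
    qed
    moreover have "closed {z. e\<^sup>2 * (1 - v\<^sup>2) \<le> (norm (z - gam v))\<^sup>2}"
      by (intro closed_Collect_le continuous_intros)
    moreover have "z \<in> closure (- tube e)" using z(1) by (simp add: frontier_def closure_complement)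
    ultimately show "e\<^sup>2 * (1 - v\<^sup>2) \<le> (norm (z - gam v))\<^sup>2" using closure_minimal by blast
  qed
  then have t: "touch e z u" using u by (auto simp: touch_def above_tube_def intro: antisym)
  have n: "(z$1 - poly g u)\<^sup>2 + (z$2 - poly f u)\<^sup>2 = e\<^sup>2 * (1 - u\<^sup>2)" using t by (simp add: touch_def norm2_sq)
  have p: "poly (pderiv g) u * (z$1 - poly g u) + poly (pderiv f) u * (z$2 - poly f u) = e\<^sup>2 * u"
    using touch_interior(2)[OF e above t] by (simp add: inner2 mult.commute)
  have w: "w$1 = of_real (z$1)" "w$2 = of_real (z$2)" by (simp_all add: z(2) complexify_def)
  have "crit (of_real u) w"
    by (simp only: crit_def w poly_cheb_of_real poly_pderiv_cheb_of_real k_def of_real_diff[symmetric]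
        of_real_power[symmetric] of_real_add[symmetric] of_real_mult[symmetric] of_real_1[where 'a = complex, symmetric] n p)
  then show "w \<in> branch_curve" by (auto simp: branch_curve_def)
qed

lemma infinite_frontier: "infinite (complexify ` frontier (tube e))"
proof -
  have "ball (gam 0) e \<subseteq> tube e"
  proof
    fix z assume "z \<in> ball (gam 0) e"
    then have "norm (z - gam 0) \<le> e" by (simp add: dist_norm norm_minus_commute)
    then have "(norm (z - gam 0))\<^sup>2 \<le> e\<^sup>2 * (1 - 0\<^sup>2)" using power_mono[of _ e 2] by fastforce
    then show "z \<in> tube e" unfolding tube_def by (intro CollectI bexI[of _ 0]) auto
  qed
  then have "gam 0 \<in> interior (tube e)" using e by (intro interiorI[of "ball (gam 0) e"]) auto
  then have "infinite (frontier (tube e))"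
    using compact_imp_bounded[OF compact_tube[OF e]] by (intro infinite_frontier_of_bounded) auto
  moreover have "inj complexify" by (auto simp: inj_def complexify_def Finite_Cartesian_Product.vec_eq_iff)
  ultimately show ?thesis by (metis finite_imageD inj_on_subset subset_UNIV)
qed

lemma infinite_branch_curve: "infinite branch_curve" using frontier_in_branch_curve infinite_frontier finite_subset by blast

lemma closure_infinite_subset:
  assumes "infinite J" "J \<subseteq> branch_curve" shows "zariski_closure J = branch_curve"
proof
  show "zariski_closure J \<subseteq> branch_curve" using assms(2) eval2_branch_poly unfolding zariski_closure_def by blast
  show "branch_curve \<subseteq> zariski_closure J" using vanish_on_branch_curve[OF assms] unfolding zariski_closure_def by blast
qed

lemma vanish_mult:
  assumes "\<And>z. z \<in> branch_curve \<Longrightarrow> eval2 (A * B) z = 0"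
  shows "(\<forall>z\<in>branch_curve. eval2 A z = 0) \<or> (\<forall>z\<in>branch_curve. eval2 B z = 0)"
proof -
  define YA where "YA = {z \<in> branch_curve. eval2 A z = 0}"
  define YB where "YB = {z \<in> branch_curve. eval2 B z = 0}"
  have "branch_curve \<subseteq> YA \<union> YB" using assms by (auto simp: eval2_mult YA_def YB_def)
  then have "infinite YA \<or> infinite YB" using infinite_branch_curve finite_subset by blast
  moreover have "\<forall>z\<in>branch_curve. eval2 A z = 0" if "infinite YA"
    using vanish_on_branch_curve[OF that] by (simp add: YA_def)
  moreover have "\<forall>z\<in>branch_curve. eval2 B z = 0" if "infinite YB"
    using vanish_on_branch_curve[OF that] by (simp add: YB_def)
  ultimately show ?thesis by blast
qed

text \<open>A product vanishing on the curve has a factor vanishing on it, so some prime factor \<open>P\<close>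
  of the resultant does. The zero set of \<open>P\<close> contains the curve and is contained in the
  zero set of the resultant, which is the curve.\<close>
lemma irreducible_branch_curve: "\<exists>n\<le>4 * d2 - 2. irreducible_plane_curve branch_curve n"
proof -
  obtain A where A: "\<forall>x. x \<in># A \<longrightarrow> prime_elem x" "normalize (prod_mset A) = normalize branch_poly"
    using prime_factorization_exists[OF branch_poly_nonzero] by blast
  have "branch_poly dvd prod_mset A" using A(2) by (simp add: associatedD2)
  then have van: "\<forall>z\<in>branch_curve. eval2 (prod_mset A) z = 0" using eval2_branch_poly eval2_dvd by blast
  have "\<exists>P\<in>#A. \<forall>z\<in>branch_curve. eval2 P z = 0" using van
  proof (induction A)
    case empty
    then show ?case using infinite_branch_curve by auto
  next
    case (add x A)
    then show ?case using vanish_mult[of x "prod_mset A"] by auto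
  qed
  then obtain P where P: "P \<in># A" "\<forall>z\<in>branch_curve. eval2 P z = 0" by blast
  have "P dvd prod_mset A" using P(1) by (rule dvd_prod_mset)
  then have PR: "P dvd branch_poly" using A(2) by (metis associatedD1 dvd_trans)
  have "irreducible P" using A(1) P(1) by (simp add: prime_elem_imp_irreducible)
  moreover have "branch_curve = {z. eval2 P z = 0}" using P(2) eval2_branch_poly eval2_dvd[OF PR] by blast
  moreover have "total_deg P \<le> 4 * d2 - 2" using total_deg_dvd_mono[OF PR branch_poly_nonzero] total_deg_branch_poly by simp
  ultimately show ?thesis unfolding irreducible_plane_curve_def by blast
qed

lemma three_distinct: "(1::3) \<noteq> 2" "(1::3) \<noteq> 3" "(2::3) \<noteq> 3" "(2::3) \<noteq> 1" "(3::3) \<noteq> 1" "(3::3) \<noteq> 2"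
  by simp_all

lemma jacobian_value:
  "jacobian_det (\<lambda>q. vector [phi d1 d2 E q $ 1, phi d1 d2 E q $ 2, sphere_eq q]) p =
    2 * E * (poly (pderiv c1) (p$1) * p$2 + poly (pderiv c2) (p$1) * p$3 - E * p$1)"
proof -
  have phi: "phi d1 d2 E q $ 1 = poly c1 (q$1) + E * q$2" "phi d1 d2 E q $ 2 = poly c2 (q$1) + E * q$3" for q
    by (simp_all add: phi_def)
  have J: "partial_deriv (\<lambda>q. phi d1 d2 E q $ 1) 1 p = poly (pderiv c1) (p$1)"
    "partial_deriv (\<lambda>q. phi d1 d2 E q $ 1) 2 p = E" "partial_deriv (\<lambda>q. phi d1 d2 E q $ 1) 3 p = 0"
    "partial_deriv (\<lambda>q. phi d1 d2 E q $ 2) 1 p = poly (pderiv c2) (p$1)"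
    "partial_deriv (\<lambda>q. phi d1 d2 E q $ 2) 2 p = 0" "partial_deriv (\<lambda>q. phi d1 d2 E q $ 2) 3 p = E"
    "partial_deriv sphere_eq 1 p = - 2 * p$1"
    "partial_deriv sphere_eq 2 p = - 2 * p$2" "partial_deriv sphere_eq 3 p = - 2 * p$3"
    unfolding phi sphere_eq_def
    by (rule partial_derivI; simp add: three_distinct; auto intro!: derivative_eq_intros poly_DERIV)+
  show ?thesis unfolding jacobian_det_def det_3 by (simp add: J algebra_simps)
qed

text \<open>The Jacobian determinant is the second equation of \<open>crit\<close> up to a nonzero factor.\<close>
lemma branch_points:
  "phi d1 d2 (complex_of_real e) ` {p. sphere_eq p = 0 \<and>
     jacobian_det (\<lambda>q. vector [phi d1 d2 (complex_of_real e) q $ 1, phi d1 d2 (complex_of_real e) q $ 2, sphere_eq q]) p = 0} = branch_curve"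
proof -
  define E where "E = complex_of_real e"
  have E: "E \<noteq> 0" "k = E\<^sup>2" using e by (simp_all add: E_def k_def)
  have "phi d1 d2 E ` {p. sphere_eq p = 0 \<and> poly (pderiv c1) (p$1) * p$2 + poly (pderiv c2) (p$1) * p$3 - E * p$1 = 0} = branch_curve"
  proof (intro equalityI subsetI)
    fix z assume "z \<in> phi d1 d2 E ` {p. sphere_eq p = 0 \<and> poly (pderiv c1) (p$1) * p$2 + poly (pderiv c2) (p$1) * p$3 - E * p$1 = 0}"
    then obtain p where p: "sphere_eq p = 0" "poly (pderiv c1) (p$1) * p$2 + poly (pderiv c2) (p$1) * p$3 = E * p$1" "z = phi d1 d2 E p" by auto
    have z: "z$1 - poly c1 (p$1) = E * p$2" "z$2 - poly c2 (p$1) = E * p$3" by (simp_all add: p(3) phi_def)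
    have "(p$2)\<^sup>2 + (p$3)\<^sup>2 = 1 - (p$1)\<^sup>2" using p(1) by (simp add: sphere_eq_def algebra_simps)
    then have "E\<^sup>2 * ((p$2)\<^sup>2 + (p$3)\<^sup>2) = k * (1 - (p$1)\<^sup>2)" by (simp add: E)
    moreover have "E * (poly (pderiv c1) (p$1) * p$2 + poly (pderiv c2) (p$1) * p$3) = k * p$1"
      unfolding p(2) by (simp add: E power2_eq_square)
    ultimately have "crit (p$1) z" unfolding crit_def z by (simp add: power_mult_distrib algebra_simps)
    then show "z \<in> branch_curve" by (auto simp: branch_curve_def)
  next
    fix z assume "z \<in> branch_curve"
    then obtain u where u: "crit u z" by (auto simp: branch_curve_def)
    define v where "v = (z$1 - poly c1 u) / E"
    define w where "w = (z$2 - poly c2 u) / E"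
    have zz: "z$1 - poly c1 u = E * v" "z$2 - poly c2 u = E * w" using E by (simp_all add: v_def w_def)
    define p where "p = (vector [u, v, w] :: complex^3)"
    have pn: "p$1 = u" "p$2 = v" "p$3 = w" by (simp_all add: p_def)
    have "E\<^sup>2 * (v\<^sup>2 + w\<^sup>2) = E\<^sup>2 * (1 - u\<^sup>2)" "E * (poly (pderiv c1) u * v + poly (pderiv c2) u * w) = E * (E * u)"
      using u unfolding crit_def zz by (simp_all add: E(2) power_mult_distrib algebra_simps power2_eq_square)
    then have "v\<^sup>2 + w\<^sup>2 = 1 - u\<^sup>2" "poly (pderiv c1) u * v + poly (pderiv c2) u * w = E * u" using E(1) by simp_all
    then have "sphere_eq p = 0 \<and> poly (pderiv c1) (p$1) * p$2 + poly (pderiv c2) (p$1) * p$3 - E * p$1 = 0"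
      by (simp add: sphere_eq_def pn algebra_simps)
    moreover have "z = phi d1 d2 E p" using zz by (simp add: vec2_eq_iff phi_def pn algebra_simps)
    ultimately show "z \<in> phi d1 d2 E ` {p. sphere_eq p = 0 \<and> poly (pderiv c1) (p$1) * p$2 + poly (pderiv c2) (p$1) * p$3 - E * p$1 = 0}" by blast
  qed
  then show ?thesis unfolding jacobian_value E_def[symmetric] using E(1) by simp
qed

theorem algebraic_boundary_tube:
  "(\<exists>n. n \<le> 4 * d2 - 2 \<and> irreducible_plane_curve (algebraic_boundary (phi d1 d2 e ` unit_ball)) n) \<and>
   algebraic_boundary (phi d1 d2 e ` unit_ball) = branch_locus (phi d1 d2 (complex_of_real e)) sphere_eq"
proof -
  have "algebraic_boundary (phi d1 d2 e ` unit_ball) = branch_curve"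
    unfolding algebraic_boundary_def phi_image_ball[OF e]
    by (rule closure_infinite_subset[OF infinite_frontier frontier_in_branch_curve])
  moreover have "branch_locus (phi d1 d2 (complex_of_real e)) sphere_eq = branch_curve"
    unfolding branch_locus_def branch_points by (rule closure_infinite_subset[OF infinite_branch_curve order_refl])
  ultimately show ?thesis using irreducible_branch_curve by auto
qed

end

theorem theorem2:
  fixes d1 d2 :: nat
  assumes "0 < d1" and "d1 < d2" and "coprime d1 d2"
  shows "\<exists>\<epsilon>\<^sub>0>0. \<forall>\<epsilon>::real. 0 < \<epsilon> \<and> \<epsilon> < \<epsilon>\<^sub>0 \<longrightarrow>
      finite (components (- (phi d1 d2 \<epsilon> ` unit_ball))) \<and>
      real (card (components (- (phi d1 d2 \<epsilon> ` unit_ball)))) =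
        (real d1 - 1) * (real d2 - 1) / 2 + 1 \<and>
      (\<exists>n. n \<le> 4 * d2 - 2 \<and>
        irreducible_plane_curve (algebraic_boundary (phi d1 d2 \<epsilon> ` unit_ball)) n) \<and>
      algebraic_boundary (phi d1 d2 \<epsilon> ` unit_ball) =
        branch_locus (phi d1 d2 (complex_of_real \<epsilon>)) sphere_eq"
proof -
  interpret cheb_curve d1 d2 by unfold_locales (use assms in auto)
  obtain \<epsilon>0 where \<epsilon>0: "\<epsilon>0 > 0" "\<And>\<epsilon>. 0 < \<epsilon> \<Longrightarrow> \<epsilon> < \<epsilon>0 \<Longrightarrow> finite (components (- (phi d1 d2 \<epsilon> ` unit_ball))) \<and>
      real (card (components (- (phi d1 d2 \<epsilon> ` unit_ball)))) = (real d1 - 1) * (real d2 - 1) / 2 + 1"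
    using components_of_complement by blast
  show ?thesis
  proof (intro exI[of _ \<epsilon>0] conjI \<epsilon>0(1) allI impI; elim conjE)
    fix \<epsilon> :: real assume small: "0 < \<epsilon>" "\<epsilon> < \<epsilon>0"
    interpret cheb_tube d1 d2 \<epsilon> by unfold_locales (rule small(1))
    show "finite (components (- (phi d1 d2 \<epsilon> ` unit_ball)))"
      "real (card (components (- (phi d1 d2 \<epsilon> ` unit_ball)))) = (real d1 - 1) * (real d2 - 1) / 2 + 1"
      using \<epsilon>0(2)[OF small] by auto
    show "\<exists>n. n \<le> 4 * d2 - 2 \<and> irreducible_plane_curve (algebraic_boundary (phi d1 d2 \<epsilon> ` unit_ball)) n"
      "algebraic_boundary (phi d1 d2 \<epsilon> ` unit_ball) = branch_locus (phi d1 d2 (complex_of_real \<epsilon>)) sphere_eq"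
      using algebraic_boundary_tube by auto
  qed
qed

end
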